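(* Let $\Bbbk$ be an algebraically closed field of characteristic $0$ and let $R=\Bbbk\langle x_1,\dots,x_n\rangle$ be the free associative algebra. The following are equivalent for $f,g\in R$: (i) for infinitely many $k\in\mathbb N$ there is a Zariski dense set $\mathcal D_k\subseteq M_k(\Bbbk)^n$ such that $f(\underline X)$ and $g(\underline X)$ share an eigenvalue for every $\underline X\in\mathcal D_k$; (ii) $f$ and $g$ are isospectral; (iii) $f$ and $g$ are intertwined; (iv) there exist $\ell\in\mathbb N$ and $f_1,\dots,f_\ell\in R$ with $f_1=f$ and $f_\ell=g$ such that $f_i$ and $f_{i+1}$ are elementary intertwined for all $1\le i\le \ell-1$.
   Context: For $\underline X\in M_k(\Bbbk)^n$, $f(\underline X)\in M_k(\Bbbk)$ denotes the evaluation $x_j\mapsto X_j$. $f,g\in R$ are isospectral if the eigenvalues of $f(\underline X)$ and $g(\underline X)$ coincide (same spectrum) for all $k\in\mathbb N$ and all $\underline X\in M_k(\Bbbk)^n$. They are intertwined if there exists a nonzero $a\in R$ with $fa=ag$. They are elementary intertwined if there exist $\lambda\in\Bbbk$ and $a,b\in R$ with $f=\lambda+ab$ and $g=\lambda+ba$. *)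

theory Defs
  imports
    "HOL-Library.Poly_Mapping"
    "HOL-Computational_Algebra.Polynomial"
    "HOL-Analysis.Abstract_Topology"
    "Jordan_Normal_Form.Spectral_Radius"
begin

section \<open>The free associative algebra\<close>

text \<open>A separate type of words is used because the sum of two lists is not concatenation in
  the additive type classes on which the ring structure of \<^type>\<open>poly_mapping\<close> is based.\<close>

datatype 'n free_monoid = Word (letters: "'n list")

instantiation free_monoid :: (type) monoid_add
begin

definition zero_free_monoid :: "'a free_monoid" where
  "0 = Word []"

definition plus_free_monoid :: "'a free_monoid \<Rightarrow> 'a free_monoid \<Rightarrow> 'a free_monoid" where
  "u + v = Word (letters u @ letters v)"

instance
  by standard (simp_all add: zero_free_monoid_def plus_free_monoid_def)

end

text \<open>The monoid algebra of the free monoid. Its multiplication is the convolution product, so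
  for a finite index type \<open>'n\<close> with \<open>n\<close> elements it is the algebra of noncommutative polynomials
  in \<open>n\<close> variables; the variable \<open>x\<^sub>j\<close> is \<open>Poly_Mapping.single (Word [j]) 1\<close>.\<close>

type_synonym ('n, 'k) free_algebra = "'n free_monoid \<Rightarrow>\<^sub>0 'k"

definition scalar :: "'k::field \<Rightarrow> ('n, 'k) free_algebra" where
  "scalar c = Poly_Mapping.single 0 c"


section \<open>Evaluation at tuples of matrices\<close>

definition matrix_tuples :: "nat \<Rightarrow> ('n \<Rightarrow> 'k mat) set" where
  "matrix_tuples k = {X. \<forall>j. X j \<in> carrier_mat k k}"

definition eval_word :: "nat \<Rightarrow> 'n free_monoid \<Rightarrow> ('n \<Rightarrow> 'k::field mat) \<Rightarrow> 'k mat" where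
  "eval_word k w X = foldr (\<lambda>j A. X j * A) (letters w) (1\<^sub>m k)"

text \<open>The sum is written entrywise, since matrices of a fixed size do not form a type.\<close>

definition eval_at :: "nat \<Rightarrow> ('n, 'k::field) free_algebra \<Rightarrow> ('n \<Rightarrow> 'k mat) \<Rightarrow> 'k mat" where
  "eval_at k f X =
     mat k k (\<lambda>(a, b). \<Sum>w\<in>Poly_Mapping.keys f.
       Poly_Mapping.lookup f w * eval_word k w X $$ (a, b))"


section \<open>The Zariski topology on tuples of matrices\<close>

text \<open>Polynomial functions in the \<open>n k\<^sup>2\<close> matrix entries.\<close>

inductive_set polynomial_functions :: "nat \<Rightarrow> (('n \<Rightarrow> 'k::field mat) \<Rightarrow> 'k) set"
  for k :: nat where
  const: "(\<lambda>X. c) \<in> polynomial_functions k"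
| entry: "a < k \<Longrightarrow> b < k \<Longrightarrow> (\<lambda>X. X j $$ (a, b)) \<in> polynomial_functions k"
| add: "p \<in> polynomial_functions k \<Longrightarrow> q \<in> polynomial_functions k \<Longrightarrow>
    (\<lambda>X. p X + q X) \<in> polynomial_functions k"
| mult: "p \<in> polynomial_functions k \<Longrightarrow> q \<in> polynomial_functions k \<Longrightarrow>
    (\<lambda>X. p X * q X) \<in> polynomial_functions k"

definition zero_locus ::
  "nat \<Rightarrow> (('n \<Rightarrow> 'k::field mat) \<Rightarrow> 'k) set \<Rightarrow> ('n \<Rightarrow> 'k mat) set" where
  "zero_locus k S = {X \<in> matrix_tuples k. \<forall>p\<in>S. p X = 0}"

definition zariski :: "nat \<Rightarrow> ('n \<Rightarrow> 'k::field mat) topology" where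
  "zariski k = topology (\<lambda>U. \<exists>S \<subseteq> polynomial_functions k. U = matrix_tuples k - zero_locus k S)"

definition zariski_dense :: "nat \<Rightarrow> ('n \<Rightarrow> 'k::field mat) set \<Rightarrow> bool" where
  "zariski_dense k D \<longleftrightarrow> D \<subseteq> matrix_tuples k \<and> zariski k closure_of D = matrix_tuples k"

text \<open>\<^const>\<open>topology\<close> is only meaningful on predicates that satisfy \<^const>\<open>istopology\<close>.\<close>

lemma istopology_zariski:
  "istopology (\<lambda>U :: ('n \<Rightarrow> 'k::field mat) set.
     \<exists>S \<subseteq> polynomial_functions k. U = matrix_tuples k - zero_locus k S)"
  unfolding istopology_def
proof (intro conjI allI impI)
  fix U V :: "('n \<Rightarrow> 'k mat) set"
  assume "\<exists>S \<subseteq> polynomial_functions k. U = matrix_tuples k - zero_locus k S"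
    and "\<exists>S \<subseteq> polynomial_functions k. V = matrix_tuples k - zero_locus k S"
  then obtain S T where S: "S \<subseteq> polynomial_functions k" "U = matrix_tuples k - zero_locus k S"
    and T: "T \<subseteq> polynomial_functions k" "V = matrix_tuples k - zero_locus k T"
    by blast
  let ?P = "(\<lambda>(p, q) X. p X * q X) ` (S \<times> T)"
  have "?P \<subseteq> polynomial_functions k"
    using S(1) T(1) by (auto intro: polynomial_functions.mult)
  moreover have "U \<inter> V = matrix_tuples k - zero_locus k ?P"
    unfolding S(2) T(2) zero_locus_def by auto
  ultimately show "\<exists>S \<subseteq> polynomial_functions k. U \<inter> V = matrix_tuples k - zero_locus k S"
    by blast
next
  fix \<U> :: "('n \<Rightarrow> 'k mat) set set"
  assume "\<forall>U\<in>\<U>. \<exists>S \<subseteq> polynomial_functions k. U = matrix_tuples k - zero_locus k S"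
  then obtain s where s: "\<And>U. U \<in> \<U> \<Longrightarrow> s U \<subseteq> polynomial_functions k"
      "\<And>U. U \<in> \<U> \<Longrightarrow> U = matrix_tuples k - zero_locus k (s U)"
    by metis
  have "\<Union>\<U> = \<Union>((\<lambda>U. matrix_tuples k - zero_locus k (s U)) ` \<U>)"
    using s(2) by (metis (no_types, lifting) image_cong image_ident)
  also have "\<dots> = matrix_tuples k - zero_locus k (\<Union>(s ` \<U>))"
    unfolding zero_locus_def by auto
  finally have "\<Union>\<U> = matrix_tuples k - zero_locus k (\<Union>(s ` \<U>))" .
  moreover have "\<Union>(s ` \<U>) \<subseteq> polynomial_functions k"
    using s(1) by blast
  ultimately show "\<exists>S \<subseteq> polynomial_functions k. \<Union>\<U> = matrix_tuples k - zero_locus k S"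
    by blast
qed

lemma openin_zariski:
  "openin (zariski k) U \<longleftrightarrow>
     (\<exists>S \<subseteq> polynomial_functions k. U = matrix_tuples k - zero_locus k S)"
  unfolding zariski_def topology_inverse'[OF istopology_zariski] ..

lemma topspace_zariski:
  "topspace (zariski k) = (matrix_tuples k :: ('n \<Rightarrow> 'k::field mat) set)"
proof (rule antisym)
  have "U \<subseteq> matrix_tuples k" if "openin (zariski k) U" for U :: "('n \<Rightarrow> 'k mat) set"
    using that unfolding openin_zariski by blast
  then show "topspace (zariski k) \<subseteq> (matrix_tuples k :: ('n \<Rightarrow> 'k mat) set)"
    using openin_topspace by blast
  have "zero_locus k {\<lambda>X. 1} = ({} :: ('n \<Rightarrow> 'k mat) set)"
    unfolding zero_locus_def by simp
  then have "matrix_tuples k = (matrix_tuples k - zero_locus k {\<lambda>X. 1} :: ('n \<Rightarrow> 'k mat) set)"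
    by simp
  moreover have "{\<lambda>X. 1} \<subseteq> (polynomial_functions k :: (('n \<Rightarrow> 'k mat) \<Rightarrow> 'k) set)"
    by (simp add: polynomial_functions.const)
  ultimately have "openin (zariski k) (matrix_tuples k :: ('n \<Rightarrow> 'k mat) set)"
    unfolding openin_zariski by blast
  then show "(matrix_tuples k :: ('n \<Rightarrow> 'k mat) set) \<subseteq> topspace (zariski k)"
    by (rule openin_subset)
qed


section \<open>Relations between noncommutative polynomials\<close>

definition isospectral :: "('n, 'k::field) free_algebra \<Rightarrow> ('n, 'k) free_algebra \<Rightarrow> bool" where
  "isospectral f g \<longleftrightarrow>
     (\<forall>k. \<forall>X \<in> matrix_tuples k. spectrum (eval_at k f X) = spectrum (eval_at k g X))"

definition intertwined :: "('n, 'k::field) free_algebra \<Rightarrow> ('n, 'k) free_algebra \<Rightarrow> bool" where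
  "intertwined f g \<longleftrightarrow> (\<exists>a. a \<noteq> 0 \<and> f * a = a * g)"

definition elementary_intertwined ::
  "('n, 'k::field) free_algebra \<Rightarrow> ('n, 'k) free_algebra \<Rightarrow> bool" where
  "elementary_intertwined f g \<longleftrightarrow>
     (\<exists>c a b. f = scalar c + a * b \<and> g = scalar c + b * a)"

end

theory Submission
  imports Defs
begin

text \<open>Let \<open>R\<close> be the free algebra over the field \<open>k\<close>.

  (iii) implies (iv): if \<open>f a = a g\<close>, then \<open>f\<close> acts from the left on \<open>R / a R\<close>. By the weak algorithm
  this action is algebraic, so some \<open>f - c\<close> is not surjective on \<open>R / a R\<close>, and \<open>f - c\<close> and \<open>a\<close> have
  a common left factor \<open>d\<close> of positive degree. Writing \<open>f = c + d f'\<close> and \<open>a = d a'\<close>, the polynomial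
  \<open>c + f' d\<close> is intertwined with \<open>g\<close> by the shorter polynomial \<open>a'\<close>.

  (i) implies (iii), first step: if \<open>f(X)\<close> and \<open>g(X)\<close> share an eigenvalue, then \<open>f(X) A = A g(X)\<close> has a
  nonzero solution. By density this holds for all \<open>X\<close>, in particular for a deformation of \<open>X\<close> with
  values in a cyclic division algebra, which is split by a polynomial ring in two variables. There
  the solution can be chosen as an element of the division algebra up to a twist, so it is
  invertible; hence \<open>f(X)\<close> and \<open>g(X)\<close> have the same characteristic polynomial.

  Second step: over \<open>K = k(t)\<close>, the module \<open>K<x> / (f - t) K<x>\<close> contains a finite-dimensional subspace
  \<open>V\<close> that is stable under division by the variables and simple as a module over the free algebra
  acting by division. Let \<open>W\<close> be the corresponding module for \<open>g\<close>. If \<open>V\<close> and \<open>W\<close> were not isomorphic,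
  some element of the free algebra would kill \<open>W\<close> and fix a nonzero vector of \<open>V\<close>. Evaluating at the
  matrices of an automaton for this element makes \<open>t\<close> an eigenvalue of \<open>f(X)\<close> but not of \<open>g(X)\<close>, which
  contradicts the first step after a specialization of \<open>t\<close>. An isomorphism extends to the full
  modules, and the image of 1 becomes the desired intertwiner once \<open>t\<close> is replaced by \<open>f\<close>.\<close>

section \<open>The weak algorithm\<close>

text \<open>A shared eigenvalue yields only a nonzero solution of F A = A G, which may be singular
  and says nothing about the other eigenvalues, whereas the automaton argument needs the whole
  spectrum. The deformation removes this obstacle: over the cyclic algebra the solution space
  carries two commuting operators of order k, and the lowest coefficient of a joint eigenvector is a
  monomial matrix, so its determinant is nonzero. What is specialized back is the equality of
  characteristic polynomials, not the intertwiner. The indeterminate t has three uses. The constant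
  term of f - t is nonzero, so division by the variables makes sense modulo f - t. Nonzero
  polynomials in t are units congruent to polynomials in f; with algebraic eigenrings this shows
  that a right ideal U R + (f - t) R over K, U stable under division, is everything once it contains
  a nonzero polynomial over k. Finally, the automaton has entries in K, so t can be specialized at
  almost every scalar. Spectra are compared only for infinitely many sizes, hence automata are
  padded by zeros up to an available size.\<close>

abbreviation "lookup \<equiv> Poly_Mapping.lookup"
abbreviation "single \<equiv> Poly_Mapping.single"
abbreviation "keys \<equiv> Poly_Mapping.keys"

abbreviation Var :: "'n \<Rightarrow> ('n, 'k::field) free_algebra" where
  "Var j \<equiv> single (Word [j]) 1"

lemma letters_0 [simp]: "letters 0 = []"
  by (simp add: zero_free_monoid_def)

lemma letters_plus [simp]: "letters (u + v) = letters u @ letters v"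
  by (simp add: plus_free_monoid_def)

lemma Word_plus [simp]: "Word u + Word v = Word (u @ v)"
  by (simp add: plus_free_monoid_def)

lemma Word_eq_0_iff [simp]: "Word u = 0 \<longleftrightarrow> u = []" "0 = Word u \<longleftrightarrow> u = []"
  by (auto simp: zero_free_monoid_def)

lemma Word_letters [simp]: "Word (letters w) = w"
  by (cases w) simp

lemma scalar_0 [simp]: "scalar 0 = 0"
  and scalar_1 [simp]: "scalar 1 = 1"
  and scalar_add: "scalar (c + d) = scalar c + scalar d"
  and scalar_diff: "scalar (c - d) = scalar c - scalar d"
  and scalar_uminus: "scalar (- c) = - scalar c"
  and scalar_mult: "scalar (c * d) = scalar c * scalar d"
  by (simp_all add: scalar_def single_add single_diff single_uminus mult_single)

lemma lookup_scalar: "lookup (scalar c) w = (if w = 0 then c else 0)"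
  by (simp add: scalar_def lookup_single when_def)

lemma lookup_scalar_0 [simp]: "lookup (scalar c) 0 = c"
  by (simp add: lookup_scalar)

lemma scalar_eq_0_iff [simp]: "scalar c = 0 \<longleftrightarrow> c = 0"
  by (metis lookup_scalar_0 lookup_zero scalar_0)

lemma lookup_scalar_mult [simp]:
  "lookup (scalar c * m) w = c * lookup m w"
proof -
  have "scalar c * m = Poly_Mapping.map ((*) c) m"
    by (simp add: scalar_def mult_map_scale_conv_mult)
  then show ?thesis
    by (simp add: Poly_Mapping.map.rep_eq when_def)
qed

lemma poly_mapping_single_induct [case_names single add]:
  assumes "\<And>w c. P (single w c)" "\<And>a b. P a \<Longrightarrow> P b \<Longrightarrow> P (a + b)"
  shows "P m"
proof (induction m rule: update_induct)
  case const
  show ?case using assms(1)[of undefined 0] by simp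
next
  case (update f a b)
  have "Poly_Mapping.update a b f = f + single a b"
    using update(1) by (intro poly_mapping_eqI)
      (auto simp: lookup_update lookup_add lookup_single when_def in_keys_iff)
  then show ?case using update assms by simp
qed

lemma scalar_commute: "m * scalar c = scalar c * m"
  by (induction m rule: poly_mapping_single_induct)
    (simp_all add: scalar_def mult_single algebra_simps)

lemma scalar_left_commute: "m * (scalar c * n) = scalar c * (m * n)"
  by (metis mult.assoc scalar_commute)

lemma lookup_mult_scalar [simp]:
  "lookup (m * scalar c) w = c * lookup m w"
  by (simp add: scalar_commute)

lemma free_algebra_induct [case_names scalar add Var]:
  assumes "\<And>c. P (scalar c)" "\<And>a b. P a \<Longrightarrow> P b \<Longrightarrow> P (a + b)" "\<And>a j. P a \<Longrightarrow> P (a * Var j)"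
  shows "P m"
proof (induction m rule: poly_mapping_single_induct)
  case (single w c)
  have "P (single (Word ls) c)" for ls
  proof (induction ls rule: rev_induct)
    case Nil
    then show ?case using assms(1)[of c] by (simp add: scalar_def zero_free_monoid_def)
  next
    case (snoc j ls)
    from assms(3)[OF this, of j] show ?case by (simp add: mult_single)
  qed
  then show ?case by (metis Word_letters)
qed (rule assms(2))

section \<open>Right quotients: the left cofactors \<open>m_j\<close> in the expansion m = c + sum
  of \<open>m_j x_j\<close>\<close>

definition rq :: "'n \<Rightarrow> ('n, 'k::field) free_algebra \<Rightarrow> ('n, 'k) free_algebra" where
  "rq j = Poly_Mapping.map_key (\<lambda>w. w + Word [j])"

lemma lookup_rq [simp]: "lookup (rq j m) w = lookup m (w + Word [j])"
proof -
  have "inj (\<lambda>w. w + Word [j])"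
    by (rule injI) (metis append1_eq_conv letters_plus free_monoid.sel free_monoid.expand)
  then show ?thesis
    by (simp add: rq_def map_key.rep_eq)
qed

lemma rq_add: "rq j (a + b) = rq j a + rq j b"
  and rq_diff: "rq j (a - b) = rq j a - rq j b"
  and rq_0 [simp]: "rq j 0 = 0"
  and rq_scalar [simp]: "rq j (scalar c) = 0"
  and rq_scalar_mult: "rq j (scalar c * a) = scalar c * rq j a"
  by (intro poly_mapping_eqI; simp add: lookup_add lookup_minus lookup_scalar plus_free_monoid_def)+

lemma rq_1 [simp]: "rq j 1 = 0"
  using rq_scalar[of j 1] by simp

lemma rq_mult_Var [simp]: "rq j (a * Var i) = (if i = j then a else 0)"
  by (induction a rule: poly_mapping_single_induct)
    (auto simp: mult_single rq_add distrib_right intro!: poly_mapping_eqI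
      simp: lookup_single when_def plus_free_monoid_def free_monoid.expand)

lemma lookup_mult_Var_0 [simp]: "lookup (a * Var i) 0 = 0"
  by (induction a rule: poly_mapping_single_induct)
    (auto simp: mult_single distrib_right lookup_add lookup_single when_def plus_free_monoid_def)

lemma lookup_mult_0:
  "lookup (a * b) 0 = lookup a 0 * lookup b (0::'n free_monoid)"
  for a b :: "('n, 'k::field) free_algebra"
proof (induction b rule: free_algebra_induct)
  case (Var a' j)
  then show ?case by (simp add: mult.assoc[symmetric] del: mult.assoc)
qed (simp_all add: distrib_left lookup_add)

text \<open>The last letter of a word of \<open>a * b\<close> comes from \<open>b\<close>, unless
  \<open>b\<close> contributes only its constant term and the letter comes from
  \<open>a\<close>.\<close>

lemma rq_mult: "rq j (a * b) = a * rq j b + scalar (lookup b 0) * rq j a"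
proof (induction b rule: free_algebra_induct)
  case (Var b i)
  then show ?case by (simp add: mult.assoc[symmetric] del: mult.assoc)
qed (simp_all add: distrib_left rq_add lookup_add scalar_add algebra_simps rq_scalar_mult scalar_commute)

lemma rq_expansion:
  "m = scalar (lookup m 0) + (\<Sum>j\<in>UNIV. rq j m * Var j)"
  for m :: "('n::finite, 'k::field) free_algebra"
proof (induction m rule: free_algebra_induct)
  case (add a b)
  have "scalar (lookup (a + b) 0) + (\<Sum>j\<in>UNIV. rq j (a + b) * Var j) =
      (scalar (lookup a 0) + (\<Sum>j\<in>UNIV. rq j a * Var j)) +
      (scalar (lookup b 0) + (\<Sum>j\<in>UNIV. rq j b * Var j))"
    by (simp add: lookup_add scalar_add rq_add distrib_right sum.distrib)
  then show ?case
    using add by metis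
next
  case (Var a j)
  have "(\<Sum>i\<in>UNIV. rq i (a * Var j) * Var i) = (\<Sum>i\<in>UNIV. if i = j then a * Var j else 0)"
    by (intro sum.cong) auto
  then show ?case by simp
qed simp

section \<open>The degree filtration; \<open>below (Suc 0)\<close> consists of the constants\<close>

definition below :: "nat \<Rightarrow> ('n, 'k::field) free_algebra set" where
  "below d = {m. \<forall>w. lookup m w \<noteq> 0 \<longrightarrow> length (letters w) < d}"

lemma below_0 [simp]: "below 0 = {0}"
  by (auto simp: below_def intro: poly_mapping_eqI)

lemma below_mono: "d \<le> e \<Longrightarrow> m \<in> below d \<Longrightarrow> m \<in> below e"
  by (fastforce simp: below_def)

lemma zero_below [simp]: "0 \<in> below d"
  by (simp add: below_def)

lemma below_add: "a \<in> below d \<Longrightarrow> b \<in> below d \<Longrightarrow> a + b \<in> below d"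
  by (auto simp: below_def lookup_add) (metis add.right_neutral)

lemma below_uminus: "a \<in> below d \<Longrightarrow> - a \<in> below d"
  by (auto simp: below_def)

lemma below_diff: "a \<in> below d \<Longrightarrow> b \<in> below d \<Longrightarrow> a - b \<in> below d"
  using below_add[OF _ below_uminus, of a d b] by simp

lemma below_scalar_mult: "a \<in> below d \<Longrightarrow> scalar c * a \<in> below d"
  by (auto simp: below_def)

lemma below_sum: "(\<And>i. i \<in> A \<Longrightarrow> f i \<in> below d) \<Longrightarrow> sum f A \<in> below d"
  by (induction A rule: infinite_finite_induct) (auto intro: below_add)

lemma below_Suc_iff: "m \<in> below (Suc d) \<longleftrightarrow> (\<forall>j. rq j m \<in> below d)"
proof
  assume "m \<in> below (Suc d)"
  then have "length (letters (w + Word [j])) < Suc d"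
    if "lookup m (w + Word [j]) \<noteq> 0" for w j
    using that unfolding below_def by blast
  then show "\<forall>j. rq j m \<in> below d" by (simp add: below_def)
next
  assume m: "\<forall>j. rq j m \<in> below d"
  show "m \<in> below (Suc d)"
    unfolding below_def
  proof (intro CollectI allI impI)
    fix w assume w: "lookup m w \<noteq> 0"
    show "length (letters w) < Suc d"
    proof (cases "letters w" rule: rev_cases)
      case (snoc u j)
      then have "w = Word u + Word [j]" by (metis Word_letters Word_plus)
      with w have "lookup (rq j m) (Word u) \<noteq> 0" by simp
      with m[rule_format, of j] have "length u < d"
        by (auto simp: below_def dest!: spec[of _ "Word u"])
      with snoc show ?thesis by simp
    qed simp
  qed
qed

lemma scalar_below [simp]: "scalar c \<in> below (Suc d)"
  by (simp add: below_Suc_iff)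

lemma below_1: "m \<in> below (Suc 0) \<Longrightarrow> m = scalar (lookup m 0)"
  by (intro poly_mapping_eqI) (auto simp: below_def lookup_scalar zero_free_monoid_def,
      metis Word_letters)

lemma finite_below_exists: "\<exists>d. m \<in> below d"
proof -
  have "finite (length ` letters ` keys m)" by simp
  then obtain d where "\<forall>n \<in> length ` letters ` keys m. n < d"
    by (metis finite_nat_set_iff_bounded)
  then have "m \<in> below d" by (auto simp: below_def in_keys_iff)
  then show ?thesis ..
qed

text \<open>The degree plus one, with value 0 at the zero polynomial.\<close>

definition ht :: "('n, 'k::field) free_algebra \<Rightarrow> nat" where
  "ht m = (LEAST d. m \<in> below d)"

lemma below_iff_ht: "m \<in> below d \<longleftrightarrow> ht m \<le> d"
  using finite_below_exists[of m] unfolding ht_def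
  by (metis LeastI Least_le below_mono)

lemma ht_eq_0_iff [simp]: "ht m = 0 \<longleftrightarrow> m = 0"
  using below_iff_ht[of m 0] by simp

lemma ht_leading:
  assumes "m \<noteq> 0"
  obtains w where "Suc (length w) = ht m" "lookup m (Word w) \<noteq> 0"
proof -
  from assms obtain d where d: "ht m = Suc d" by (metis ht_eq_0_iff not0_implies_Suc)
  then have "m \<notin> below d" "m \<in> below (Suc d)" by (simp_all add: below_iff_ht)
  then obtain w where "lookup m w \<noteq> 0" "length (letters w) = d"
    by (fastforce simp: below_def)
  then show thesis using that[of "letters w"] d by simp
qed

text \<open>Strips the suffix \<open>w\<close>, its last letter first; this order is the reason for
  \<open>foldr\<close>.\<close>

definition rqs :: "'n list \<Rightarrow> ('n, 'k::field) free_algebra \<Rightarrow> ('n, 'k) free_algebra" where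
  "rqs w m = foldr rq w m"

lemma rqs_simps [simp]: "rqs [] m = m" "rqs (j # w) m = rq j (rqs w m)"
  by (simp_all add: rqs_def)

lemma lookup_rqs: "lookup (rqs w m) u = lookup m (u + Word w)"
  by (induction w arbitrary: u) (simp_all add: add.assoc zero_free_monoid_def[symmetric])

lemma rqs_below: "m \<in> below (length w + d) \<Longrightarrow> rqs w m \<in> below d"
  by (auto simp: below_def lookup_rqs)

lemma rqs_leading:
  assumes "Suc (length w) = ht m"
  shows "rqs w m = scalar (lookup m (Word w))"
proof -
  have "rqs w m \<in> below (Suc 0)"
    by (rule rqs_below) (simp add: below_iff_ht assms[symmetric])
  from below_1[OF this] show ?thesis by (simp add: lookup_rqs)
qed

text \<open>By the product rule each stripped letter comes off \<open>b\<close> or, through a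
  constant term, off \<open>a\<close>, and in the latter case the degree of that term drops below
  the bound for \<open>a\<close>. Hence stripping commutes with left multiplication by
  \<open>a\<close> up to lower terms. Additivity of degrees and the weak algorithm both rest on
  this.\<close>

lemma rqs_mult:
  assumes "a \<in> below (Suc d)"
  shows "rqs w (a * b) - a * rqs w b \<in> below d"
proof (induction w)
  case Nil
  then show ?case by simp
next
  case (Cons j w)
  define e where "e = rqs w (a * b) - a * rqs w b"
  have "rqs w (a * b) = a * rqs w b + e" by (simp add: e_def)
  then have "rqs (j # w) (a * b) - a * rqs (j # w) b =
      scalar (lookup (rqs w b) 0) * rq j a + rq j e"
    by (simp add: rq_add rq_mult)
  moreover have "rq j a \<in> below d"
    using assms by (simp add: below_Suc_iff)
  moreover have "rq j e \<in> below d"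
    using below_mono[of d "Suc d" e] Cons by (simp add: e_def below_Suc_iff)
  ultimately show ?case by (simp add: below_add below_scalar_mult)
qed

text \<open>Stripping a leading word of \<open>b\<close> from \<open>a * b\<close> leaves a nonzero
  scalar multiple of \<open>a\<close> up to lower terms, so deg (a b) is at least deg a + deg b; the
  \<open>Suc\<close> is due to \<open>ht\<close> being the degree plus one.\<close>

lemma ht_mult:
  assumes "a \<noteq> 0" "b \<noteq> 0"
  shows "ht a + ht b \<le> Suc (ht (a * b))"
proof -
  obtain w where w: "Suc (length w) = ht b" "lookup b (Word w) \<noteq> 0"
    using ht_leading assms by blast
  let ?c = "lookup b (Word w)"
  obtain d where d: "ht a = Suc d" by (metis assms(1) ht_eq_0_iff not0_implies_Suc)
  have e: "rqs w (a * b) - a * scalar ?c \<in> below d"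
    using rqs_mult[of a d w b] d rqs_leading[OF w(1)] by (simp add: below_iff_ht)
  show ?thesis
  proof (rule ccontr)
    assume "\<not> ?thesis"
    then have "ht (a * b) \<le> length w + d" using w d by simp
    then have "rqs w (a * b) \<in> below d" by (intro rqs_below) (simp add: below_iff_ht)
    from below_diff[OF this e] have "a * scalar ?c \<in> below d" by simp
    then have "scalar (inverse ?c) * (scalar ?c * a) \<in> below d"
      unfolding scalar_commute[of a] by (rule below_scalar_mult)
    then have "a \<in> below d"
      unfolding mult.assoc[symmetric] scalar_mult[symmetric] using w(2) by simp
    then show False using d by (simp add: below_iff_ht)
  qed
qed

lemma free_algebra_mult_eq_0_iff [simp]: "a * b = 0 \<longleftrightarrow> a = 0 \<or> b = 0"
  for a b :: "('n, 'k::field) free_algebra"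
proof -
  have "a * b \<noteq> 0" if "a \<noteq> 0" "b \<noteq> 0"
  proof
    assume "a * b = 0"
    then have "ht (a * b) = 0" by simp
    with ht_mult[OF that] have "ht a = 0 \<or> ht b = 0" by linarith
    with that show False by simp
  qed
  then show ?thesis by auto
qed

lemma free_algebra_mult_left_cancel: "a * b = a * c \<Longrightarrow> a \<noteq> 0 \<Longrightarrow> b = c"
  for a b c :: "('n, 'k::field) free_algebra"
  using free_algebra_mult_eq_0_iff[of a "b - c"] by (simp add: right_diff_distrib)

lemma free_algebra_mult_right_cancel: "b * a = c * a \<Longrightarrow> a \<noteq> 0 \<Longrightarrow> b = c"
  for a b c :: "('n, 'k::field) free_algebra"
  using free_algebra_mult_eq_0_iff[of "b - c" a] by (simp add: left_diff_distrib)

text \<open>Strip a leading word \<open>w\<close> of \<open>u\<close> from both sides of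
  \<open>a * u = b * v\<close>. The left side becomes a nonzero multiple of \<open>a\<close> and the
  right side becomes \<open>b * rqs w v\<close>, both up to degree less than that of
  \<open>a\<close>. So the leading part of \<open>a\<close> is a right multiple of \<open>b\<close>,
  and \<open>h\<close> is a scalar times \<open>rqs w v\<close>.\<close>

lemma weak_algorithm:
  fixes a b u v :: "('n, 'k::field) free_algebra"
  assumes eq: "a * u = b * v" and u: "u \<noteq> 0" and ht: "ht b \<le> ht a" and b: "b \<noteq> 0"
  obtains h where "ht (a - b * h) < ht a"
proof -
  obtain w where w: "Suc (length w) = ht u" "lookup u (Word w) \<noteq> 0"
    using ht_leading u by blast
  let ?c = "lookup u (Word w)"
  obtain d where d: "ht b = Suc d" by (metis b ht_eq_0_iff not0_implies_Suc)
  with ht obtain d' where d': "ht a = Suc d'" by (cases "ht a") auto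
  have a: "rqs w (a * u) - a * scalar ?c \<in> below d'"
    using rqs_mult[of a d' w u] d' rqs_leading[OF w(1)] by (simp add: below_iff_ht)
  have "rqs w (b * v) - b * rqs w v \<in> below d"
    using rqs_mult[of b d w v] d by (simp add: below_iff_ht)
  then have "rqs w (a * u) - b * rqs w v \<in> below d'"
    using eq ht d d' by (auto intro: below_mono)
  from below_diff[OF this a] have "a * scalar ?c - b * rqs w v \<in> below d'" by simp
  then have "scalar (inverse ?c) * (scalar ?c * a - b * rqs w v) \<in> below d'"
    unfolding scalar_commute[of a] by (rule below_scalar_mult)
  also have "scalar (inverse ?c) * (scalar ?c * a - b * rqs w v) =
      scalar (inverse ?c * ?c) * a - b * (scalar (inverse ?c) * rqs w v)"
    unfolding right_diff_distrib mult.assoc[symmetric] scalar_mult scalar_commute[of b] ..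
  also have "inverse ?c * ?c = 1"
    using w(2) by simp
  finally show thesis by (intro that[of "scalar (inverse ?c) * rqs w v"]) (simp add: below_iff_ht d')
qed

text \<open>Euclid's algorithm. Division with remainder is available only in the presence of a
  common right multiple, and this survives each step: (a - b h) u = b (v - h u).\<close>

lemma bezout:
  fixes a b u v :: "('n, 'k::field) free_algebra"
  assumes "a * u = b * v" "u \<noteq> 0" "v \<noteq> 0" "a \<noteq> 0" "b \<noteq> 0"
  obtains d a' b' r s where "a = d * a'" "b = d * b'" "d = a * r + b * s"
proof -
  have "\<exists>d a' b' r s. a = d * a' \<and> b = d * b' \<and> d = a * r + b * s"
    using assms
  proof (induction "ht a + ht b" arbitrary: a b u v rule: less_induct)
    case (less a b u v)
    define n where "n = ht a + ht b"
    have step: "\<exists>d a' b' r s. a = d * a' \<and> b = d * b' \<and> d = a * r + b * s"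
      if n: "ht a + ht b = n" and eq: "a * u = b * v" "u \<noteq> 0" "v \<noteq> 0" "a \<noteq> 0" "b \<noteq> 0" "ht b \<le> ht a"
      for a b u v :: "('n, 'k) free_algebra"
    proof -
      obtain h where h: "ht (a - b * h) < ht a"
        using weak_algorithm[OF eq(1,2,6,5)] .
      show ?thesis
      proof (cases "a - b * h = 0")
        case True
        then have "a = b * h \<and> b = b * 1 \<and> b = a * 0 + b * 1" by simp
        then show ?thesis by blast
      next
        case False
        have e: "(a - b * h) * u = b * (v - h * u)"
          using eq(1) by (simp add: left_diff_distrib right_diff_distrib mult.assoc)
        have nz: "v - h * u \<noteq> 0"
        proof
          assume "v - h * u = 0"
          with e have "(a - b * h) * u = 0" by simp
          with False eq(2) show False by simp
        qed
        have lt: "ht (a - b * h) + ht b < n" using h n by linarith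
        obtain d a'' b'' r s where d: "a - b * h = d * a''" "b = d * b''" "d = (a - b * h) * r + b * s"
          using less(1)[OF lt[unfolded n_def] e eq(2) nz False eq(5)] by blast
        have "a = (a - b * h) + b * h" by simp
        also have "\<dots> = d * a'' + d * b'' * h" by (simp only: d(1) d(2)[symmetric])
        finally have "a = d * (a'' + b'' * h)" by (simp only: distrib_left mult.assoc)
        moreover have "d = a * r + b * (s - h * r)"
          by (subst d(3)) (simp add: left_diff_distrib right_diff_distrib mult.assoc)
        ultimately show ?thesis using d(2) by blast
      qed
    qed
    show ?case
    proof (cases "ht b \<le> ht a")
      case True
      from step[OF n_def[symmetric] less.prems True] show ?thesis .
    next
      case False
      then obtain d a' b' r s where "b = d * a'" "a = d * b'" and d: "d = b * r + a * s"
        using step[OF _ less.prems(1)[symmetric] less.prems(3,2,5,4)] n_def by (metis add.commute nat_le_linear)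
      moreover from d have "d = a * s + b * r" by (simp only: add.commute)
      ultimately show ?thesis by blast
    qed
  qed
  then show thesis using that by blast
qed

section \<open>Eigenrings and elementary intertwining\<close>

global_interpretation fa: vector_space "\<lambda>c (m :: ('n, 'k::field) free_algebra). scalar c * m"
  by standard (simp_all add: distrib_left distrib_right scalar_add scalar_mult mult.assoc)

lemma fa_subspace_below: "fa.subspace (below d)"
  by (auto simp: fa.subspace_def below_add below_scalar_mult)

lemma finite_short_words: "finite {w :: 'n::finite free_monoid. length (letters w) < d}"
proof -
  have "finite {ls :: 'n list. set ls \<subseteq> UNIV \<and> length ls \<le> d}"
    by (rule finite_lists_length_le) simp
  then have "finite (Word ` {ls :: 'n list. set ls \<subseteq> UNIV \<and> length ls \<le> d})"
    by (rule finite_imageI)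
  then show ?thesis
    by (rule rev_finite_subset) (auto intro!: image_eqI[of _ _ "letters _"])
qed

definition short_monomials :: "nat \<Rightarrow> ('n, 'k::field) free_algebra set" where
  "short_monomials d = (\<lambda>w. single w 1) ` {w. length (letters w) < d}"

lemma finite_short_monomials [simp]:
  "finite (short_monomials d :: ('n::finite, 'k::field) free_algebra set)"
  by (simp add: short_monomials_def finite_short_words)

lemma poly_mapping_sum_single:
  "m = (\<Sum>w\<in>keys m. single w (lookup m w))"
  by (intro poly_mapping_eqI) (auto simp: lookup_sum lookup_single when_def in_keys_iff)

lemma scalar_mult_single: "scalar c * single w d = single w (c * d)"
  by (simp add: scalar_def mult_single)

lemma below_subset_span: "below d \<subseteq> fa.span (short_monomials d)"
proof
  fix m :: "('a, 'b) free_algebra" assume m: "m \<in> below d"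
  have "single w (lookup m w) \<in> fa.span (short_monomials d)"
    if "w \<in> keys m" for w
  proof -
    have "single w 1 \<in> (short_monomials d :: ('a, 'b) free_algebra set)"
      using m that by (auto simp: short_monomials_def below_def in_keys_iff)
    from fa.span_scale[OF fa.span_base[OF this], of "lookup m w"] show ?thesis
      by (simp add: scalar_mult_single)
  qed
  then have "(\<Sum>w\<in>keys m. single w (lookup m w))
      \<in> fa.span (short_monomials d)"
    by (rule fa.span_sum)
  then show "m \<in> fa.span (short_monomials d)"
    using poly_mapping_sum_single[of m] by simp
qed

lemma below_linear_relation:
  fixes r :: "nat \<Rightarrow> ('n::finite, 'k::field) free_algebra"
  assumes "\<And>i. r i \<in> below d"
  obtains N c i where "(\<Sum>i\<le>N. scalar (c i) * r i) = 0" "i \<le> N" "c i \<noteq> 0"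
proof -
  define N where "N = card (short_monomials d :: ('n, 'k) free_algebra set)"
  show thesis
  proof (cases "inj_on r {..N}")
    case True
    then have "card (r ` {..N}) = Suc N" by (simp add: card_image)
    moreover have "r ` {..N} \<subseteq> fa.span (short_monomials d)"
      using below_subset_span assms by blast
    ultimately have "fa.dependent (r ` {..N})"
      using fa.independent_span_bound[of "short_monomials d" "r ` {..N}"] N_def by fastforce
    then obtain u v where u: "v \<in> r ` {..N}" "u v \<noteq> 0" "(\<Sum>v\<in>r ` {..N}. scalar (u v) * v) = 0"
      using fa.dependent_finite[of "r ` {..N}"] by auto
    then obtain i where "i \<le> N" "v = r i" by auto
    moreover have "(\<Sum>i\<le>N. scalar (u (r i)) * r i) = 0"
      using u(3) sum.reindex[OF True, of "\<lambda>v. scalar (u v) * v"] by simp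
    ultimately show thesis using that[of "\<lambda>i. u (r i)" N i] u by simp
  next
    \<comment> \<open>Linear dependence is a property of sets, so a repetition in the sequence has
      to be turned into a relation separately.\<close>
    case False
    then obtain i j where ij: "i \<le> N" "j \<le> N" "i \<noteq> j" "r i = r j"
      by (auto simp: inj_on_def)
    define c :: "nat \<Rightarrow> 'k" where "c l = (if l = i then 1 else if l = j then - 1 else 0)" for l
    have "(\<Sum>l\<le>N. scalar (c l) * r l) = (\<Sum>l\<in>{i, j}. scalar (c l) * r l)"
      using ij by (intro sum.mono_neutral_right) (auto simp: c_def)
    also have "\<dots> = 0" using ij by (simp add: c_def scalar_uminus)
    finally show thesis using that[of c N i] ij by (simp add: c_def)
  qed
qed

section \<open>Polynomials in a single element of the free algebra\<close>

definition peval :: "'k poly \<Rightarrow> ('n, 'k::field) free_algebra \<Rightarrow> ('n, 'k) free_algebra" where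
  "peval p f = fold_coeffs (\<lambda>c r. scalar c + f * r) p 0"

lemma peval_0 [simp]: "peval 0 f = 0"
  by (simp add: peval_def)

lemma peval_pCons [simp]: "peval (pCons c p) f = scalar c + f * peval p f"
  by (cases "p = 0 \<and> c = 0") (auto simp: peval_def)

lemma peval_add: "peval (p + q) f = peval p f + peval q f"
proof (induction p q rule: poly_induct2)
  case (pCons a p b q)
  then show ?case by (simp add: scalar_add distrib_left)
qed simp

lemma peval_smult: "peval (Polynomial.smult c p) f = scalar c * peval p f"
proof (induction p)
  case (pCons a p)
  then show ?case by (simp add: scalar_mult distrib_left scalar_left_commute)
qed simp

lemma peval_mult: "peval (p * q) f = peval p f * peval q f"
  by (induction p) (simp_all add: peval_add peval_smult distrib_right mult.assoc)

lemma peval_commute: "peval p f * f = f * peval p f"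
proof (induction p)
  case (pCons a p)
  then show ?case by (simp add: distrib_left distrib_right mult.assoc scalar_commute)
qed simp

lemma peval_monom: "peval (monom c n) f = scalar c * f ^ n"
  by (induction n) (simp_all add: monom_0 monom_Suc scalar_left_commute)

lemma peval_sum: "peval (sum p A) f = (\<Sum>i\<in>A. peval (p i) f)"
  by (induction A rule: infinite_finite_induct) (simp_all add: peval_add)

text \<open>The hypothesis provides the common right multiple that the weak algorithm asks for, and
  it persists when \<open>m * q\<close> is subtracted from \<open>h\<close>, with
  \<open>v - q * m\<close> in place of \<open>v\<close>. The remainder has at most the degree of
  \<open>m\<close>.\<close>

lemma reduce_modulo:
  fixes h m v :: "('n, 'k::field) free_algebra"
  assumes "h * m = m * v" "m \<noteq> 0"
  shows "\<exists>r q. r \<in> below (ht m) \<and> h = r + m * q"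
  using assms(1)
proof (induction "ht h" arbitrary: h v rule: less_induct)
  case less
  show ?case
  proof (cases "ht h \<le> ht m")
    case True
    then have "h \<in> below (ht m)" "h = h + m * 0" by (simp_all add: below_iff_ht)
    then show ?thesis by blast
  next
    case False
    then obtain q where q: "ht (h - m * q) < ht h"
      using weak_algorithm[OF less.prems assms(2) _ assms(2)] by force
    have "(h - m * q) * m = m * (v - q * m)"
      using less.prems by (simp add: left_diff_distrib right_diff_distrib mult.assoc)
    from less.hyps[OF q this] obtain r q' where "r \<in> below (ht m)" "h - m * q = r + m * q'"
      by blast
    then have "r \<in> below (ht m) \<and> h = r + m * (q' + q)"
      by (simp add: distrib_left algebra_simps)
    then show ?thesis by blast
  qed
qed

text \<open>Modulo \<open>m R\<close>, all powers of \<open>f\<close> have representatives in a fixed finite-dimensional space.\<close>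

lemma eigenring_algebraic:
  fixes f g m :: "('n::finite, 'k::field) free_algebra"
  assumes "f * m = m * g" "m \<noteq> 0"
  obtains p h where "p \<noteq> 0" "peval p f = m * h"
proof -
  have "f ^ i * m = m * g ^ i" for i
  proof (induction i)
    case (Suc i)
    have "f ^ Suc i * m = f * (f ^ i * m)" by (simp add: mult.assoc)
    also have "\<dots> = (f * m) * g ^ i" by (simp only: Suc mult.assoc)
    also have "\<dots> = m * g ^ Suc i" by (simp add: assms(1) mult.assoc)
    finally show ?case .
  qed simp
  then have "\<exists>x. fst x \<in> below (ht m) \<and> f ^ i = fst x + m * snd x" for i
    using reduce_modulo[of "f ^ i" m "g ^ i"] assms(2) by simp
  then obtain x where x: "\<And>i. fst (x i) \<in> below (ht m) \<and> f ^ i = fst (x i) + m * snd (x i)"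
    using choice[of "\<lambda>i x. fst x \<in> below (ht m) \<and> f ^ i = fst x + m * snd x"] by blast
  define r q where "r i = fst (x i)" and "q i = snd (x i)" for i
  have r: "\<And>i. r i \<in> below (ht m)" "\<And>i. f ^ i = r i + m * q i"
    using x by (simp_all add: r_def q_def)
  obtain N c i where c: "(\<Sum>i\<le>N. scalar (c i) * r i) = 0" "i \<le> N" "c i \<noteq> 0"
    by (rule below_linear_relation[of r, OF r(1)])
  define p where "p = (\<Sum>i\<le>N. monom (c i) i)"
  have "coeff p i = c i" using c(2) by (simp add: p_def coeff_sum)
  then have "p \<noteq> 0" using c(3) by auto
  moreover have "peval p f = (\<Sum>i\<le>N. scalar (c i) * r i) + (\<Sum>i\<le>N. m * (scalar (c i) * q i))"
    by (simp add: p_def peval_sum peval_monom r(2) distrib_left sum.distrib scalar_left_commute)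
  ultimately show thesis
    using that c(1) by (simp add: sum_distrib_left[symmetric])
qed

text \<open>Let \<open>p\<close> have least degree among the nonzero polynomials with p(f) in a R,
  and split off a root: p = (t - c) q. Then (f - c) q(f) lies in a R, so \<open>f - c\<close> and
  \<open>a\<close> have a nonzero common right multiple and hence a greatest common left factor
  \<open>d\<close>. A constant \<open>d\<close> would force q(f) into a R, against
  minimality.\<close>

lemma common_left_factor:
  fixes f g a :: "('n::finite, 'k::alg_closed_field) free_algebra"
  assumes fa: "f * a = a * g" and a: "a \<noteq> 0" "a \<notin> below (Suc 0)" and f: "\<And>c. f \<noteq> scalar c"
  obtains c d f' a' where "f = scalar c + d * f'" "a = d * a'" "d \<notin> below (Suc 0)"
proof -
  let ?P = "\<lambda>p. p \<noteq> 0 \<and> (\<exists>h. peval p f = a * h)"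
  obtain p0 where "?P p0" using eigenring_algebraic[OF fa a(1)] by blast
  from ex_has_least_nat[of ?P, OF this, of degree]
  obtain p where p: "?P p" and "\<And>q. ?P q \<Longrightarrow> degree p \<le> degree q" by blast
  then have min: "\<And>q. degree q < degree p \<Longrightarrow> \<not> ?P q" using not_less by blast
  obtain h where h: "peval p f = a * h" using p by blast
  \<comment> \<open>Otherwise a R contains a nonzero constant, which by additivity of degrees makes
    \<open>a\<close> constant.\<close>
  have "degree p > 0"
  proof (rule ccontr)
    assume "\<not> ?thesis"
    then obtain c where c: "p = [:c:]" using degree_eq_zeroE by blast
    then have "c \<noteq> 0" using p by simp
    have "a * h = scalar c" using h c by simp
    with \<open>c \<noteq> 0\<close> have "a * h \<noteq> 0" "a * h \<in> below (Suc 0)" by (simp_all del: free_algebra_mult_eq_0_iff)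
    then have "ht a + ht h \<le> Suc (Suc 0)" "h \<noteq> 0"
      using ht_mult[of a h] by (simp_all add: below_iff_ht)
    moreover have "ht h > 0" using \<open>h \<noteq> 0\<close> ht_eq_0_iff[of h] by linarith
    ultimately show False using a(2) unfolding below_iff_ht by linarith
  qed
  then obtain c where "poly p c = 0" using alg_closed_imp_poly_has_root by blast
  then obtain q where q: "p = [:- c, 1:] * q" using poly_eq_0_iff_dvd by blast
  have "q \<noteq> 0" using p q by auto
  then have "degree p = Suc (degree q)" unfolding q by (subst degree_mult_eq) simp_all
  then have "degree q < degree p" by simp
  then have nq: "\<nexists>h. peval q f = a * h" using min \<open>q \<noteq> 0\<close> by blast
  have fc: "peval [:- c, 1:] f = f - scalar c" by (simp add: scalar_uminus)
  have eq: "(f - scalar c) * peval q f = a * h"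
    using h q by (simp add: peval_mult fc del: peval_pCons mult_pCons_left)
  have "peval q f \<noteq> 0" using nq by (metis mult_zero_right)
  moreover have "f - scalar c \<noteq> 0" using f by simp
  ultimately have "h \<noteq> 0" using eq by (metis free_algebra_mult_eq_0_iff)
  from bezout[OF eq \<open>peval q f \<noteq> 0\<close> this \<open>f - scalar c \<noteq> 0\<close> a(1)]
  obtain d f' a' r s where d: "f - scalar c = d * f'" "a = d * a'" "d = (f - scalar c) * r + a * s"
    by blast
  have "d \<notin> below (Suc 0)"
  proof
    assume "d \<in> below (Suc 0)"
    then obtain e where e: "d = scalar e" using below_1 by blast
    then have "e \<noteq> 0" using d(2) a(1) by auto
    have comm: "peval q f * a = a * peval q g"
    proof (induction q)
      case (pCons x q)
      then show ?case
        by (simp add: distrib_left distrib_right mult.assoc scalar_commute)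
          (simp add: mult.assoc[symmetric] fa)
    qed simp
    \<comment> \<open>Multiply the Bezout identity for \<open>d = e\<close> by q(f) from the left:
      q(f) (f - c) = a h and q(f) a = a q(g) both lie in a R.\<close>
    have "scalar e * peval q f = peval q f * ((f - scalar c) * r + a * s)"
      unfolding d(3)[symmetric] e scalar_commute ..
    also have "\<dots> = (peval q f * (f - scalar c)) * r + (peval q f * a) * s"
      by (simp add: distrib_left mult.assoc)
    also have "peval q f * (f - scalar c) = a * h"
      using eq by (simp add: left_diff_distrib right_diff_distrib peval_commute scalar_commute)
    also have "a * h * r + peval q f * a * s = a * (h * r + peval q g * s)"
      by (simp add: comm distrib_left mult.assoc)
    finally have "scalar (inverse e) * (scalar e * peval q f) =
        a * (scalar (inverse e) * (h * r + peval q g * s))"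
      by (simp only: scalar_left_commute[of a])
    moreover have "scalar (inverse e) * (scalar e * peval q f) = peval q f"
      unfolding mult.assoc[symmetric] scalar_mult[symmetric] using \<open>e \<noteq> 0\<close> by simp
    ultimately have "peval q f = a * (scalar (inverse e) * (h * r + peval q g * s))"
      by simp
    with nq show False by blast
  qed
  moreover have "f = scalar c + d * f'"
    unfolding d(1)[symmetric] by simp
  ultimately show thesis using that d(2) by blast
qed

lemma intertwined_imp_chain:
  fixes f g a :: "('n::finite, 'k::alg_closed_field) free_algebra"
  assumes "f * a = a * g" "a \<noteq> 0"
  shows "elementary_intertwined\<^sup>*\<^sup>* f g"
  using assms
proof (induction "ht a" arbitrary: a f rule: less_induct)
  case less
  consider (const) "a \<in> below (Suc 0)" | (scalar) c where "f = scalar c"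
    | (step) "a \<notin> below (Suc 0)" "\<And>c. f \<noteq> scalar c" by blast
  then show ?case
  proof cases
    case const
    then obtain e where e: "a = scalar e" using below_1 by blast
    have "a * f = a * g" using less.prems(1) scalar_commute[of f e] unfolding e by simp
    then have "f = g" using less.prems(2) by (rule free_algebra_mult_left_cancel)
    then show ?thesis by simp
  next
    case scalar
    then have "a * f = a * g" using less.prems(1) scalar_commute[of a c] by simp
    then have "f = g" using less.prems(2) by (rule free_algebra_mult_left_cancel)
    then show ?thesis by simp
  next
    case step
    obtain c d f' a' where d: "f = scalar c + d * f'" "a = d * a'" "d \<notin> below (Suc 0)"
      using common_left_factor[OF less.prems step] by blast
    have nz: "d \<noteq> 0" "a' \<noteq> 0" using d(2) less.prems(2) by auto
    have "d * ((scalar c + f' * d) * a') = (scalar c + d * f') * (d * a')"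
      by (simp add: distrib_left distrib_right mult.assoc scalar_left_commute)
    also have "\<dots> = d * (a' * g)"
      using less.prems(1) by (simp add: d mult.assoc)
    finally have "(scalar c + f' * d) * a' = a' * g"
      using nz(1) by (rule free_algebra_mult_left_cancel)
    moreover have "ht a' < ht a"
      using ht_mult[OF nz] d by (simp add: below_iff_ht)
    ultimately have "elementary_intertwined\<^sup>*\<^sup>* (scalar c + f' * d) g"
      using less.hyps nz(2) by blast
    moreover have "elementary_intertwined f (scalar c + f' * d)"
      using d(1) unfolding elementary_intertwined_def by blast
    ultimately show ?thesis by simp
  qed
qed

lemma rtranclp_iff_chain:
  "r\<^sup>*\<^sup>* x y \<longleftrightarrow>
    (\<exists>(l::nat) F. 1 \<le> l \<and> F 1 = x \<and> F l = y \<and> (\<forall>i. 1 \<le> i \<and> i \<le> l - 1 \<longrightarrow> r (F i) (F (i + 1))))"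
proof
  assume "r\<^sup>*\<^sup>* x y"
  then obtain n F where F: "F 0 = x" "F n = y" "\<forall>i<n. r (F i) (F (Suc i))"
    unfolding rtranclp_power relpowp_fun_conv by blast
  have "r (F (i - 1)) (F i)" if "1 \<le> i" "i \<le> n" for i
    using F(3)[rule_format, of "i - 1"] that by simp
  then show "\<exists>(l::nat) F. 1 \<le> l \<and> F 1 = x \<and> F l = y \<and> (\<forall>i. 1 \<le> i \<and> i \<le> l - 1 \<longrightarrow> r (F i) (F (i + 1)))"
    using F(1,2) by (intro exI[of _ "Suc n"] exI[of _ "\<lambda>i. F (i - 1)"]) auto
next
  assume "\<exists>(l::nat) F. 1 \<le> l \<and> F 1 = x \<and> F l = y \<and> (\<forall>i. 1 \<le> i \<and> i \<le> l - 1 \<longrightarrow> r (F i) (F (i + 1)))"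
  then obtain l F where F: "1 \<le> (l::nat)" "F 1 = x" "F l = y"
    "\<And>i. 1 \<le> i \<Longrightarrow> i \<le> l - 1 \<Longrightarrow> r (F i) (F (i + 1))" by blast
  have "r\<^sup>*\<^sup>* x (F (Suc i))" if "Suc i \<le> l" for i
    using that
  proof (induction i)
    case 0
    then show ?case using F(2) by simp
  next
    case (Suc i)
    then have "r (F (Suc i)) (F (Suc (Suc i)))" using F(4)[of "Suc i"] by simp
    with Suc show ?case by (simp add: rtranclp.rtrancl_into_rtrancl)
  qed
  from this[of "l - 1"] show "r\<^sup>*\<^sup>* x y" using F(1,3) by simp
qed

section \<open>Evaluation and the Sylvester determinant\<close>

definition evw :: "nat \<Rightarrow> 'n list \<Rightarrow> ('n \<Rightarrow> 'a::comm_ring_1 mat) \<Rightarrow> 'a mat" where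
  "evw k w X = foldr (\<lambda>j A. X j * A) w (1\<^sub>m k)"

text \<open>The coefficient map \<open>h\<close> lets one development serve for matrices over the
  base field, where it is the identity, and over the polynomial ring of the deformation, where it is
  \<open>const2\<close>.\<close>

definition evm :: "('k::field \<Rightarrow> 'a::comm_ring_1) \<Rightarrow> nat \<Rightarrow> ('n, 'k) free_algebra \<Rightarrow> ('n \<Rightarrow> 'a mat) \<Rightarrow> 'a mat"
  where "evm h k f X = mat k k (\<lambda>(a, b). \<Sum>w\<in>keys f.
    h (lookup f w) * evw k (letters w) X $$ (a, b))"

lemma eval_at_eq_evm: "eval_at k f X = evm (\<lambda>x. x) k f X"
  by (simp add: eval_at_def evm_def eval_word_def evw_def)

lemma evm_carrier [simp]: "evm h k f X \<in> carrier_mat k k"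
  by (simp add: evm_def)

lemma evm_dim [simp]: "dim_row (evm h k f X) = k" "dim_col (evm h k f X) = k"
  by (simp_all add: evm_def)

lemma eval_at_carrier [simp]: "eval_at k f X \<in> carrier_mat k k"
  by (simp add: eval_at_eq_evm)

lemma matrix_tuplesD: "X \<in> matrix_tuples k \<Longrightarrow> X j \<in> carrier_mat k k"
  by (simp add: matrix_tuples_def)

lemma evw_carrier [simp]:
  assumes "X \<in> matrix_tuples k"
  shows "evw k w X \<in> carrier_mat k k"
  unfolding evw_def by (induction w) (use matrix_tuplesD[OF assms] in \<open>auto intro: mult_carrier_mat\<close>)

lemma evw_Nil [simp]: "evw k [] X = 1\<^sub>m k"
  by (simp add: evw_def)

lemma evw_snoc:
  assumes X: "X \<in> matrix_tuples k"
  shows "evw k (w @ [j]) X = evw k w X * X j"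
proof (induction w)
  case Nil
  then show ?case using matrix_tuplesD[OF X, of j] by (simp add: evw_def)
next
  case (Cons i w)
  have "evw k ((i # w) @ [j]) X = X i * evw k (w @ [j]) X" by (simp add: evw_def)
  also have "\<dots> = (X i * evw k w X) * X j"
    unfolding Cons
    by (rule assoc_mult_mat[symmetric, of _ k k _ k _ k]) (use X in \<open>auto simp: matrix_tuplesD\<close>)
  finally show ?case by (simp add: evw_def)
qed

lemma evw_hom:
  assumes "comm_ring_hom \<phi>" and X: "X \<in> matrix_tuples k"
  shows "map_mat \<phi> (evw k w X) = evw k w (\<lambda>j. map_mat \<phi> (X j))"
proof -
  interpret comm_ring_hom \<phi> by fact
  show ?thesis
  proof (induction w)
    case Nil
    then show ?case by (simp add: evw_def mat_hom_one)
  next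
    case (Cons i w)
    have "map_mat \<phi> (X i * evw k w X) = map_mat \<phi> (X i) * map_mat \<phi> (evw k w X)"
      by (rule mat_hom_mult[of _ k k _ k]) (use X in \<open>auto simp: matrix_tuplesD\<close>)
    then show ?case using Cons by (simp add: evw_def)
  qed
qed

lemma evm_superset:
  assumes "h 0 = 0" "finite S" "keys f \<subseteq> S" "a < k" "b < k"
  shows "evm h k f X $$ (a, b) = (\<Sum>w\<in>S. h (lookup f w) * evw k (letters w) X $$ (a, b))"
  using assms by (auto simp: evm_def in_keys_iff intro!: sum.mono_neutral_left)

lemma evm_hom:
  assumes \<phi>: "comm_ring_hom \<phi>" and X: "X \<in> matrix_tuples k"
  shows "map_mat \<phi> (evm h k f X) = evm (\<lambda>x. \<phi> (h x)) k f (\<lambda>j. map_mat \<phi> (X j))"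
proof -
  interpret comm_ring_hom \<phi> by fact
  have "\<phi> (evw k w X $$ (a, b)) = evw k w (\<lambda>j. map_mat \<phi> (X j)) $$ (a, b)"
    if "a < k" "b < k" for w a b
    using that carrier_matD[OF evw_carrier[OF X, of w]] by (simp add: evw_hom[OF \<phi> X, symmetric])
  then show ?thesis by (intro eq_matI) (auto simp: evm_def hom_distribs)
qed

context
  fixes h :: "'k::field \<Rightarrow> 'a::comm_ring_1" and k :: nat and X :: "'n \<Rightarrow> 'a mat"
  assumes h: "comm_ring_hom h" and X: "X \<in> matrix_tuples k"
begin

interpretation comm_ring_hom h by (rule h)

lemma evm_add: "evm h k (f + g) X = evm h k f X + evm h k g X"
proof (rule eq_matI)
  fix a b assume "a < dim_row (evm h k f X + evm h k g X)" "b < dim_col (evm h k f X + evm h k g X)"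
  then have ab: "a < k" "b < k" by simp_all
  let ?S = "keys f \<union> keys g"
  have "keys (f + g) \<subseteq> ?S" by (rule keys_add)
  then show "evm h k (f + g) X $$ (a, b) = (evm h k f X + evm h k g X) $$ (a, b)"
    using ab by (simp add: evm_superset[of h ?S] lookup_add hom_add distrib_right sum.distrib)
qed simp_all

lemma evm_single: "evm h k (single w c) X = h c \<cdot>\<^sub>m evw k (letters w) X"
proof (rule eq_matI)
  fix a b assume "a < dim_row (h c \<cdot>\<^sub>m evw k (letters w) X)" "b < dim_col (h c \<cdot>\<^sub>m evw k (letters w) X)"
  then have ab: "a < k" "b < k"
    using carrier_matD[OF evw_carrier[OF X, of "letters w"]] by simp_all
  have "keys (single w c) \<subseteq> {w}" by simp
  then show "evm h k (single w c) X $$ (a, b) = (h c \<cdot>\<^sub>m evw k (letters w) X) $$ (a, b)"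
    using ab carrier_matD[OF evw_carrier[OF X, of "letters w"]] by (subst evm_superset) auto
qed (use carrier_matD[OF evw_carrier[OF X, of "letters w"]] in auto)

lemma evm_scalar: "evm h k (scalar c) X = h c \<cdot>\<^sub>m 1\<^sub>m k"
  by (simp add: scalar_def evm_single)

lemma evm_mult_Var: "evm h k (f * Var j) X = evm h k f X * X j"
proof (induction f rule: poly_mapping_single_induct)
  case (single w c)
  then show ?case
    using evw_carrier[OF X, of "letters w"] matrix_tuplesD[OF X, of j]
    by (simp add: mult_single evm_single evw_snoc[OF X] mult_smult_assoc_mat[of _ k k _ k])
next
  case (add f g)
  then show ?case
    using matrix_tuplesD[OF X, of j]
    by (simp add: distrib_right evm_add add_mult_distrib_mat[of _ k k])
qed

lemma evm_mult: "evm h k (f * g) X = evm h k f X * evm h k g X"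
proof (induction g rule: free_algebra_induct)
  case (scalar c)
  have "evm h k (scalar c * f) X = h c \<cdot>\<^sub>m evm h k f X"
  proof (rule eq_matI)
    fix a b assume "a < dim_row (h c \<cdot>\<^sub>m evm h k f X)" "b < dim_col (h c \<cdot>\<^sub>m evm h k f X)"
    then have ab: "a < k" "b < k" by simp_all
    have "keys (scalar c * f) \<subseteq> keys f"
      by (auto simp: in_keys_iff)
    then show "evm h k (scalar c * f) X $$ (a, b) = (h c \<cdot>\<^sub>m evm h k f X) $$ (a, b)"
      using ab by (simp add: evm_superset[of h "keys f"] hom_mult sum_distrib_left mult.assoc)
  qed simp_all
  then show ?case
    by (simp add: scalar_commute evm_scalar mult_smult_distrib[of _ k k _ k])
next
  case (add g g')
  then show ?case by (simp add: distrib_left evm_add mult_add_distrib_mat[of _ k k _ k])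
next
  case (Var g j)
  then show ?case
    using matrix_tuplesD[OF X, of j]
    by (simp add: mult.assoc[symmetric] evm_mult_Var assoc_mult_mat[of _ k k _ k _ k])
qed

end

lemma comm_ring_hom_id: "comm_ring_hom (\<lambda>x. x)"
  by unfold_locales simp_all

lemmas eval_at_add = evm_add[OF comm_ring_hom_id, folded eval_at_eq_evm]
  and eval_at_scalar = evm_scalar[OF comm_ring_hom_id, folded eval_at_eq_evm]
  and eval_at_mult_Var = evm_mult_Var[OF comm_ring_hom_id, folded eval_at_eq_evm]
  and eval_at_mult = evm_mult[OF comm_ring_hom_id, folded eval_at_eq_evm]

text \<open>Up to the shift by \<open>c\<close> this compares A B with B A. For a nonzero
  eigenvalue, \<open>v\<close> is carried to B v, which cannot vanish; the eigenvalue 0, where B v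
  may vanish, is decided by det (A B) = det (B A).\<close>

lemma eigenvalue_shifted_mult_commute:
  fixes A B :: "'k::field mat"
  assumes A: "A \<in> carrier_mat k k" and B: "B \<in> carrier_mat k k"
    and ev: "eigenvalue (c \<cdot>\<^sub>m 1\<^sub>m k + A * B) e"
  shows "eigenvalue (c \<cdot>\<^sub>m 1\<^sub>m k + B * A) e"
proof -
  have AB: "A * B \<in> carrier_mat k k" "B * A \<in> carrier_mat k k"
    using A B by auto
  have shift: "(c \<cdot>\<^sub>m 1\<^sub>m k + M) *\<^sub>v v = e \<cdot>\<^sub>v v \<longleftrightarrow> M *\<^sub>v v = (e - c) \<cdot>\<^sub>v v"
    if M: "M \<in> carrier_mat k k" and v: "v \<in> carrier_vec k" for M v
  proof -
    have "(c \<cdot>\<^sub>m 1\<^sub>m k + M) *\<^sub>v v = c \<cdot>\<^sub>v v + M *\<^sub>v v"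
      using M v by (subst add_mult_distrib_mat_vec[of _ k k]) (auto simp: vec_eq_iff)
    then show ?thesis
      using M v by (auto simp: vec_eq_iff algebra_simps)
  qed
  have evs: "eigenvalue (c \<cdot>\<^sub>m 1\<^sub>m k + M) e \<longleftrightarrow>
      (\<exists>v\<in>carrier_vec k. v \<noteq> 0\<^sub>v k \<and> M *\<^sub>v v = (e - c) \<cdot>\<^sub>v v)"
    if M: "M \<in> carrier_mat k k" for M
    using shift[OF M] M by (auto simp: eigenvalue_def eigenvector_def)
  from ev evs[OF AB(1)] obtain v where v: "v \<in> carrier_vec k" "v \<noteq> 0\<^sub>v k"
    "(A * B) *\<^sub>v v = (e - c) \<cdot>\<^sub>v v" by blast
  show ?thesis
  proof (cases "e = c")
    case True
    then have "(A * B) *\<^sub>v v = 0\<^sub>v k" using v(1,3) by (auto simp: vec_eq_iff)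
    then have "det (A * B) = 0" using det_0_iff_vec_prod_zero[OF AB(1)] v by blast
    then have "det (B * A) = 0" using A B by (simp add: det_mult mult.commute)
    then obtain w where "w \<in> carrier_vec k" "w \<noteq> 0\<^sub>v k" "(B * A) *\<^sub>v w = 0\<^sub>v k"
      using det_0_iff_vec_prod_zero[OF AB(2)] by blast
    then show ?thesis unfolding evs[OF AB(2)] using True by (intro bexI[of _ w]) (auto simp: vec_eq_iff)
  next
    case False
    have ABv: "A *\<^sub>v (B *\<^sub>v v) = (e - c) \<cdot>\<^sub>v v"
      using v A B by (simp add: assoc_mult_mat_vec[of _ k k _ k])
    have Bv: "B *\<^sub>v v \<in> carrier_vec k" using B v by simp
    have "B *\<^sub>v v \<noteq> 0\<^sub>v k"
    proof
      assume "B *\<^sub>v v = 0\<^sub>v k"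
      then have "(e - c) \<cdot>\<^sub>v v = A *\<^sub>v 0\<^sub>v k" using ABv by simp
      also have "\<dots> = 0\<^sub>v k" using A by (auto simp: vec_eq_iff)
      finally have "(e - c) \<cdot>\<^sub>v v = 0\<^sub>v k" .
      then have "v = 0\<^sub>v k" using False v(1) by (auto simp: vec_eq_iff)
      with v(2) show False by simp
    qed
    moreover have "(B * A) *\<^sub>v (B *\<^sub>v v) = B *\<^sub>v (A *\<^sub>v (B *\<^sub>v v))"
      using A B v Bv by (simp add: assoc_mult_mat_vec[of _ k k _ k])
    ultimately show ?thesis unfolding evs[OF AB(2)]
      using ABv B v(1) Bv by (intro bexI[of _ "B *\<^sub>v v"]) (auto simp: mult_mat_vec[of _ k k])
  qed
qed

lemma elementary_intertwined_imp_isospectral: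
  assumes "elementary_intertwined f g"
  shows "isospectral f g"
proof -
  from assms obtain c a b where fg: "f = scalar c + a * b" "g = scalar c + b * a"
    unfolding elementary_intertwined_def by blast
  show ?thesis
    unfolding isospectral_def
  proof (intro allI ballI)
    fix k and X :: "'a \<Rightarrow> 'b mat" assume X: "X \<in> matrix_tuples k"
    have "eval_at k f X = c \<cdot>\<^sub>m 1\<^sub>m k + eval_at k a X * eval_at k b X"
      "eval_at k g X = c \<cdot>\<^sub>m 1\<^sub>m k + eval_at k b X * eval_at k a X"
      by (simp_all add: fg eval_at_add[OF X] eval_at_scalar[OF X] eval_at_mult[OF X])
    then show "spectrum (eval_at k f X) = spectrum (eval_at k g X)"
      unfolding spectrum_def
      by (metis Collect_cong eval_at_carrier eigenvalue_shifted_mult_commute)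
  qed
qed

lemma chain_imp_isospectral:
  assumes "elementary_intertwined\<^sup>*\<^sup>* f g"
  shows "isospectral f g"
  using assms
proof (induction rule: rtranclp_induct)
  case base
  then show ?case by (simp add: isospectral_def)
next
  case (step g h)
  then show ?case
    using elementary_intertwined_imp_isospectral[of g h] by (simp add: isospectral_def)
qed

lemma eigenvalue_exists:
  fixes A :: "'k::alg_closed_field mat"
  assumes "A \<in> carrier_mat k k" "k > 0"
  obtains e where "eigenvalue A e"
proof -
  have "degree (char_poly A) > 0" using degree_monic_char_poly[OF assms(1)] assms(2) by simp
  then show thesis
    using alg_closed_imp_poly_has_root that eigenvalue_root_char_poly[OF assms(1)] by blast
qed

lemma zariski_dense_matrix_tuples: "zariski_dense k (matrix_tuples k)"
  unfolding zariski_dense_def using closure_of_topspace[of "zariski k"]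
  by (simp add: topspace_zariski)

lemma polynomial_function_vanishes:
  fixes D :: "('n \<Rightarrow> 'k::field mat) set"
  assumes D: "zariski_dense k D" and p: "p \<in> polynomial_functions k"
    and zero: "\<And>X. X \<in> D \<Longrightarrow> p X = 0" and X: "X \<in> matrix_tuples k"
  shows "p X = 0"
proof (rule ccontr)
  assume "p X \<noteq> 0"
  let ?U = "matrix_tuples k - zero_locus k {p}"
  have "openin (zariski k) ?U"
    unfolding openin_zariski using p by blast
  moreover have "X \<in> ?U" using X \<open>p X \<noteq> 0\<close> by (simp add: zero_locus_def)
  moreover have "X \<in> zariski k closure_of D" using D X by (simp add: zariski_dense_def)
  ultimately obtain Y where "Y \<in> D" "Y \<in> ?U"
    unfolding in_closure_of by blast
  then show False using zero[of Y] by (simp add: zero_locus_def)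
qed

lemma polynomial_functions_sum:
  "(\<And>i. i \<in> A \<Longrightarrow> p i \<in> polynomial_functions k) \<Longrightarrow> (\<lambda>X. \<Sum>i\<in>A. p i X) \<in> polynomial_functions k"
  by (induction A rule: infinite_finite_induct)
    (auto intro: polynomial_functions.const polynomial_functions.add)

lemma polynomial_functions_prod:
  "(\<And>i. i \<in> A \<Longrightarrow> p i \<in> polynomial_functions k) \<Longrightarrow> (\<lambda>X. \<Prod>i\<in>A. p i X) \<in> polynomial_functions k"
  by (induction A rule: infinite_finite_induct)
    (auto intro: polynomial_functions.const polynomial_functions.mult)

lemma polynomial_functions_diff:
  assumes "p \<in> polynomial_functions k" "q \<in> polynomial_functions k"
  shows "(\<lambda>X. p X - q X) \<in> polynomial_functions k"
proof -
  have "(\<lambda>X. p X + (- 1) * q X) \<in> polynomial_functions k"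
    by (intro polynomial_functions.add polynomial_functions.mult polynomial_functions.const assms)
  then show ?thesis by simp
qed

text \<open>The agreement is restricted to \<open>matrix_tuples k\<close>: on matrices of other
  sizes the entries of a product have no such description.\<close>

lemma polynomial_functions_evw:
  fixes w :: "'n list"
  assumes "a < k" "b < k"
  shows "\<exists>p \<in> polynomial_functions k. \<forall>X \<in> (matrix_tuples k :: ('n \<Rightarrow> 'k::field mat) set). evw k w X $$ (a, b) = p X"
  using assms
proof (induction w arbitrary: a)
  case Nil
  then show ?case by (intro bexI[OF _ polynomial_functions.const[of "1\<^sub>m k $$ (a, b)"]]) simp
next
  case (Cons j w)
  have "\<exists>p. c < k \<longrightarrow> p \<in> polynomial_functions k \<and>
      (\<forall>X \<in> (matrix_tuples k :: ('n \<Rightarrow> 'k mat) set). evw k w X $$ (c, b) = p X)" for c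
    using Cons.IH[of c] Cons.prems(2) by (cases "c < k") auto
  then have "\<forall>c. \<exists>p. c < k \<longrightarrow> p \<in> polynomial_functions k \<and>
      (\<forall>X \<in> (matrix_tuples k :: ('n \<Rightarrow> 'k mat) set). evw k w X $$ (c, b) = p X)"
    by (rule allI)
  from choice[OF this] obtain p where p: "\<And>c. c < k \<Longrightarrow> p c \<in> polynomial_functions k"
    "\<And>c X. c < k \<Longrightarrow> X \<in> (matrix_tuples k :: ('n \<Rightarrow> 'k mat) set) \<Longrightarrow> evw k w X $$ (c, b) = p c X"
    by blast
  have "(\<lambda>X :: 'n \<Rightarrow> 'k mat. \<Sum>c<k. X j $$ (a, c) * p c X) \<in> polynomial_functions k"
    using p(1) Cons.prems
    by (intro polynomial_functions_sum polynomial_functions.mult polynomial_functions.entry) auto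
  moreover have "evw k (j # w) X $$ (a, b) = (\<Sum>c<k. X j $$ (a, c) * p c X)"
    if X: "X \<in> matrix_tuples k" for X :: "'n \<Rightarrow> 'k mat"
  proof -
    have "evw k (j # w) X $$ (a, b) = (X j * evw k w X) $$ (a, b)" by (simp add: evw_def)
    also have "\<dots> = (\<Sum>c<k. X j $$ (a, c) * evw k w X $$ (c, b))"
      using Cons.prems carrier_matD[OF evw_carrier[OF X, of w]] carrier_matD[OF matrix_tuplesD[OF X, of j]]
      by (simp add: scalar_prod_def atLeast0LessThan)
    finally show ?thesis using p(2) X by simp
  qed
  ultimately show ?case by (intro bexI ballI)
qed

lemma polynomial_functions_eval_at:
  fixes f :: "('n, 'k::field) free_algebra"
  assumes "a < k" "b < k"
  shows "\<exists>p \<in> polynomial_functions k. \<forall>X \<in> matrix_tuples k. eval_at k f X $$ (a, b) = p X"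
proof -
  have "\<forall>w :: 'n free_monoid. \<exists>p. p \<in> polynomial_functions k \<and>
      (\<forall>X \<in> (matrix_tuples k :: ('n \<Rightarrow> 'k mat) set). evw k (letters w) X $$ (a, b) = p X)"
    using polynomial_functions_evw[OF assms] by blast
  from choice[OF this] obtain p where p: "\<And>w. p w \<in> polynomial_functions k"
    "\<And>w X. X \<in> (matrix_tuples k :: ('n \<Rightarrow> 'k mat) set) \<Longrightarrow> evw k (letters w) X $$ (a, b) = p w X"
    by blast
  have "(\<lambda>X. \<Sum>w\<in>keys f. lookup f w * p w X) \<in> polynomial_functions k"
    using p(1) by (intro polynomial_functions_sum polynomial_functions.mult polynomial_functions.const)
  then show ?thesis
    using p(2) assms by (intro bexI) (auto simp: eval_at_eq_evm evm_def)
qed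

text \<open>The matrix of \<open>A \<mapsto> F A - A G\<close>; the entry \<open>(a, b)\<close> of \<open>A\<close> has the index \<open>a k + b\<close>.\<close>

definition sylvester :: "nat \<Rightarrow> 'a::comm_ring_1 mat \<Rightarrow> 'a mat \<Rightarrow> 'a mat" where
  "sylvester k F G = mat (k * k) (k * k) (\<lambda>(p, q).
     (if p mod k = q mod k then F $$ (p div k, q div k) else 0) -
     (if p div k = q div k then G $$ (q mod k, p mod k) else 0))"

lemma sylvester_carrier [simp]: "sylvester k F G \<in> carrier_mat (k * k) (k * k)"
  by (simp add: sylvester_def)

lemma index_less_square: "a < k \<Longrightarrow> b < k \<Longrightarrow> a * k + b < k * k" for a b k :: nat
proof -
  assume "a < k" "b < k"
  then have "a * k + b < Suc a * k" by simp
  also have "\<dots> \<le> k * k" using \<open>a < k\<close> by (intro mult_le_mono1) simp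
  finally show ?thesis .
qed

lemma sum_square:
  "(\<Sum>q<k * k. f q) = (\<Sum>c<k. \<Sum>d<k. f (c * k + d))" for k :: nat
proof -
  have "(\<Sum>c<k. \<Sum>d<k. f (c * k + d)) = (\<Sum>(c, d)\<in>{..<k} \<times> {..<k}. f (c * k + d))"
    by (simp add: sum.cartesian_product)
  also have "\<dots> = (\<Sum>q<k * k. f q)"
    by (rule sum.reindex_bij_witness[of _ "\<lambda>q. (q div k, q mod k)" "\<lambda>(c, d). c * k + d"])
      (auto simp: index_less_square less_mult_imp_div_less mod_less_divisor, metis gr0I mod_less_divisor mult_0_right not_less_zero)
  finally show ?thesis ..
qed

lemma sylvester_mult:
  assumes F: "F \<in> carrier_mat k k" and G: "G \<in> carrier_mat k k" and v: "v \<in> carrier_vec (k * k)"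
    and ab: "a < k" "b < k"
  defines "A \<equiv> mat k k (\<lambda>(a, b). v $ (a * k + b))"
  shows "(sylvester k F G *\<^sub>v v) $ (a * k + b) = (F * A) $$ (a, b) - (A * G) $$ (a, b)"
proof -
  have "(sylvester k F G *\<^sub>v v) $ (a * k + b) = (\<Sum>q<k * k. sylvester k F G $$ (a * k + b, q) * v $ q)"
    using v ab index_less_square[OF ab] by (simp add: sylvester_def scalar_prod_def atLeast0LessThan)
  also have "\<dots> = (\<Sum>c<k. \<Sum>d<k. sylvester k F G $$ (a * k + b, c * k + d) * v $ (c * k + d))"
    by (rule sum_square)
  also have "\<dots> = (\<Sum>c<k. \<Sum>d<k. (if d = b then F $$ (a, c) * v $ (c * k + d) else 0) -
      (if c = a then G $$ (d, b) * v $ (c * k + d) else 0))"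
    using ab by (intro sum.cong refl) (auto simp: sylvester_def index_less_square left_diff_distrib)
  also have "\<dots> = (\<Sum>c<k. F $$ (a, c) * v $ (c * k + b)) - (\<Sum>d<k. G $$ (d, b) * v $ (a * k + d))"
  proof -
    have "(\<Sum>c<k. \<Sum>d<k. if c = a then G $$ (d, b) * v $ (c * k + d) else 0) =
        (\<Sum>c<k. if c = a then \<Sum>d<k. G $$ (d, b) * v $ (c * k + d) else 0)"
      by (intro sum.cong) auto
    then show ?thesis using ab by (simp add: sum_subtractf)
  qed
  also have "\<dots> = (F * A) $$ (a, b) - (A * G) $$ (a, b)"
    using F G ab by (simp add: A_def scalar_prod_def atLeast0LessThan mult.commute)
  finally show ?thesis .
qed

lemma det_sylvester_eq_0_iff:
  fixes F G :: "'a::idom mat"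
  assumes F: "F \<in> carrier_mat k k" and G: "G \<in> carrier_mat k k"
  shows "det (sylvester k F G) = 0 \<longleftrightarrow> (\<exists>A\<in>carrier_mat k k. A \<noteq> 0\<^sub>m k k \<and> F * A = A * G)"
proof
  assume "det (sylvester k F G) = 0"
  then obtain v where v: "v \<in> carrier_vec (k * k)" "v \<noteq> 0\<^sub>v (k * k)"
    "sylvester k F G *\<^sub>v v = 0\<^sub>v (k * k)"
    using det_0_iff_vec_prod_zero[OF sylvester_carrier] by blast
  define A where "A = mat k k (\<lambda>(a, b). v $ (a * k + b))"
  have A: "A \<in> carrier_mat k k" by (simp add: A_def)
  have "F * A = A * G"
  proof (rule eq_matI)
    fix a b assume "a < dim_row (A * G)" "b < dim_col (A * G)"
    then have ab: "a < k" "b < k" using A G by auto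
    then show "(F * A) $$ (a, b) = (A * G) $$ (a, b)"
      using sylvester_mult[OF F G v(1) ab] index_less_square[OF ab] unfolding v(3) A_def[symmetric]
      by simp
  qed (use A F G in auto)
  moreover have "A \<noteq> 0\<^sub>m k k"
  proof
    assume A0: "A = 0\<^sub>m k k"
    have "v $ q = 0" if "q < k * k" for q
    proof -
      have "k > 0" using that by (cases k) auto
      then have "A $$ (q div k, q mod k) = v $ q"
        using that by (simp add: A_def less_mult_imp_div_less)
      then show ?thesis using \<open>k > 0\<close> that by (simp add: A0 less_mult_imp_div_less)
    qed
    then have "v = 0\<^sub>v (k * k)" using v(1) by auto
    with v(2) show False ..
  qed
  ultimately show "\<exists>A\<in>carrier_mat k k. A \<noteq> 0\<^sub>m k k \<and> F * A = A * G" using A by blast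
next
  assume "\<exists>A\<in>carrier_mat k k. A \<noteq> 0\<^sub>m k k \<and> F * A = A * G"
  then obtain A where A: "A \<in> carrier_mat k k" "A \<noteq> 0\<^sub>m k k" "F * A = A * G" by blast
  define v where "v = vec (k * k) (\<lambda>q. A $$ (q div k, q mod k))"
  have v: "v \<in> carrier_vec (k * k)" by (simp add: v_def)
  have vA: "v $ (a * k + b) = A $$ (a, b)" if "a < k" "b < k" for a b
    using that index_less_square[OF that] by (simp add: v_def)
  then have "mat k k (\<lambda>(a, b). v $ (a * k + b)) = A" using A(1) by auto
  note syl = sylvester_mult[OF F G v, unfolded this]
  have "sylvester k F G *\<^sub>v v = 0\<^sub>v (k * k)"
  proof (rule eq_vecI)
    fix q assume "q < dim_vec (0\<^sub>v (k * k))"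
    then have q: "q < k * k" by simp
    then have "k > 0" by (cases k) auto
    with q have "(sylvester k F G *\<^sub>v v) $ ((q div k) * k + q mod k) = 0"
      by (subst syl) (simp_all add: A(3) less_mult_imp_div_less)
    then show "(sylvester k F G *\<^sub>v v) $ q = 0\<^sub>v (k * k) $ q" using q by simp
  qed (simp add: sylvester_def)
  moreover have "v \<noteq> 0\<^sub>v (k * k)"
  proof
    assume v0: "v = 0\<^sub>v (k * k)"
    have "A = 0\<^sub>m k k"
      by (rule eq_matI) (use A(1) vA index_less_square in \<open>auto simp: v0\<close>)
    with A(2) show False ..
  qed
  ultimately show "det (sylvester k F G) = 0"
    using det_0_iff_vec_prod_zero[OF sylvester_carrier] v by blast
qed

text \<open>If \<open>v\<close> is an eigenvector of \<open>F\<close> and \<open>w\<close> one of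
  the transpose of \<open>G\<close> for the same eigenvalue, the rank one matrix with entries
  \<open>v $ a * w $ b\<close> intertwines \<open>F\<close> and \<open>G\<close>.\<close>

lemma shared_eigenvalue_imp_sylvester:
  fixes F G :: "'k::field mat"
  assumes F: "F \<in> carrier_mat k k" and G: "G \<in> carrier_mat k k"
    and e: "eigenvalue F e" "eigenvalue G e"
  shows "det (sylvester k F G) = 0"
proof -
  obtain v where v: "v \<in> carrier_vec k" "v \<noteq> 0\<^sub>v k" "F *\<^sub>v v = e \<cdot>\<^sub>v v"
    using e(1) F by (auto simp: eigenvalue_def eigenvector_def)
  have "eigenvalue (transpose_mat G) e"
    using e(2) G char_poly_transpose_mat[OF G]
    by (metis eigenvalue_root_char_poly transpose_carrier_mat)
  then obtain w where w: "w \<in> carrier_vec k" "w \<noteq> 0\<^sub>v k" "transpose_mat G *\<^sub>v w = e \<cdot>\<^sub>v w"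
    using G by (auto simp: eigenvalue_def eigenvector_def)
  define A where "A = mat k k (\<lambda>(a, b). v $ a * w $ b)"
  have A: "A \<in> carrier_mat k k" by (simp add: A_def)
  have "F * A = A * G"
  proof (rule eq_matI)
    fix a b assume "a < dim_row (A * G)" "b < dim_col (A * G)"
    then have ab: "a < k" "b < k" using A G by auto
    have "(F * A) $$ (a, b) = (\<Sum>c<k. F $$ (a, c) * v $ c) * w $ b"
      using ab F by (simp add: A_def scalar_prod_def atLeast0LessThan sum_distrib_right mult.assoc)
    also have "(\<Sum>c<k. F $$ (a, c) * v $ c) = (F *\<^sub>v v) $ a"
      using ab F v(1) by (simp add: scalar_prod_def atLeast0LessThan)
    also have "\<dots> * w $ b = v $ a * (transpose_mat G *\<^sub>v w) $ b"
      using ab v(1) w(1) by (simp add: v(3) w(3))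
    also have "(transpose_mat G *\<^sub>v w) $ b = (\<Sum>c<k. G $$ (c, b) * w $ c)"
      using ab G w(1) by (simp add: scalar_prod_def atLeast0LessThan)
    also have "v $ a * \<dots> = (A * G) $$ (a, b)"
      using ab G by (simp add: A_def scalar_prod_def atLeast0LessThan sum_distrib_left mult_ac)
    finally show "(F * A) $$ (a, b) = (A * G) $$ (a, b)" .
  qed (use A F G in auto)
  moreover have "A \<noteq> 0\<^sub>m k k"
  proof
    obtain a b where "a < k" "v $ a \<noteq> 0" "b < k" "w $ b \<noteq> 0"
      using v(1,2) w(1,2) by (auto simp: vec_eq_iff)
    moreover assume "A = 0\<^sub>m k k"
    then have "A $$ (a, b) = 0\<^sub>m k k $$ (a, b)" by simp
    ultimately show False by (simp add: A_def)
  qed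
  ultimately show ?thesis using det_sylvester_eq_0_iff[OF F G] A by blast
qed

text \<open>By the Leibniz formula the Sylvester determinant is a polynomial function of the tuple,
  so its vanishing passes from a dense set to all tuples, including those obtained by specializing a
  deformation.\<close>

lemma sylvester_vanishes:
  fixes D :: "('n \<Rightarrow> 'k::field mat) set"
  assumes D: "zariski_dense k D"
    and ev: "\<And>X. X \<in> D \<Longrightarrow> \<exists>c. eigenvalue (eval_at k f X) c \<and> eigenvalue (eval_at k g X) c"
    and X: "X \<in> matrix_tuples k"
  shows "det (sylvester k (eval_at k f X) (eval_at k g X)) = 0"
proof -
  let ?S = "\<lambda>X. sylvester k (eval_at k f X) (eval_at k g X)"
  have entry: "\<exists>r \<in> polynomial_functions k. \<forall>X \<in> matrix_tuples k. ?S X $$ (p, q) = r X"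
    if pq: "p < k * k" "q < k * k" for p q
  proof -
    have "k > 0" using pq by (cases k) auto
    then have *: "p div k < k" "q div k < k" "p mod k < k" "q mod k < k"
      using pq by (simp_all add: less_mult_imp_div_less)
    obtain r s where r: "r \<in> polynomial_functions k" "s \<in> polynomial_functions k"
      "\<And>X. X \<in> matrix_tuples k \<Longrightarrow> eval_at k f X $$ (p div k, q div k) = r X"
      "\<And>X. X \<in> matrix_tuples k \<Longrightarrow> eval_at k g X $$ (q mod k, p mod k) = s X"
      using polynomial_functions_eval_at[OF *(1,2), of f] polynomial_functions_eval_at[OF *(4,3), of g]
      by metis
    let ?r = "\<lambda>X. (if p mod k = q mod k then r X else 0) - (if p div k = q div k then s X else 0)"
    have "?r \<in> polynomial_functions k"
      using r(1,2) polynomial_functions.const[of 0 k]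
      by (intro polynomial_functions_diff; cases "p mod k = q mod k"; cases "p div k = q div k") simp_all
    then show ?thesis by (rule bexI[rotated]) (use r(3,4) pq in \<open>auto simp: sylvester_def\<close>)
  qed
  obtain r where r: "\<And>p q. p < k * k \<Longrightarrow> q < k * k \<Longrightarrow> r p q \<in> polynomial_functions k"
    "\<And>p q X. p < k * k \<Longrightarrow> q < k * k \<Longrightarrow> X \<in> matrix_tuples k \<Longrightarrow> ?S X $$ (p, q) = r p q X"
    using entry by metis
  let ?d = "\<lambda>X. \<Sum>p\<in>{p. p permutes {0..<k * k}}. signof p * (\<Prod>i = 0..<k * k. r i (p i) X)"
  have perm: "p i < k * k" if "p permutes {0..<k * k}" "i < k * k" for p i
    using permutes_in_image[OF that(1), of i] that(2) by simp
  have d: "?d \<in> polynomial_functions k"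
    by (intro polynomial_functions_sum polynomial_functions.mult polynomial_functions.const
        polynomial_functions_prod r(1)) (auto simp: perm)
  have det: "det (?S X) = ?d X" if "X \<in> matrix_tuples k" for X
    unfolding det_def'[OF sylvester_carrier]
    by (intro sum.cong refl arg_cong2[of _ _ _ _ "(*)"] prod.cong) (auto simp: perm r(2)[OF _ _ that])
  have "?d X = 0" if "X \<in> D" for X
  proof -
    have "X \<in> matrix_tuples k" using D that by (auto simp: zariski_dense_def)
    moreover have "det (?S X) = 0"
      using ev[OF that] shared_eigenvalue_imp_sylvester[OF eval_at_carrier eval_at_carrier] by blast
    ultimately show ?thesis using det by simp
  qed
  from polynomial_function_vanishes[OF D d this X] show ?thesis
    unfolding det[OF X] .
qed

section \<open>Deformation into a cyclic algebra\<close>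

text \<open>It suffices to find a p-th root \<eta> of \<zeta> with \<open>\<eta> ^ m\<close>
  different from 1. If some p-th root fails, then \<open>p\<close> does not divide \<open>m\<close>,
  and multiplying it by a nontrivial p-th root of unity \<omega> repairs it.\<close>

lemma primitive_root_step:
  fixes \<zeta> :: "'k::{alg_closed_field, field_char_0}"
  assumes \<zeta>: "\<And>n. \<zeta> ^ n = 1 \<longleftrightarrow> m dvd n" and p: "prime p" and m: "m > 0"
  obtains \<eta> :: 'k where "\<And>n. \<eta> ^ n = 1 \<longleftrightarrow> p * m dvd n"
proof -
  have p1: "p > 1" using p by (rule prime_gt_1_nat)
  \<comment> \<open>A root of 1 + x + ... + x^(p - 1). It differs from 1 because \<open>p\<close> is
    nonzero in characteristic 0.\<close>
  have "\<exists>\<omega> :: 'k. (\<Sum>i\<le>p - 1. 1 * \<omega> ^ i) = 0"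
    by (rule alg_closed) (use p1 in auto)
  then obtain \<omega> :: 'k where "(\<Sum>i<p. \<omega> ^ i) = 0"
    using p1 by (auto simp: lessThan_Suc_atMost[symmetric])
  moreover from this have "\<omega> \<noteq> 1" using p1 by auto
  ultimately have \<omega>: "\<omega> ^ p = 1" "\<omega> \<noteq> 1"
    using geometric_sum[of \<omega> p] by auto
  obtain \<eta>0 where \<eta>0: "\<eta>0 ^ p = \<zeta>" using nth_root_exists[of p \<zeta>] p1 by auto
  have power_eq_1: "p dvd l" if "\<tau> ^ p = 1" "\<tau> \<noteq> 1" "\<tau> ^ l = 1" for \<tau> :: 'k and l
  proof (rule ccontr)
    assume "\<not> p dvd l"
    then have "coprime l p" using p by (metis coprime_commute prime_imp_coprime)
    moreover have "l \<noteq> 0" using \<open>\<not> p dvd l\<close> by (metis dvd_0_right)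
    ultimately obtain x y where "l * x = p * y + 1"
      using bezout_nat[of l p] by (metis coprime_imp_gcd_eq_1)
    then have "(\<tau> ^ l) ^ x = (\<tau> ^ p) ^ y * \<tau>"
      by (metis power_add power_mult power_one_right)
    with that show False by simp
  qed
  obtain \<eta> where \<eta>: "\<eta> ^ p = \<zeta>" "\<eta> ^ m \<noteq> 1"
  proof (cases "\<eta>0 ^ m = 1")
    case True
    have "\<not> p dvd m"
    proof
      assume "p dvd m"
      then obtain r where r: "m = p * r" by blast
      then have "\<zeta> ^ r = 1" using True \<eta>0 by (metis power_mult)
      then have "m dvd r" using \<zeta> by blast
      then show False using r p1 m by (auto dest: dvd_imp_le)
    qed
    then have "\<omega> ^ m \<noteq> 1" using power_eq_1 \<omega> by blast
    then show thesis
      using that[of "\<eta>0 * \<omega>"] \<eta>0 \<omega> True by (simp add: power_mult_distrib)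
  qed (use that \<eta>0 in blast)
  have "\<eta> ^ n = 1 \<longleftrightarrow> p * m dvd n" for n
  proof
    assume n: "\<eta> ^ n = 1"
    have "\<zeta> ^ n = (\<eta> ^ n) ^ p" by (metis \<eta>(1) mult.commute power_mult)
    then have "m dvd n" using n \<zeta> by simp
    then obtain l where l: "n = m * l" by blast
    have "(\<eta> ^ m) ^ p = 1" using \<zeta>[of m] \<eta>(1) by (metis dvd_refl mult.commute power_mult)
    moreover have "(\<eta> ^ m) ^ l = 1" using n l by (simp add: power_mult)
    ultimately have "p dvd l" using power_eq_1 \<eta>(2) by blast
    then show "p * m dvd n" using l by (auto simp: dvd_def)
  next
    assume "p * m dvd n"
    then obtain l where "n = p * m * l" by blast
    then have "\<eta> ^ n = (\<zeta> ^ m) ^ l" using \<eta>(1) by (simp add: power_mult)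
    then show "\<eta> ^ n = 1" using \<zeta>[of m] by simp
  qed
  then show thesis by (rule that)
qed

lemma primitive_root_of_unity:
  assumes "k > 0"
  shows "\<exists>\<zeta> :: 'k::{alg_closed_field, field_char_0}. \<forall>n. \<zeta> ^ n = 1 \<longleftrightarrow> k dvd n"
  using assms
proof (induction k rule: less_induct)
    case (less k)
    show ?case
    proof (cases "k = 1")
      case True
      then show ?thesis by (intro exI[of _ 1]) simp
    next
      case False
      then obtain p where p: "prime p" "p dvd k" using prime_factor_nat by blast
      then obtain m where m: "k = p * m" by blast
      then have "m > 0" "m < k" using less.prems prime_gt_1_nat[OF p(1)] by auto
      then obtain \<zeta> :: 'k where "\<And>n. \<zeta> ^ n = 1 \<longleftrightarrow> m dvd n" using less.IH by blast
      from primitive_root_step[OF this p(1) \<open>m > 0\<close>] m show ?thesis by metis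
    qed
qed

lemma interpolation:
  fixes x v :: "nat \<Rightarrow> 'k::field"
  assumes "inj_on x {..<k}"
  shows "\<exists>p. \<forall>i<k. poly p (x i) = v i"
  using assms
proof (induction k)
  case (Suc k)
  then obtain p where p: "\<forall>i<k. poly p (x i) = v i"
    by (auto simp: lessThan_Suc inj_on_insert)
  define q where "q = (\<Prod>i<k. [:- x i, 1:])"
  have q: "poly q (x i) = 0" if "i < k" for i
    using that by (auto simp: q_def poly_prod)
  have "poly q (x k) \<noteq> 0"
    using Suc.prems by (auto simp: q_def poly_prod inj_on_def lessThan_Suc)
  then show ?case
    using p q by (intro exI[of _ "p + Polynomial.smult ((v k - poly p (x k)) / poly q (x k)) q"])
      (auto simp: less_Suc_eq)
qed simp

text \<open>The vector p(T) v by Horner's rule. The scalars come from the field through \<iota>,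
  since the operators of interest substitute into polynomial entries and are not linear over the
  ring \<open>'m\<close>.\<close>

definition op_eval :: "('k::field \<Rightarrow> 'm::comm_ring_1) \<Rightarrow> (('i \<Rightarrow> 'm) \<Rightarrow> 'i \<Rightarrow> 'm) \<Rightarrow>
    'k poly \<Rightarrow> ('i \<Rightarrow> 'm) \<Rightarrow> 'i \<Rightarrow> 'm" where
  "op_eval \<iota> T p v = fold_coeffs (\<lambda>c r i. \<iota> c * v i + T r i) p (\<lambda>i. 0)"

text \<open>No finite dimension is assumed: x^N - 1 annihilates \<open>v\<close>, and this
  polynomial splits. Removing linear factors x - c one at a time, the first quotient
  \<open>q\<close> with q(T) v nonzero gives an eigenvector for \<open>c\<close>.\<close>

lemma eigenvector_of_finite_order:
  fixes \<iota> :: "'k::alg_closed_field \<Rightarrow> 'm::comm_ring_1" and T :: "('i \<Rightarrow> 'm) \<Rightarrow> 'i \<Rightarrow> 'm"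
  assumes \<iota>: "comm_ring_hom \<iota>"
    and T_add: "\<And>v w. T (\<lambda>i. v i + w i) = (\<lambda>i. T v i + T w i)"
    and T_scale: "\<And>c v. T (\<lambda>i. \<iota> c * v i) = (\<lambda>i. \<iota> c * T v i)"
    and V_add: "\<And>v w. V v \<Longrightarrow> V w \<Longrightarrow> V (\<lambda>i. v i + w i)"
    and V_scale: "\<And>c v. V v \<Longrightarrow> V (\<lambda>i. \<iota> c * v i)"
    and V_T: "\<And>v. V v \<Longrightarrow> V (T v)"
    and v: "V v" "v \<noteq> (\<lambda>i. 0)" "(T ^^ N) v = v" "N > 0"
  obtains c w where "V w" "w \<noteq> (\<lambda>i. 0)" "T w = (\<lambda>i. \<iota> c * w i)"
proof -
  interpret \<iota>: comm_ring_hom \<iota> by (rule \<iota>)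
  have T0: "T (\<lambda>i. 0) = (\<lambda>i. 0)" using T_scale[of 0 "\<lambda>i. 0"] by simp
  let ?E = "op_eval \<iota> T"
  have E_0: "?E 0 v = (\<lambda>i. 0)" by (simp add: op_eval_def)
  have E_pCons: "?E (pCons a p) v = (\<lambda>i. \<iota> a * v i + T (?E p v) i)" for a p
    by (cases "p = 0 \<and> a = 0") (auto simp: op_eval_def T0)
  have E_add: "?E (p + q) v = (\<lambda>i. ?E p v i + ?E q v i)" for p q
    by (induction p q rule: poly_induct2) (simp_all add: E_0 E_pCons T_add \<iota>.hom_add algebra_simps)
  have E_smult: "?E (Polynomial.smult c p) v = (\<lambda>i. \<iota> c * ?E p v i)" for c p
    by (induction p) (simp_all add: E_0 E_pCons T_scale \<iota>.hom_mult algebra_simps)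
  have E_monom: "?E (monom 1 n) v = (T ^^ n) v" for n
    by (induction n) (simp_all add: monom_0 monom_Suc E_0 E_pCons T0)
  have VE: "V (?E p v)" for p
  proof (induction p)
    case 0
    then show ?case using V_scale[OF v(1), of 0] by (simp add: E_0)
  next
    case (pCons a p)
    then show ?case by (simp add: E_pCons V_add V_scale V_T v(1))
  qed
  have "\<exists>c w. V w \<and> w \<noteq> (\<lambda>i. 0) \<and> T w = (\<lambda>i. \<iota> c * w i)" if "p \<noteq> 0" "?E p v = (\<lambda>i. 0)" for p
    using that
  proof (induction "degree p" arbitrary: p rule: less_induct)
    case less
    have "degree p > 0"
    proof (rule ccontr)
      assume "\<not> ?thesis"
      then obtain c where c: "p = [:c:]" using degree_eq_zeroE by blast
      then have "c \<noteq> 0" using less.prems by simp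
      have "\<iota> c * v i = 0" for i
        using less.prems(2) c by (simp add: E_pCons E_0 T0 fun_eq_iff)
      then have "\<iota> (inverse c) * (\<iota> c * v i) = 0" for i by simp
      then have "v i = 0" for i
        using \<open>c \<noteq> 0\<close> by (simp add: mult.assoc[symmetric] \<iota>.hom_mult[symmetric])
      then show False using v(2) by blast
    qed
    then obtain c where "poly p c = 0" using alg_closed_imp_poly_has_root by blast
    then obtain q where q: "p = [:- c, 1:] * q" using poly_eq_0_iff_dvd by blast
    have "q \<noteq> 0" using less.prems q by auto
    then have "degree p = Suc (degree q)" unfolding q by (subst degree_mult_eq) simp_all
    have p: "p = Polynomial.smult (- c) q + pCons 0 q" using q by simp
    have "?E p v = (\<lambda>i. \<iota> (- c) * ?E q v i + T (?E q v) i)"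
      unfolding p by (simp only: E_add E_smult E_pCons) simp
    then have eig: "T (?E q v) = (\<lambda>i. \<iota> c * ?E q v i)"
      using less.prems(2) by (simp add: fun_eq_iff \<iota>.hom_uminus)
    show ?case
    proof (cases "?E q v = (\<lambda>i. 0)")
      case True
      then show ?thesis using less.hyps[of q] \<open>q \<noteq> 0\<close> \<open>degree p = Suc (degree q)\<close> by simp
    next
      case False
      then show ?thesis using eig VE by blast
    qed
  qed
  note claim = this
  have "?E (monom 1 N + [:- 1:]) v = (\<lambda>i. 0)"
    by (simp only: E_add E_monom) (simp add: E_pCons E_0 T0 v(3) \<iota>.hom_uminus)
  moreover have "monom 1 N + [:- 1:] \<noteq> (0 :: 'k poly)"
  proof -
    have "coeff (monom 1 N + [:- 1:] :: 'k poly) N = 1"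
      using v(4) by (simp add: coeff_pCons split: nat.splits)
    then show ?thesis by (metis coeff_0 zero_neq_one)
  qed
  ultimately show thesis using claim that by blast
qed

text \<open>Write M = x^j N with \<open>j\<close> the least exponent that occurs. Then det N = 0,
  and N at x = 0 is the lowest coefficient matrix of \<open>M\<close>.\<close>

lemma lowest_coeff_matrix_singular:
  fixes M :: "'a::idom poly mat"
  assumes M: "M \<in> carrier_mat k k" "M \<noteq> 0\<^sub>m k k" and det: "det M = 0"
  obtains j where "map_mat (\<lambda>p. coeff p j) M \<noteq> 0\<^sub>m k k" "det (map_mat (\<lambda>p. coeff p j) M) = 0"
proof -
  have "\<exists>j. map_mat (\<lambda>p. coeff p j) M \<noteq> 0\<^sub>m k k"
  proof (rule ccontr)
    assume "\<not> ?thesis"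
    then have *: "map_mat (\<lambda>p. coeff p j) M = 0\<^sub>m k k" for j by blast
    have "M = 0\<^sub>m k k"
    proof (rule eq_matI)
      fix a b assume ab: "a < dim_row (0\<^sub>m k k :: 'a poly mat)" "b < dim_col (0\<^sub>m k k :: 'a poly mat)"
      have "coeff (M $$ (a, b)) j = 0" for j
        using arg_cong[OF *[of j], of "\<lambda>N. N $$ (a, b)"] ab M(1) by simp
      then show "M $$ (a, b) = 0\<^sub>m k k $$ (a, b)" using ab by (simp add: poly_eq_iff)
    qed (use M(1) in auto)
    with M(2) show False ..
  qed
  from exists_least_iff[THEN iffD1, OF this]
  obtain j where j: "map_mat (\<lambda>p. coeff p j) M \<noteq> 0\<^sub>m k k"
    and least: "\<And>i. i < j \<Longrightarrow> map_mat (\<lambda>p. coeff p i) M = 0\<^sub>m k k" by auto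
  have "\<exists>q. M $$ (a, b) = monom 1 j * q" if "a < k" "b < k" for a b
  proof -
    have "coeff (M $$ (a, b)) i = 0" if "i < j" for i
      using arg_cong[OF least[OF that], of "\<lambda>N. N $$ (a, b)"] \<open>a < k\<close> \<open>b < k\<close> M(1) by simp
    then have "monom 1 j dvd M $$ (a, b)" by (simp add: monom_1_dvd_iff')
    then show ?thesis by (rule dvdE) blast
  qed
  then obtain q where q: "\<And>a b. a < k \<Longrightarrow> b < k \<Longrightarrow> M $$ (a, b) = monom 1 j * q a b" by metis
  define N where "N = mat k k (\<lambda>(a, b). q a b)"
  have N: "N \<in> carrier_mat k k" by (simp add: N_def)
  have MN: "M = monom 1 j \<cdot>\<^sub>m N"
    by (rule eq_matI) (use M(1) in \<open>auto simp: N_def q\<close>)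
  have "det M = monom 1 j ^ k * det N" using N by (simp add: MN)
  then have "det N = 0" using det by simp
  have "comm_ring_hom (\<lambda>p :: 'a poly. poly p 0)" by unfold_locales simp_all
  from comm_ring_hom.hom_det[OF this, of N]
  have "det (map_mat (\<lambda>p. poly p 0) N) = 0" using \<open>det N = 0\<close> by simp
  moreover have "map_mat (\<lambda>p. poly p 0) N = map_mat (\<lambda>p. coeff p j) M"
    by (rule eq_matI) (use N in \<open>auto simp: MN coeff_monom_mult poly_0_coeff_0\<close>)
  ultimately show thesis using that j by simp
qed

text \<open>Multiplying x - F and x - G by \<open>A\<close> and cancelling det A avoids the inverse
  of \<open>A\<close>, which need not have entries in the domain.\<close>

lemma char_poly_eq_of_intertwining:
  fixes F G A :: "'a::idom mat"
  assumes F: "F \<in> carrier_mat k k" and G: "G \<in> carrier_mat k k" and A: "A \<in> carrier_mat k k"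
    and eq: "F * A = A * G" and det: "det A \<noteq> 0"
  shows "char_poly F = char_poly G"
proof -
  let ?c = "\<lambda>a :: 'a. [:a:]"
  interpret c: comm_ring_hom ?c by unfold_locales simp_all
  let ?A = "map_mat ?c A"
  have cA: "?A \<in> carrier_mat k k" using A by simp
  have "char_poly_matrix F * ?A = ?A * char_poly_matrix G"
  proof (rule eq_matI)
    fix a b assume "a < dim_row (?A * char_poly_matrix G)" "b < dim_col (?A * char_poly_matrix G)"
    then have ab: "a < k" "b < k" using A G by (auto simp: char_poly_matrix_def)
    have "(F * A) $$ (a, b) = (A * G) $$ (a, b)" using eq by simp
    then have e: "(\<Sum>i<k. F $$ (a, i) * A $$ (i, b)) = (\<Sum>i<k. A $$ (a, i) * G $$ (i, b))"
      using ab F G A by (simp add: scalar_prod_def atLeast0LessThan)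
    have "(char_poly_matrix F * ?A) $$ (a, b) =
        (\<Sum>i<k. (if a = i then [:0, 1:] * [:A $$ (i, b):] else 0) - [:F $$ (a, i) * A $$ (i, b):])"
      using ab F A by (auto simp: char_poly_matrix_def scalar_prod_def atLeast0LessThan intro!: sum.cong)
    also have "\<dots> = [:0, 1:] * [:A $$ (a, b):] - [:\<Sum>i<k. F $$ (a, i) * A $$ (i, b):]"
      using ab by (simp add: sum_subtractf c.hom_sum)
    also have "\<dots> = (\<Sum>i<k. (if i = b then [:0, 1:] * [:A $$ (a, i):] else 0) - [:A $$ (a, i) * G $$ (i, b):])"
      using ab by (simp add: sum_subtractf c.hom_sum e)
    also have "\<dots> = (?A * char_poly_matrix G) $$ (a, b)"
      using ab G A by (auto simp: char_poly_matrix_def scalar_prod_def atLeast0LessThan intro!: sum.cong)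
    finally show "(char_poly_matrix F * ?A) $$ (a, b) = (?A * char_poly_matrix G) $$ (a, b)" .
  qed (use A F G in \<open>auto simp: char_poly_matrix_def\<close>)
  then have "det (char_poly_matrix F) * det ?A = det ?A * det (char_poly_matrix G)"
    using det_mult[of "char_poly_matrix F" k ?A] det_mult[of ?A k "char_poly_matrix G"] F G cA
    by simp
  moreover have "det ?A \<noteq> 0" using det by (simp add: c.hom_det)
  ultimately show ?thesis unfolding char_poly_def by (metis mult.commute mult_left_cancel)
qed

section \<open>Polynomials in an inner and an outer variable, and the rescaling of each\<close>

lemma poly2_eqI: "(\<And>i j. coeff (coeff p j) i = coeff (coeff q j) i) \<Longrightarrow> p = q"
  by (intro poly_eqI)

definition const2 :: "'k::field \<Rightarrow> 'k poly poly" where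
  "const2 c = [:[:c:]:]"

definition scale_inner :: "'k::field \<Rightarrow> 'k poly poly \<Rightarrow> 'k poly poly" where
  "scale_inner c = map_poly (\<lambda>p. pcompose p [:0, c:])"

definition scale_outer :: "'k::field \<Rightarrow> 'k poly poly \<Rightarrow> 'k poly poly" where
  "scale_outer c p = pcompose p [:0, [:c:]:]"

lemma comm_ring_hom_const2: "comm_ring_hom const2"
  by unfold_locales (simp_all add: const2_def one_pCons)

interpretation const2: comm_ring_hom const2
  by (rule comm_ring_hom_const2)

interpretation pcompose: comm_ring_hom "\<lambda>p. pcompose p q" for q :: "'a::comm_ring_1 poly"
  by unfold_locales (simp_all add: pcompose_add pcompose_mult pcompose_1)

interpretation pcompose_poly: map_poly_comm_ring_hom "\<lambda>p. pcompose p q" for q :: "'a::comm_ring_1 poly" ..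

lemma scale_inner_hom: "comm_ring_hom (scale_inner c)"
  unfolding scale_inner_def by (rule pcompose_poly.comm_ring_hom_axioms)

lemma scale_outer_hom: "comm_ring_hom (scale_outer c)"
  by unfold_locales (simp_all add: scale_outer_def pcompose_add pcompose_mult pcompose_1)

interpretation scale_inner: comm_ring_hom "scale_inner c" by (rule scale_inner_hom)
interpretation scale_outer: comm_ring_hom "scale_outer c" by (rule scale_outer_hom)

lemma coeff_const2_mult [simp]: "coeff (coeff (const2 c * p) j) i = c * coeff (coeff p j) i"
  by (simp add: const2_def)

lemma coeff_scale_inner [simp]: "coeff (coeff (scale_inner c p) j) i = c ^ i * coeff (coeff p j) i"
  by (simp add: scale_inner_def coeff_map_poly coeff_pcompose_linear)

lemma coeff_scale_outer [simp]: "coeff (coeff (scale_outer c p) j) i = c ^ j * coeff (coeff p j) i"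
proof -
  have "coeff (scale_outer c p) j = [:c:] ^ j * coeff p j"
    by (simp add: scale_outer_def coeff_pcompose_linear)
  also have "[:c:] ^ j = [:c ^ j:]" by (rule poly_const_pow)
  finally show ?thesis by simp
qed

lemma scale_inner_const2: "scale_inner c (const2 d * p) = const2 d * scale_inner c p"
  and scale_outer_const2: "scale_outer c (const2 d * p) = const2 d * scale_outer c p"
  and scale_inner_outer: "scale_inner c (scale_outer d p) = scale_outer d (scale_inner c p)"
  by (rule poly2_eqI; simp add: mult.left_commute)+

lemma sum_mod_shift: "(\<Sum>c<k. f (Suc c mod k)) = (\<Sum>c<k. f c)" for k :: nat
proof (cases k)
  case (Suc n)
  have "(\<Sum>c<Suc n. f (Suc c mod Suc n)) = (\<Sum>c<n. f (Suc c)) + f 0"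
    by (simp add: lessThan_Suc add.commute)
  also have "\<dots> = (\<Sum>c<Suc n. f c)" by (simp only: sum.lessThan_Suc_shift add.commute)
  finally show ?thesis by (simp add: Suc)
qed simp

locale root_of_unity =
  fixes k :: nat and \<zeta> :: "'k::{alg_closed_field, field_char_0}"
  assumes k_pos: "k > 0" and \<zeta>: "\<And>n. \<zeta> ^ n = 1 \<longleftrightarrow> k dvd n"
begin

definition \<xi> where "\<xi> = inverse \<zeta>"

lemma \<zeta>_nonzero: "\<zeta> \<noteq> 0"
  using \<zeta>[of k] k_pos by (auto simp: power_0_left)

lemma \<zeta>_\<xi> [simp]: "\<zeta> * \<xi> = 1" "\<xi> * \<zeta> = 1" "\<zeta> ^ n * \<xi> ^ n = 1" "\<xi> ^ n * \<zeta> ^ n = 1" "\<zeta> ^ k = 1" "\<xi> ^ k = 1"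
  using \<zeta>_nonzero \<zeta>[of k] by (simp_all add: \<xi>_def power_inverse)

lemma power_mod [simp]: "\<zeta> ^ (n mod k) = \<zeta> ^ n" "\<xi> ^ (n mod k) = \<xi> ^ n"
proof -
  have *: "x ^ (n mod k) = x ^ n" if "x ^ k = 1" for x :: 'k
  proof -
    have "x ^ n = x ^ (k * (n div k) + n mod k)" by (simp only: mult_div_mod_eq)
    also have "\<dots> = x ^ (n mod k)" by (simp only: power_add power_mult that power_one mult_1_left)
    finally show ?thesis ..
  qed
  show "\<zeta> ^ (n mod k) = \<zeta> ^ n" "\<xi> ^ (n mod k) = \<xi> ^ n" by (simp_all add: *)
qed

lemma \<zeta>_power_eq_iff: "\<zeta> ^ m = \<zeta> ^ n \<longleftrightarrow> m mod k = n mod k"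
proof -
  have *: "\<zeta> ^ m = \<zeta> ^ n \<longleftrightarrow> m mod k = n mod k" if "m \<le> n" for m n
  proof -
    have "\<zeta> ^ n = \<zeta> ^ m * \<zeta> ^ (n - m)" using that by (simp add: power_add[symmetric])
    then have "\<zeta> ^ m = \<zeta> ^ n \<longleftrightarrow> \<zeta> ^ (n - m) = 1" using \<zeta>_nonzero by auto
    also have "\<dots> \<longleftrightarrow> m mod k = n mod k" using \<zeta> that by (metis mod_eq_dvd_iff_nat)
    finally show ?thesis .
  qed
  show ?thesis
    using *[of m n] *[of n m] by (cases "m \<le> n") auto
qed

abbreviation shift :: "nat \<Rightarrow> nat" where "shift a \<equiv> Suc a mod k"

text \<open>The elements of the cyclic algebra that is generated over the scalars by the clock matrix times
  the inner variable and the shift matrix times the outer variable.\<close>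

definition graded :: "'k poly poly mat \<Rightarrow> bool" where
  "graded F \<longleftrightarrow> F \<in> carrier_mat k k \<and> (\<forall>a<k. \<forall>b<k.
     scale_inner \<zeta> (F $$ (shift a, shift b)) = F $$ (a, b) \<and>
     const2 (\<zeta> ^ a * \<xi> ^ b) * scale_outer \<zeta> (F $$ (a, b)) = F $$ (a, b))"

lemma gradedD:
  assumes "graded F"
  shows "F \<in> carrier_mat k k"
    and "a < k \<Longrightarrow> b < k \<Longrightarrow> scale_inner \<zeta> (F $$ (shift a, shift b)) = F $$ (a, b)"
    and "a < k \<Longrightarrow> b < k \<Longrightarrow> const2 (\<zeta> ^ a * \<xi> ^ b) * scale_outer \<zeta> (F $$ (a, b)) = F $$ (a, b)"
  using assms by (simp_all add: graded_def)

lemma shift_less [simp]: "shift a < k"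
  using k_pos by simp

lemma graded_scalar: "graded (const2 c \<cdot>\<^sub>m 1\<^sub>m k)"
proof -
  have "shift a = shift b \<longleftrightarrow> a = b" if "a < k" "b < k" for a b
    using that by (auto simp: mod_Suc split: if_splits)
  then show ?thesis
    by (auto simp: graded_def scale_inner_const2[of _ _ 1, simplified] scale_outer_const2[of _ _ 1, simplified]
        intro!: poly2_eqI)
qed

lemma graded_add:
  assumes F: "graded F" and G: "graded G"
  shows "graded (F + G)"
  using gradedD[OF F] gradedD[OF G]
  by (auto simp: graded_def scale_inner.hom_add scale_outer.hom_add distrib_left)

text \<open>Each of the two conditions says that the matrix is fixed by a ring automorphism: the
  cyclic shift of both indices combined with scaling the inner variable by \<zeta>, and conjugation
  by the diagonal matrix of the powers of \<zeta> combined with scaling the outer variable. Fixed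
  points are closed under products.\<close>

lemma graded_mult:
  assumes F: "graded F" and G: "graded G"
  shows "graded (F * G)"
proof -
  have FG: "F \<in> carrier_mat k k" "G \<in> carrier_mat k k" using gradedD F G by auto
  have entry: "(F * G) $$ (a, b) = (\<Sum>c<k. F $$ (a, c) * G $$ (c, b))" if "a < k" "b < k" for a b
    using FG that by (simp add: scalar_prod_def atLeast0LessThan)
  show ?thesis
    unfolding graded_def
  proof (intro conjI allI impI)
    fix a b assume ab: "a < k" "b < k"
    have "(F * G) $$ (shift a, shift b) = (\<Sum>c<k. F $$ (shift a, shift c) * G $$ (shift c, shift b))"
      unfolding entry[OF shift_less shift_less] sum_mod_shift[of "\<lambda>c. F $$ (shift a, c) * G $$ (c, shift b)"] ..
    then show "scale_inner \<zeta> ((F * G) $$ (shift a, shift b)) = (F * G) $$ (a, b)"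
      using ab by (simp add: entry scale_inner.hom_sum scale_inner.hom_mult gradedD(2)[OF F] gradedD(2)[OF G])
    have "const2 (\<zeta> ^ a * \<xi> ^ b) * scale_outer \<zeta> ((F * G) $$ (a, b)) =
        (\<Sum>c<k. const2 (\<zeta> ^ a * \<xi> ^ b) * (scale_outer \<zeta> (F $$ (a, c)) * scale_outer \<zeta> (G $$ (c, b))))"
      using ab by (simp add: entry scale_outer.hom_sum scale_outer.hom_mult sum_distrib_left)
    also have "\<dots> = (\<Sum>c<k. F $$ (a, c) * G $$ (c, b))"
    proof (intro sum.cong refl)
      fix c assume "c \<in> {..<k}"
      then have c: "c < k" by simp
      have "\<zeta> ^ a * \<xi> ^ b = (\<zeta> ^ a * \<xi> ^ c) * (\<zeta> ^ c * \<xi> ^ b)"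
        by (simp add: mult.assoc)
      then have "const2 (\<zeta> ^ a * \<xi> ^ b) * (scale_outer \<zeta> (F $$ (a, c)) * scale_outer \<zeta> (G $$ (c, b))) =
          (const2 (\<zeta> ^ a * \<xi> ^ c) * scale_outer \<zeta> (F $$ (a, c))) *
          (const2 (\<zeta> ^ c * \<xi> ^ b) * scale_outer \<zeta> (G $$ (c, b)))"
        by (simp only: const2.hom_mult mult_ac)
      then show "const2 (\<zeta> ^ a * \<xi> ^ b) * (scale_outer \<zeta> (F $$ (a, c)) * scale_outer \<zeta> (G $$ (c, b))) =
          F $$ (a, c) * G $$ (c, b)"
        unfolding gradedD(3)[OF F ab(1) c] gradedD(3)[OF G c ab(2)] .
    qed
    finally show "const2 (\<zeta> ^ a * \<xi> ^ b) * scale_outer \<zeta> ((F * G) $$ (a, b)) = (F * G) $$ (a, b)"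
      using ab by (simp add: entry)
  qed (use FG in auto)
qed

lemma graded_evm:
  assumes "\<And>j. graded (X j)"
  shows "graded (evm const2 k f X)"
proof -
  have X: "X \<in> matrix_tuples k" using gradedD(1)[OF assms] by (simp add: matrix_tuples_def)
  show ?thesis
  proof (induction f rule: free_algebra_induct)
    case (scalar c)
    then show ?case by (simp add: evm_scalar[OF comm_ring_hom_const2 X] graded_scalar)
  next
    case (add f g)
    then show ?case by (simp add: evm_add[OF comm_ring_hom_const2 X] graded_add)
  next
    case (Var f j)
    then show ?case by (simp add: evm_mult_Var[OF comm_ring_hom_const2 X] graded_mult assms)
  qed
qed

text \<open>On the cyclic diagonal b - a = e mod k, graded matrices may have the entries
  \<open>P_e(\<xi>^a s) t^e\<close>, with s the inner and t the outer variable. At s = t = 1 this is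
  \<open>P_e(\<xi>^a)\<close>, and interpolation at the distinct powers of \<xi> prescribes these
  values.\<close>

lemma graded_deformation:
  assumes M: "M \<in> carrier_mat k k"
  obtains N where "graded N" "map_mat (\<lambda>p. poly (poly p 1) 1) N = M"
proof -
  have inj: "inj_on (\<lambda>a. \<xi> ^ a) {..<k}"
  proof (rule inj_onI)
    fix a b assume ab: "a \<in> {..<k}" "b \<in> {..<k}" "\<xi> ^ a = \<xi> ^ b"
    then have "\<zeta> ^ a = \<zeta> ^ b" by (simp add: \<xi>_def power_inverse)
    then show "a = b" using ab \<zeta>_power_eq_iff by simp
  qed
  have "\<exists>p. \<forall>a<k. poly p (\<xi> ^ a) = M $$ (a, (a + d) mod k)" for d
    by (rule interpolation[OF inj])
  then obtain P where P: "\<And>d a. a < k \<Longrightarrow> poly (P d) (\<xi> ^ a) = M $$ (a, (a + d) mod k)" by metis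
  \<comment> \<open>The residue of b - a modulo \<open>k\<close>; the summand \<open>k\<close> keeps
    the subtraction of natural numbers exact.\<close>
  define e where "e a b = (k + b - a) mod k" for a b
  define N where "N = mat k k (\<lambda>(a, b). monom (pcompose (P (e a b)) [:0, \<xi> ^ a:]) (e a b))"
  have e1: "(a + e a b) mod k = b" if "a < k" "b < k" for a b
    using that by (simp add: e_def mod_simps)
  have e2: "e (shift a) (shift b) = e a b" if "a < k" "b < k" for a b
  proof -
    have "e (shift a) (shift b) < k" "e a b < k" using k_pos by (simp_all add: e_def)
    moreover have "(shift a + e (shift a) (shift b)) mod k = (shift a + e a b) mod k"
    proof -
      have "(shift a + e a b) mod k = Suc ((a + e a b) mod k) mod k" by (simp add: mod_simps)
      then show ?thesis using that by (simp add: e1)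
    qed
    ultimately show ?thesis
      using \<zeta>_power_eq_iff[of "shift a + e (shift a) (shift b)" "shift a + e a b"]
        \<zeta>_power_eq_iff[of "e (shift a) (shift b)" "e a b"] \<zeta>_nonzero by (simp add: power_add)
  qed
  have coeff: "coeff (coeff (N $$ (a, b)) j) i = (if e a b = j then (\<xi> ^ a) ^ i * coeff (P (e a b)) i else 0)"
    if "a < k" "b < k" for a b i j
    using that by (simp add: N_def coeff_pcompose_linear)
  have "graded N"
    unfolding graded_def
  proof (intro conjI allI impI)
    fix a b assume ab: "a < k" "b < k"
    show "scale_inner \<zeta> (N $$ (shift a, shift b)) = N $$ (a, b)"
    proof (rule poly2_eqI)
      fix i j
      have "\<zeta> ^ i * ((\<xi> ^ shift a) ^ i) = (\<xi> ^ a) ^ i * (\<zeta> ^ i * \<xi> ^ i)"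
        by (simp only: power_mod) (simp add: power_mult_distrib mult_ac del: \<zeta>_\<xi>)
      then have "\<zeta> ^ i * ((\<xi> ^ shift a) ^ i * x) = (\<xi> ^ a) ^ i * x" for x
        by (simp add: mult.assoc[symmetric])
      then show "coeff (coeff (scale_inner \<zeta> (N $$ (shift a, shift b))) j) i = coeff (coeff (N $$ (a, b)) j) i"
        using ab e2[OF ab] by (simp add: coeff del: power_mod)
    qed
    show "const2 (\<zeta> ^ a * \<xi> ^ b) * scale_outer \<zeta> (N $$ (a, b)) = N $$ (a, b)"
    proof (rule poly2_eqI)
      fix i j
      have "\<zeta> ^ (a + e a b) = \<zeta> ^ b" using \<zeta>_power_eq_iff e1[OF ab] ab by simp
      moreover have "\<zeta> ^ a * \<xi> ^ b * \<zeta> ^ e a b = \<zeta> ^ (a + e a b) * \<xi> ^ b"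
        by (simp only: power_add mult_ac)
      ultimately have eq1: "\<zeta> ^ a * \<xi> ^ b * \<zeta> ^ e a b = 1" by simp
      show "coeff (coeff (const2 (\<zeta> ^ a * \<xi> ^ b) * scale_outer \<zeta> (N $$ (a, b))) j) i =
          coeff (coeff (N $$ (a, b)) j) i"
      proof (cases "e a b = j")
        case True
        have "coeff (coeff (const2 (\<zeta> ^ a * \<xi> ^ b) * scale_outer \<zeta> (N $$ (a, b))) j) i =
            (\<zeta> ^ a * \<xi> ^ b * \<zeta> ^ e a b) * coeff (coeff (N $$ (a, b)) j) i"
          by (simp only: coeff_const2_mult coeff_scale_outer mult.assoc True)
        then show ?thesis unfolding eq1 by simp
      qed (use ab in \<open>simp add: coeff\<close>)
    qed
  qed (simp add: N_def)
  moreover have "map_mat (\<lambda>p. poly (poly p 1) 1) N = M"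
    by (rule eq_matI) (use M P e1 in \<open>auto simp: N_def poly_monom poly_pcompose\<close>)
  ultimately show thesis by (rule that)
qed

text \<open>The automorphisms that fix \<open>F\<close> and \<open>G\<close> act on all matrices, as
  \<open>T1\<close> and \<open>T2\<close>, and preserve the solutions of F A = A G. They commute and
  have order \<open>k\<close> on solutions, so there is a joint eigenvector \<open>B\<close>. Its
  eigenvalues are the twist: \<open>B\<close> need not be graded, yet its lowest coefficient has the
  shape of that of a graded matrix and is nonsingular.\<close>

lemma graded_intertwiner:
  assumes F: "graded F" and G: "graded G"
    and A: "A \<in> carrier_mat k k" "A \<noteq> 0\<^sub>m k k" "F * A = A * G"
  obtains B where "B \<in> carrier_mat k k" "det B \<noteq> 0" "F * B = B * G"
proof -
  have FG: "F \<in> carrier_mat k k" "G \<in> carrier_mat k k" using gradedD F G by auto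
  define T1 where "T1 v = (\<lambda>(a, b). if a < k \<and> b < k then scale_inner \<zeta> (v (shift a, shift b)) else 0)"
    for v :: "nat \<times> nat \<Rightarrow> 'k poly poly"
  define T2 where "T2 v = (\<lambda>(a, b). const2 (\<zeta> ^ a * \<xi> ^ b) * scale_outer \<zeta> (v (a, b)))"
    for v :: "nat \<times> nat \<Rightarrow> 'k poly poly"
  define V where "V v \<longleftrightarrow> (\<forall>a b. \<not> (a < k \<and> b < k) \<longrightarrow> v (a, b) = 0) \<and>
      (\<forall>a<k. \<forall>b<k. (\<Sum>c<k. F $$ (a, c) * v (c, b)) = (\<Sum>c<k. v (a, c) * G $$ (c, b)))"
    for v :: "nat \<times> nat \<Rightarrow> 'k poly poly"
  define v where "v = (\<lambda>(a, b). if a < k \<and> b < k then A $$ (a, b) else 0)"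
  have Vv: "V v"
    unfolding V_def
  proof (intro conjI allI impI)
    fix a b assume ab: "a < k" "b < k"
    have "(F * A) $$ (a, b) = (A * G) $$ (a, b)" using A(3) by simp
    then show "(\<Sum>c<k. F $$ (a, c) * v (c, b)) = (\<Sum>c<k. v (a, c) * G $$ (c, b))"
      using ab FG A(1) by (simp add: scalar_prod_def atLeast0LessThan v_def)
  qed (auto simp: v_def)
  have v0: "v \<noteq> (\<lambda>i. 0)"
  proof
    assume "v = (\<lambda>i. 0)"
    then have "A $$ (a, b) = 0" if "a < k" "b < k" for a b
      using that by (auto simp: v_def fun_eq_iff split: if_splits)
    then have "A = 0\<^sub>m k k" using A(1) by auto
    with A(2) show False ..
  qed
  have V_add: "V (\<lambda>i. v i + w i)" if "V v" "V w" for v w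
    using that by (simp add: V_def distrib_left distrib_right sum.distrib)
  have V_scale: "V (\<lambda>i. const2 c * v i)" if "V v" for c v
    using that unfolding V_def by (simp add: mult.left_commute mult.assoc sum_distrib_left[symmetric])
  have V_T1: "V (T1 v)" if v: "V v" for v
    unfolding V_def
  proof (intro conjI allI impI)
    fix a b assume ab: "a < k" "b < k"
    have "(\<Sum>c<k. F $$ (a, c) * T1 v (c, b)) = scale_inner \<zeta> (\<Sum>c<k. F $$ (shift a, shift c) * v (shift c, shift b))"
      using ab by (simp add: T1_def scale_inner.hom_sum scale_inner.hom_mult gradedD(2)[OF F])
    also have "(\<Sum>c<k. F $$ (shift a, shift c) * v (shift c, shift b)) = (\<Sum>c<k. v (shift a, c) * G $$ (c, shift b))"
      using v unfolding V_def sum_mod_shift[of "\<lambda>c. F $$ (shift a, c) * v (c, shift b)"] by simp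
    also have "\<dots> = (\<Sum>c<k. v (shift a, shift c) * G $$ (shift c, shift b))"
      unfolding sum_mod_shift[of "\<lambda>c. v (shift a, c) * G $$ (c, shift b)"] ..
    also have "scale_inner \<zeta> \<dots> = (\<Sum>c<k. T1 v (a, c) * G $$ (c, b))"
      using ab by (simp add: T1_def scale_inner.hom_sum scale_inner.hom_mult gradedD(2)[OF G])
    finally show "(\<Sum>c<k. F $$ (a, c) * T1 v (c, b)) = (\<Sum>c<k. T1 v (a, c) * G $$ (c, b))" .
  qed (auto simp: T1_def)
  have cancel: "const2 (\<zeta> ^ a * \<xi> ^ c) * x * (const2 (\<zeta> ^ c * \<xi> ^ b) * y) =
      const2 (\<zeta> ^ a * \<xi> ^ b) * (x * y)" for a b c x y
  proof -
    have "\<zeta> ^ a * \<xi> ^ b = (\<zeta> ^ a * \<xi> ^ c) * (\<zeta> ^ c * \<xi> ^ b)"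
      by (simp add: mult.assoc)
    then show ?thesis by (simp only: const2.hom_mult mult_ac)
  qed
  have V_T2: "V (T2 v)" if v: "V v" for v
    unfolding V_def
  proof (intro conjI allI impI)
    fix a b assume ab: "a < k" "b < k"
    have "(\<Sum>c<k. F $$ (a, c) * T2 v (c, b)) =
        (\<Sum>c<k. (const2 (\<zeta> ^ a * \<xi> ^ c) * scale_outer \<zeta> (F $$ (a, c))) * (const2 (\<zeta> ^ c * \<xi> ^ b) * scale_outer \<zeta> (v (c, b))))"
      using ab by (simp add: T2_def gradedD(3)[OF F])
    also have "\<dots> = const2 (\<zeta> ^ a * \<xi> ^ b) * scale_outer \<zeta> (\<Sum>c<k. F $$ (a, c) * v (c, b))"
      unfolding cancel by (simp add: scale_outer.hom_sum scale_outer.hom_mult sum_distrib_left)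
    also have "(\<Sum>c<k. F $$ (a, c) * v (c, b)) = (\<Sum>c<k. v (a, c) * G $$ (c, b))"
      using v ab by (simp add: V_def)
    also have "const2 (\<zeta> ^ a * \<xi> ^ b) * scale_outer \<zeta> \<dots> =
        (\<Sum>c<k. (const2 (\<zeta> ^ a * \<xi> ^ c) * scale_outer \<zeta> (v (a, c))) * (const2 (\<zeta> ^ c * \<xi> ^ b) * scale_outer \<zeta> (G $$ (c, b))))"
      unfolding cancel by (simp add: scale_outer.hom_sum scale_outer.hom_mult sum_distrib_left)
    also have "\<dots> = (\<Sum>c<k. T2 v (a, c) * G $$ (c, b))"
      using ab by (simp add: T2_def gradedD(3)[OF G])
    finally show "(\<Sum>c<k. F $$ (a, c) * T2 v (c, b)) = (\<Sum>c<k. T2 v (a, c) * G $$ (c, b))" .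
  qed (use v in \<open>auto simp: T2_def V_def\<close>)
  have T1_add: "T1 (\<lambda>i. v i + w i) = (\<lambda>i. T1 v i + T1 w i)" for v w
    by (auto simp: T1_def fun_eq_iff scale_inner.hom_add)
  have T1_scale: "T1 (\<lambda>i. const2 c * v i) = (\<lambda>i. const2 c * T1 v i)" for c v
    by (auto simp: T1_def fun_eq_iff scale_inner_const2)
  have T2_add: "T2 (\<lambda>i. v i + w i) = (\<lambda>i. T2 v i + T2 w i)" for v w
    by (auto simp: T2_def fun_eq_iff scale_outer.hom_add distrib_left)
  have T2_scale: "T2 (\<lambda>i. const2 c * v i) = (\<lambda>i. const2 c * T2 v i)" for c v
    by (auto simp: T2_def fun_eq_iff scale_outer_const2 mult_ac)
  have T1_pow: "(T1 ^^ l) v (a, b) = (scale_inner \<zeta> ^^ l) (v ((a + l) mod k, (b + l) mod k))"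
    if "V v" "a < k" "b < k" for v l a b
    using that(2,3)
  proof (induction l arbitrary: a b)
    case (Suc l)
    then have "(T1 ^^ Suc l) v (a, b) = scale_inner \<zeta> ((T1 ^^ l) v (shift a, shift b))"
      by (simp add: T1_def)
    also have "\<dots> = scale_inner \<zeta> ((scale_inner \<zeta> ^^ l) (v ((shift a + l) mod k, (shift b + l) mod k)))"
      using Suc.IH[of "shift a" "shift b"] by simp
    finally show ?case by (simp add: mod_simps)
  qed simp
  have V_pow: "V ((T1 ^^ l) v)" if "V v" for v l
    using that by (induction l) (simp_all add: V_T1)
  have inner_pow: "coeff (coeff ((scale_inner \<zeta> ^^ l) p) j) i = (\<zeta> ^ l) ^ i * coeff (coeff p j) i" for l p i j
    by (induction l) (simp_all add: power_mult_distrib mult.assoc)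
  \<comment> \<open>Membership in \<open>V\<close> matters here because \<open>T1\<close> erases
    whatever lies outside the index range.\<close>
  have T1_order: "(T1 ^^ k) v = v" if v: "V v" for v
  proof (rule ext)
    fix ab :: "nat \<times> nat" obtain a b where ab: "ab = (a, b)" by (cases ab)
    show "(T1 ^^ k) v ab = v ab"
    proof (cases "a < k \<and> b < k")
      case True
      then have "(T1 ^^ k) v ab = (scale_inner \<zeta> ^^ k) (v (a, b))"
        using T1_pow[OF v, of a b k] by (simp add: ab)
      also have "\<dots> = v ab" unfolding ab by (rule poly2_eqI) (simp add: inner_pow)
      finally show ?thesis .
    next
      case False
      then show ?thesis using v V_pow[OF v, of k] by (auto simp: ab V_def)
    qed
  qed
  obtain c1 v1 where v1: "V v1" "v1 \<noteq> (\<lambda>i. 0)" "T1 v1 = (\<lambda>i. const2 c1 * v1 i)"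
    by (rule eigenvector_of_finite_order[OF comm_ring_hom_const2 T1_add T1_scale V_add V_scale V_T1 Vv v0
          T1_order[OF Vv] k_pos])
  \<comment> \<open>The eigenspace of \<open>T1\<close> inside the solutions; it is stable under
    \<open>T2\<close> since the operators commute.\<close>
  define V' where "V' v \<longleftrightarrow> V v \<and> T1 v = (\<lambda>i. const2 c1 * v i)" for v
  have V'_add: "V' (\<lambda>i. v i + w i)" if "V' v" "V' w" for v w
    using that by (simp add: V'_def V_add T1_add distrib_left)
  have V'_scale: "V' (\<lambda>i. const2 c * v i)" if "V' v" for c v
    using that by (simp add: V'_def V_scale T1_scale mult_ac)
  have "\<zeta> * \<zeta> ^ a * (\<xi> * \<xi> ^ b) = (\<zeta> * \<xi>) * (\<zeta> ^ a * \<xi> ^ b)" for a b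
    by (simp only: mult_ac)
  then have cancel1: "\<zeta> * \<zeta> ^ a * (\<xi> * \<xi> ^ b) = \<zeta> ^ a * \<xi> ^ b" for a b
    by simp
  have comm: "T1 (T2 v) = T2 (T1 v)" for v
    by (simp add: T1_def T2_def fun_eq_iff scale_inner_const2 scale_inner_outer cancel1)
  have V'_T2: "V' (T2 v)" if "V' v" for v
    using that by (simp add: V'_def V_T2 comm T2_scale)
  have T2_pow: "coeff (coeff ((T2 ^^ l) v (a, b)) j) i = (\<zeta> ^ a * \<xi> ^ b * \<zeta> ^ j) ^ l * coeff (coeff (v (a, b)) j) i"
    for l v a b i j
    by (induction l) (simp_all add: T2_def mult_ac)
  have T2_order: "(T2 ^^ k) v = v" for v
  proof (rule ext)
    fix ab :: "nat \<times> nat" obtain a b where ab: "ab = (a, b)" by (cases ab)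
    have "(\<zeta> ^ a * \<xi> ^ b * \<zeta> ^ j) ^ k = 1" for j
    proof -
      have "(\<zeta> ^ a * \<xi> ^ b * \<zeta> ^ j) ^ k = (\<zeta> ^ k) ^ a * (\<xi> ^ k) ^ b * (\<zeta> ^ k) ^ j"
        by (simp only: power_mult_distrib power_mult[symmetric] mult.commute)
      then show ?thesis by simp
    qed
    then show "(T2 ^^ k) v ab = v ab" unfolding ab by (intro poly2_eqI) (simp add: T2_pow)
  qed
  have "V' v1" using v1 by (simp add: V'_def)
  obtain c2 w where w: "V' w" "w \<noteq> (\<lambda>i. 0)" "T2 w = (\<lambda>i. const2 c2 * w i)"
    by (rule eigenvector_of_finite_order[OF comm_ring_hom_const2 T2_add T2_scale V'_add V'_scale V'_T2
          \<open>V' v1\<close> v1(2) T2_order k_pos])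
  define B where "B = mat k k w"
  have B: "B \<in> carrier_mat k k" by (simp add: B_def)
  have wV: "V w" and w1: "T1 w = (\<lambda>i. const2 c1 * w i)" using w(1) by (simp_all add: V'_def)
  have "F * B = B * G"
  proof (rule eq_matI)
    fix a b assume "a < dim_row (B * G)" "b < dim_col (B * G)"
    then have "a < k" "b < k" using B FG by auto
    then show "(F * B) $$ (a, b) = (B * G) $$ (a, b)"
      using wV FG by (simp add: B_def scalar_prod_def atLeast0LessThan V_def)
  qed (use B FG in auto)
  moreover have "det B \<noteq> 0"
  proof
    assume "det B = 0"
    moreover have "B \<noteq> 0\<^sub>m k k"
    proof
      assume B0: "B = 0\<^sub>m k k"
      have "w (a, b) = 0" for a b
      proof (cases "a < k \<and> b < k")
        case True
        then show ?thesis using arg_cong[OF B0, of "\<lambda>M. M $$ (a, b)"] by (simp add: B_def)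
      qed (use wV in \<open>auto simp: V_def\<close>)
      then show False using w(2) by auto
    qed
    ultimately obtain j where j: "map_mat (\<lambda>p. coeff p j) B \<noteq> 0\<^sub>m k k" "det (map_mat (\<lambda>p. coeff p j) B) = 0"
      using lowest_coeff_matrix_singular[OF B] by blast
    have Bj: "map_mat (\<lambda>p. coeff p j) B \<in> carrier_mat k k" using B by simp
    obtain i where i: "map_mat (\<lambda>p. coeff p i) (map_mat (\<lambda>p. coeff p j) B) \<noteq> 0\<^sub>m k k"
      "det (map_mat (\<lambda>p. coeff p i) (map_mat (\<lambda>p. coeff p j) B)) = 0"
      using lowest_coeff_matrix_singular[OF Bj j] by blast
    \<comment> \<open>The lowest coefficient of \<open>B\<close> in both variables. The
      \<open>T1\<close> eigenvalue spreads a nonzero entry along its whole cyclic diagonal, and the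
      \<open>T2\<close> eigenvalue allows at most one nonzero entry in each row, so this is a
      monomial matrix and cannot be singular.\<close>
    define C where "C a b = coeff (coeff (w (a, b)) j) i" for a b
    define M where "M = mat k k (\<lambda>(a, b). C a b)"
    have M: "M \<in> carrier_mat k k" by (simp add: M_def)
    have "map_mat (\<lambda>p. coeff p i) (map_mat (\<lambda>p. coeff p j) B) = M"
      by (rule eq_matI) (auto simp: B_def M_def C_def)
    then have M0: "M \<noteq> 0\<^sub>m k k" "det M = 0" using i by simp_all
    have C1: "\<zeta> ^ i * C (shift a) (shift b) = c1 * C a b" if "a < k" "b < k" for a b
    proof -
      have "scale_inner \<zeta> (w (shift a, shift b)) = const2 c1 * w (a, b)"
        using fun_cong[OF w1, of "(a, b)"] that by (simp add: T1_def)
      then have "coeff (coeff (scale_inner \<zeta> (w (shift a, shift b))) j) i = coeff (coeff (const2 c1 * w (a, b)) j) i"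
        by simp
      then show ?thesis by (simp add: C_def)
    qed
    have C2: "\<zeta> ^ a * \<xi> ^ b * \<zeta> ^ j * C a b = c2 * C a b" for a b
    proof -
      have "coeff (coeff (T2 w (a, b)) j) i = coeff (coeff (const2 c2 * w (a, b)) j) i"
        using w(3) by simp
      then show ?thesis by (simp add: C_def T2_def mult.assoc)
    qed
    obtain a0 b0 where ab0: "a0 < k" "b0 < k" "C a0 b0 \<noteq> 0"
    proof -
      have "\<exists>a0 b0. a0 < k \<and> b0 < k \<and> C a0 b0 \<noteq> 0"
      proof (rule ccontr)
        assume "\<not> ?thesis"
        then have "M = 0\<^sub>m k k" by (intro eq_matI) (auto simp: M_def)
        with M0(1) show False ..
      qed
      then show thesis using that by blast
    qed
    have mod_shift: "Suc (a + l) mod k = shift ((a + l) mod k)" for a l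
      by (simp add: mod_simps)
    have "c1 \<noteq> 0"
    proof
      assume "c1 = 0"
      have "C (shift ((a0 + (k - 1)) mod k)) (shift ((b0 + (k - 1)) mod k)) = 0"
        using C1[of "(a0 + (k - 1)) mod k" "(b0 + (k - 1)) mod k"] k_pos \<open>c1 = 0\<close> \<zeta>_nonzero by simp
      moreover have "shift ((x + (k - 1)) mod k) = x" if "x < k" for x
        unfolding mod_shift[symmetric] using that k_pos by simp
      ultimately show False using ab0 by simp
    qed
    have nz: "C ((a0 + l) mod k) ((b0 + l) mod k) \<noteq> 0" for l
    proof (induction l)
      case 0
      then show ?case using ab0 by simp
    next
      case (Suc l)
      have "\<zeta> ^ i * C (shift ((a0 + l) mod k)) (shift ((b0 + l) mod k)) \<noteq> 0"
        using C1[of "(a0 + l) mod k" "(b0 + l) mod k"] Suc \<open>c1 \<noteq> 0\<close> k_pos by simp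
      then show ?case by (simp add: mod_shift)
    qed
    from M0(2) obtain u where u: "u \<in> carrier_vec k" "u \<noteq> 0\<^sub>v k" "M *\<^sub>v u = 0\<^sub>v k"
      using det_0_iff_vec_prod_zero[OF M] by blast
    have "u $ b = 0" if b: "b < k" for b
    proof -
      define l where "l = k + b - b0"
      have bl: "(b0 + l) mod k = b" using ab0(2) b by (simp add: l_def)
      define a where "a = (a0 + l) mod k"
      have a: "a < k" and nzab: "C a b \<noteq> 0" using nz[of l] bl k_pos by (simp_all add: a_def)
      have zero: "C a b' = 0" if b': "b' < k" "b' \<noteq> b" for b'
      proof (rule ccontr)
        assume "C a b' \<noteq> 0"
        then have "\<zeta> ^ a * \<xi> ^ b' * \<zeta> ^ j = \<zeta> ^ a * \<xi> ^ b * \<zeta> ^ j" using C2[of a b] C2[of a b'] nzab by simp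
        then have "\<xi> ^ b' = \<xi> ^ b" using \<zeta>_nonzero by simp
        then have "\<zeta> ^ b' = \<zeta> ^ b" by (simp add: \<xi>_def power_inverse)
        then show False using \<zeta>_power_eq_iff[of b' b] b b' by simp
      qed
      have "0 = (M *\<^sub>v u) $ a" using u(3) a by simp
      also have "\<dots> = (\<Sum>b'<k. C a b' * u $ b')"
        using a u(1) by (simp add: M_def scalar_prod_def atLeast0LessThan)
      also have "\<dots> = (\<Sum>b'\<in>{b}. C a b' * u $ b')"
        using b zero by (intro sum.mono_neutral_right) auto
      finally show ?thesis using nzab by simp
    qed
    then have "u = 0\<^sub>v k" using u(1) by auto
    with u(2) show False ..
  qed
  ultimately show thesis using that B by blast
qed

end

lemma poly2_eq_0I:
  fixes p :: "'k::field_char_0 poly poly"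
  assumes "\<And>x y. poly (poly p [:x:]) y = 0"
  shows "p = 0"
proof -
  have "poly p [:x:] = 0" for x
    using assms by (metis poly_all_0_iff_0)
  then have "infinite {c. poly p c = 0}"
  proof -
    have "range (\<lambda>x :: 'k. [:x:]) \<subseteq> {c. poly p c = 0}" using \<open>\<And>x. poly p [:x:] = 0\<close> by blast
    moreover have "infinite (range (\<lambda>x :: 'k. [:x:]))"
      using infinite_UNIV_char_0 by (subst finite_image_iff) (auto simp: inj_on_def)
    ultimately show ?thesis using finite_subset by blast
  qed
  then show ?thesis using poly_roots_finite by blast
qed

text \<open>Every specialization of the graded deformation is an ordinary tuple, so the Sylvester
  determinant vanishes at all points and hence identically. This gives a nonzero intertwiner over
  the polynomial ring, which is then replaced by one with nonzero determinant. That one may become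
  singular at (1, 1), but equality of characteristic polynomials specializes.\<close>

lemma shared_eigenvalues_imp_char_poly_eq:
  fixes f g :: "('n, 'k::{alg_closed_field, field_char_0}) free_algebra"
  assumes D: "zariski_dense k D"
    and ev: "\<And>X. X \<in> D \<Longrightarrow> \<exists>c. eigenvalue (eval_at k f X) c \<and> eigenvalue (eval_at k g X) c"
    and k: "k > 0" and X: "X \<in> matrix_tuples k"
  shows "char_poly (eval_at k f X) = char_poly (eval_at k g X)"
proof -
  obtain \<zeta> :: 'k where \<zeta>: "\<And>n. \<zeta> ^ n = 1 \<longleftrightarrow> k dvd n" using primitive_root_of_unity[OF k] by blast
  interpret root_of_unity k \<zeta> by unfold_locales (use k \<zeta> in auto)
  have "\<exists>N. graded N \<and> map_mat (\<lambda>p. poly (poly p 1) 1) N = X j" for j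
    using graded_deformation[OF matrix_tuplesD[OF X, of j]] by blast
  then obtain Y where Y: "\<And>j. graded (Y j)" "\<And>j. map_mat (\<lambda>p. poly (poly p 1) 1) (Y j) = X j"
    by metis
  have Ym: "Y \<in> matrix_tuples k" using gradedD(1)[OF Y(1)] by (simp add: matrix_tuples_def)
  define F G where "F = evm const2 k f Y" and "G = evm const2 k g Y"
  have FG: "graded F" "graded G" using graded_evm[OF Y(1)] by (simp_all add: F_def G_def)
  note cFG = gradedD(1)[OF FG(1)] gradedD(1)[OF FG(2)]
  have hom: "comm_ring_hom (\<lambda>p. poly (poly p [:x:]) y)" for x y :: 'k
    by unfold_locales simp_all
  have eval: "map_mat (\<lambda>p. poly (poly p [:x:]) y) (evm const2 k h Y) =
      eval_at k h (\<lambda>j. map_mat (\<lambda>p. poly (poly p [:x:]) y) (Y j))" for x y h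
    unfolding evm_hom[OF hom Ym] eval_at_eq_evm by (simp add: const2_def)
  have "det (sylvester k F G) = 0"
  proof (rule poly2_eq_0I)
    fix x y
    let ?e = "\<lambda>p :: 'k poly poly. poly (poly p [:x:]) y"
    let ?X = "\<lambda>j. map_mat ?e (Y j)"
    have X': "?X \<in> matrix_tuples k" using Ym by (simp add: matrix_tuples_def)
    have "map_mat ?e (sylvester k F G) = sylvester k (map_mat ?e F) (map_mat ?e G)"
    proof (rule eq_matI)
      fix p q assume "p < dim_row (sylvester k (map_mat ?e F) (map_mat ?e G))"
        "q < dim_col (sylvester k (map_mat ?e F) (map_mat ?e G))"
      then have pq: "p < k * k" "q < k * k" by (simp_all add: sylvester_def)
      then have "p div k < k" "q div k < k" "p mod k < k" "q mod k < k"
        using k by (simp_all add: less_mult_imp_div_less)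
      then show "map_mat ?e (sylvester k F G) $$ (p, q) = sylvester k (map_mat ?e F) (map_mat ?e G) $$ (p, q)"
        using pq cFG by (auto simp: sylvester_def)
    qed (simp_all add: sylvester_def)
    then have "?e (det (sylvester k F G)) = det (sylvester k (eval_at k f ?X) (eval_at k g ?X))"
      unfolding comm_ring_hom.hom_det[OF hom, symmetric] by (simp add: F_def G_def eval)
    also have "\<dots> = 0" by (rule sylvester_vanishes[OF D ev X'])
    finally show "?e (det (sylvester k F G)) = 0" .
  qed
  then obtain A where A: "A \<in> carrier_mat k k" "A \<noteq> 0\<^sub>m k k" "F * A = A * G"
    using det_sylvester_eq_0_iff[OF cFG] by blast
  obtain B where B: "B \<in> carrier_mat k k" "det B \<noteq> 0" "F * B = B * G"
    using graded_intertwiner[OF FG A] .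
  have "char_poly F = char_poly G"
    by (rule char_poly_eq_of_intertwining[OF cFG B(1,3,2)])
  then have "char_poly (map_mat (\<lambda>p. poly (poly p [:1:]) 1) F) = char_poly (map_mat (\<lambda>p. poly (poly p [:1:]) 1) G)"
    by (simp add: comm_ring_hom.char_poly_hom[OF hom cFG(1)] comm_ring_hom.char_poly_hom[OF hom cFG(2)])
  moreover have "(\<lambda>j. map_mat (\<lambda>p. poly (poly p [:1:]) 1) (Y j)) = X"
    using Y(2) by (simp add: one_pCons)
  ultimately show ?thesis by (simp add: F_def G_def eval)
qed

section \<open>Modules over the rational function field\<close>

text \<open>\<open>dq p j m\<close> is the coefficient of the variable \<open>j\<close> when \<open>m\<close> is divided by the variables on the
  right after its constant term has been eliminated by a multiple of \<open>p\<close>. It describes a unique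
  expansion of the classes modulo the right ideal generated by \<open>p\<close>.\<close>

definition dq :: "('n, 'k::field) free_algebra \<Rightarrow> 'n \<Rightarrow> ('n, 'k) free_algebra \<Rightarrow> ('n, 'k) free_algebra"
  where "dq p j m = rq j m - scalar (lookup m 0 / lookup p 0) * rq j p"

definition dqs :: "('n, 'k::field) free_algebra \<Rightarrow> 'n list \<Rightarrow> ('n, 'k) free_algebra \<Rightarrow> ('n, 'k) free_algebra"
  where "dqs p w m = foldr (dq p) w m"

lemma dqs_simps [simp]: "dqs p [] m = m" "dqs p (j # w) m = dq p j (dqs p w m)"
  by (simp_all add: dqs_def)

lemma dqs_append: "dqs p (u @ w) m = dqs p u (dqs p w m)"
  by (simp add: dqs_def)

lemma dq_add: "dq p j (a + b) = dq p j a + dq p j b"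
  by (simp add: dq_def rq_add lookup_add add_divide_distrib scalar_add distrib_right)

lemma dq_scalar_mult: "dq p j (scalar c * a) = scalar c * dq p j a"
  by (simp add: dq_def rq_scalar_mult right_diff_distrib scalar_mult[symmetric] mult.assoc[symmetric])

lemma dq_0 [simp]: "dq p j 0 = 0"
  by (simp add: dq_def)

lemma dqs_add: "dqs p w (a + b) = dqs p w a + dqs p w b"
  by (induction w) (simp_all add: dq_add)

lemma dqs_scalar_mult: "dqs p w (scalar c * a) = scalar c * dqs p w a"
  by (induction w) (simp_all add: dq_scalar_mult)

lemma dqs_0 [simp]: "dqs p w 0 = 0"
  by (induction w) simp_all

lemma dqs_sum: "dqs p w (sum f A) = (\<Sum>i\<in>A. dqs p w (f i))"
  by (induction A rule: infinite_finite_induct) (simp_all add: dqs_add)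

lemma dq_below:
  assumes "p \<in> below (Suc d)" "m \<in> below d"
  shows "dq p j m \<in> below d"
proof (cases d)
  case (Suc e)
  have "rq j m \<in> below e" using assms(2) by (simp add: Suc below_Suc_iff)
  moreover have "rq j p \<in> below d" using assms(1) by (simp add: below_Suc_iff)
  ultimately show ?thesis unfolding dq_def Suc
    by (intro below_diff below_scalar_mult) (auto intro: below_mono[of e])
qed (use assms in simp)

lemma dq_mult_Var [simp]: "dq p j (m * Var i) = (if i = j then m else 0)"
  by (simp add: dq_def)

lemma monomial_conv_Cons: "single (Word (j # w)) 1 = Var j * single (Word w) (1 :: 'k::field)"
  by (simp add: mult_single)

context
  fixes p :: "('n::finite, 'k::field) free_algebra"
  assumes p0: "lookup p 0 \<noteq> 0"
begin

text \<open>The correction in \<open>dq\<close> is chosen to cancel the second term of the product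
  rule for \<open>rq\<close>. Thus \<open>dq\<close> preserves p R and acts on the quotient.\<close>

lemma dq_mult: "dq p j (p * a) = p * rq j a"
  using p0 by (simp add: dq_def rq_mult lookup_mult_0)

lemma dqs_mult: "dqs p w (p * a) = p * rqs w a"
  by (induction w) (simp_all add: dq_mult)

text \<open>Subtract the scalar multiple of \<open>p\<close> that has the constant term of
  \<open>m\<close>; the right quotients of the difference are the \<open>dq p j m\<close>.\<close>

lemma dq_expansion:
  "m = (\<Sum>j\<in>UNIV. dq p j m * Var j) + p * scalar (lookup m 0 / lookup p 0)"
proof -
  let ?c = "lookup m 0 / lookup p 0"
  have "(\<Sum>j\<in>UNIV. dq p j m * Var j) =
      (\<Sum>j\<in>UNIV. rq j m * Var j) - scalar ?c * (\<Sum>j\<in>UNIV. rq j p * Var j)"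
    by (simp add: dq_def left_diff_distrib sum_subtractf sum_distrib_left mult.assoc)
  also have "(\<Sum>j\<in>UNIV. rq j m * Var j) = m - scalar (lookup m 0)"
    using rq_expansion[of m] by (simp add: eq_diff_eq add.commute)
  also have "(\<Sum>j\<in>UNIV. rq j p * Var j) = p - scalar (lookup p 0)"
    using rq_expansion[of p] by (simp add: eq_diff_eq add.commute)
  finally show ?thesis
    using p0 unfolding right_diff_distrib scalar_mult[symmetric] scalar_commute[of p] by simp
qed

lemma dqs_expansion:
  fixes m :: "('n, 'k) free_algebra"
  shows "\<exists>h. m = (\<Sum>w | length w = N. dqs p w m * single (Word w) 1) + p * h"
proof (induction N)
  case 0
  have "m = (\<Sum>w | length w = 0. dqs p w m * single (Word w) 1) + p * 0"
    by (simp add: zero_free_monoid_def[symmetric])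
  then show ?case by blast
next
  case (Suc N)
  then obtain h where h: "m = (\<Sum>w | length w = N. dqs p w m * single (Word w) 1) + p * h"
    by blast
  define c :: "'n list \<Rightarrow> ('n, 'k) free_algebra"
    where "c w = scalar (lookup (dqs p w m) 0 / lookup p 0)" for w
  have fin: "finite {w :: 'n list. length w = N}"
    using finite_lists_length_eq[of "UNIV :: 'n set" N] by simp
  have "(\<Sum>w | length w = N. dqs p w m * single (Word w) 1) =
      (\<Sum>w | length w = N. (\<Sum>j\<in>UNIV. dqs p (j # w) m * single (Word (j # w)) 1) +
        p * (c w * single (Word w) 1))"
  proof (intro sum.cong refl)
    fix w
    have "dqs p w m * single (Word w) 1 =
        ((\<Sum>j\<in>UNIV. dq p j (dqs p w m) * Var j) + p * c w) * single (Word w) 1"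
      using dq_expansion[of "dqs p w m"] by (simp add: c_def)
    then show "dqs p w m * single (Word w) 1 =
        (\<Sum>j\<in>UNIV. dqs p (j # w) m * single (Word (j # w)) 1) + p * (c w * single (Word w) 1)"
      unfolding monomial_conv_Cons[of _ w] by (simp add: distrib_right sum_distrib_right mult.assoc)
  qed
  also have "\<dots> = (\<Sum>w | length w = N. \<Sum>j\<in>UNIV. dqs p (j # w) m * single (Word (j # w)) 1) +
      p * (\<Sum>w | length w = N. c w * single (Word w) 1)"
    by (simp add: sum.distrib sum_distrib_left)
  also have "(\<Sum>w | length w = N. \<Sum>j\<in>UNIV. dqs p (j # w) m * single (Word (j # w)) 1) =
      (\<Sum>w | length w = Suc N. dqs p w m * single (Word w) 1)"
  proof -
    have "(\<Sum>w | length w = N. \<Sum>j\<in>UNIV. dqs p (j # w) m * single (Word (j # w)) 1) =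
        (\<Sum>(w, j) \<in> {w. length w = N} \<times> UNIV. dqs p (j # w) m * single (Word (j # w)) 1)"
      using fin by (simp add: sum.cartesian_product)
    also have "\<dots> = (\<Sum>w | length w = Suc N. dqs p w m * single (Word w) 1)"
      by (rule sum.reindex_bij_witness[of _ "\<lambda>w. (tl w, hd w)" "\<lambda>(w, j). j # w"])
        (auto simp: length_Suc_conv)
    finally show ?thesis .
  qed
  finally have "m = (\<Sum>w | length w = Suc N. dqs p w m * single (Word w) 1) +
      p * ((\<Sum>w | length w = N. c w * single (Word w) 1) + h)"
    using h by (simp add: distrib_left add.assoc)
  then show ?case by blast
qed

end

section \<open>Subspaces stable under division and the right ideals that they generate\<close>

definition dq_stable :: "('n, 'k::field) free_algebra \<Rightarrow> ('n, 'k) free_algebra set \<Rightarrow> bool" where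
  "dq_stable p U \<longleftrightarrow> fa.subspace U \<and> (\<forall>m\<in>U. \<forall>j. dq p j m \<in> U)"

text \<open>For stable \<open>U\<close> and \<open>lookup p 0 \<noteq> 0\<close> this is the right
  ideal U R + p R: one inclusion is \<open>dqs_expansion\<close>, the other consists of the closure
  properties below. In this form its stability under division is immediate.\<close>

definition absorbed :: "('n, 'k::field) free_algebra \<Rightarrow> ('n, 'k) free_algebra set \<Rightarrow> ('n, 'k) free_algebra set" where
  "absorbed p U = {m. \<exists>N. \<forall>w. length w \<ge> N \<longrightarrow> dqs p w m \<in> U}"

lemma dq_stable_dqs: "dq_stable p U \<Longrightarrow> m \<in> U \<Longrightarrow> dqs p w m \<in> U"
  by (induction w) (auto simp: dq_stable_def)

lemma dq_stable_zero: "dq_stable p {0}"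
  by (simp add: dq_stable_def fa.subspace_def)

context
  fixes p :: "('n::finite, 'k::field) free_algebra" and U
  assumes p0: "lookup p 0 \<noteq> 0" and U: "dq_stable p U"
begin

lemma U_subspace: "fa.subspace U"
  using U by (simp add: dq_stable_def)

lemma absorbed_add: "a \<in> absorbed p U \<Longrightarrow> b \<in> absorbed p U \<Longrightarrow> a + b \<in> absorbed p U"
proof -
  assume "a \<in> absorbed p U" "b \<in> absorbed p U"
  then obtain N N' where N: "\<And>w. length w \<ge> N \<Longrightarrow> dqs p w a \<in> U" "\<And>w. length w \<ge> N' \<Longrightarrow> dqs p w b \<in> U"
    by (auto simp: absorbed_def)
  have "dqs p w (a + b) \<in> U" if "length w \<ge> max N N'" for w
    using N that U_subspace by (simp add: dqs_add fa.subspace_add)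
  then show ?thesis unfolding absorbed_def by blast
qed

lemma absorbed_scale: "a \<in> absorbed p U \<Longrightarrow> scalar c * a \<in> absorbed p U"
  using fa.subspace_scale[OF U_subspace] unfolding absorbed_def by (fastforce simp: dqs_scalar_mult)

lemma absorbed_diff: "a \<in> absorbed p U \<Longrightarrow> b \<in> absorbed p U \<Longrightarrow> a - b \<in> absorbed p U"
  using absorbed_add[OF _ absorbed_scale[of b "- 1"], of a] by (simp add: scalar_uminus)

lemma absorbed_0: "0 \<in> absorbed p U"
  using U_subspace by (auto simp: absorbed_def fa.subspace_0)

lemma absorbed_base: "m \<in> U \<Longrightarrow> m \<in> absorbed p U"
  using dq_stable_dqs[OF U] by (auto simp: absorbed_def)

lemma absorbed_dq: "m \<in> absorbed p U \<Longrightarrow> dq p j m \<in> absorbed p U"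
proof -
  assume "m \<in> absorbed p U"
  then obtain N where N: "\<And>w. length w \<ge> N \<Longrightarrow> dqs p w m \<in> U" by (auto simp: absorbed_def)
  have "dqs p w (dq p j m) \<in> U" if "length w \<ge> N" for w
    using N[of "w @ [j]"] that by (simp add: dqs_append)
  then show ?thesis by (auto simp: absorbed_def)
qed

lemma absorbed_if_dq: "(\<And>j. dq p j m \<in> absorbed p U) \<Longrightarrow> m \<in> absorbed p U"
proof -
  assume "\<And>j. dq p j m \<in> absorbed p U"
  then have "\<forall>j. \<exists>N. \<forall>w. length w \<ge> N \<longrightarrow> dqs p w (dq p j m) \<in> U" by (simp add: absorbed_def)
  from choice[OF this] obtain N where N: "\<And>j w. length w \<ge> N j \<Longrightarrow> dqs p w (dq p j m) \<in> U" by blast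
  have "dqs p w m \<in> U" if w: "length w \<ge> Suc (\<Sum>j\<in>UNIV. N j)" for w
  proof -
    obtain w' j where w': "w = w' @ [j]" using w by (cases w rule: rev_cases) auto
    have "N j \<le> (\<Sum>j\<in>UNIV. N j)" by (rule member_le_sum) simp_all
    then show ?thesis using N[of j w'] w by (simp add: w' dqs_append)
  qed
  then show ?thesis unfolding absorbed_def by blast
qed

lemma absorbed_mult_left: "p * a \<in> absorbed p U"
proof -
  obtain N where N: "a \<in> below N" using finite_below_exists by blast
  have "dqs p w (p * a) \<in> U" if "length w \<ge> N" for w
  proof -
    have "a \<in> below (length w + 0)" using N below_mono that by simp
    then have "rqs w a \<in> below 0" by (rule rqs_below)
    then show ?thesis using U_subspace by (simp add: dqs_mult[OF p0] fa.subspace_0)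
  qed
  then show ?thesis unfolding absorbed_def by blast
qed

lemma absorbed_mult: "m \<in> absorbed p U \<Longrightarrow> m * r \<in> absorbed p U"
proof (induction r rule: free_algebra_induct)
  case (scalar c)
  then show ?case by (simp add: scalar_commute absorbed_scale)
next
  case (add a b)
  then show ?case by (simp add: distrib_left absorbed_add)
next
  case (Var a j)
  then have *: "m * a \<in> absorbed p U" by blast
  have "m * a * Var j \<in> absorbed p U"
    by (rule absorbed_if_dq) (use * in \<open>auto simp: absorbed_0\<close>)
  then show ?case by (simp add: mult.assoc)
qed

end

lemma absorbed_zero_imp_multiple:
  fixes p :: "('n::finite, 'k::field) free_algebra"
  assumes "lookup p 0 \<noteq> 0" "m \<in> absorbed p {0}"
  shows "\<exists>h. m = p * h"
proof -
  from assms(2) obtain N where "\<And>w. length w \<ge> N \<Longrightarrow> dqs p w m = 0" by (auto simp: absorbed_def)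
  then show ?thesis using dqs_expansion[OF assms(1), of m N] by auto
qed


section \<open>Scalar extension to rational functions, and substitution of \<open>f\<close> for the
  indeterminate\<close>

type_synonym 'k ratfun = "'k poly fract"

definition const :: "'k::field \<Rightarrow> 'k ratfun" where
  "const c = to_fract [:c:]"

definition ratvar :: "'k::field ratfun" where
  "ratvar = to_fract [:0, 1:]"

definition lift :: "('n, 'k::field) free_algebra \<Rightarrow> ('n, 'k ratfun) free_algebra" where
  "lift m = Poly_Mapping.map const m"

lemma const_simps [simp]: "const 0 = 0" "const 1 = 1" "const c = 0 \<longleftrightarrow> c = 0" "const c = const d \<longleftrightarrow> c = d"
  by (auto simp: const_def one_pCons[symmetric])

lemma const_hom: "const (c + d) = const c + const d" "const (c * d) = const c * const d"
    "const (c - d) = const c - const d" "const (- c) = - const c"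
  by (simp_all add: const_def flip: to_fract_add to_fract_mult to_fract_diff to_fract_uminus)

lemma ratvar_neq_const: "ratvar \<noteq> const c"
  by (simp add: ratvar_def const_def)

lemma lookup_lift [simp]: "lookup (lift m) w = const (lookup m w)"
  by (simp add: lift_def Poly_Mapping.map.rep_eq when_def)

lemma lift_single [simp]: "lift (single w c) = single w (const c)"
  by (intro poly_mapping_eqI) (simp add: lookup_single when_def)

lemma lift_add: "lift (a + b) = lift a + lift b"
  and lift_diff: "lift (a - b) = lift a - lift b"
  and lift_0 [simp]: "lift 0 = 0"
  and rq_lift: "rq j (lift a) = lift (rq j a)"
  by (intro poly_mapping_eqI; simp add: lookup_add lookup_minus const_hom)+

lemma lift_scalar: "lift (scalar c) = scalar (const c)"
  by (simp add: scalar_def)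

lemma lift_mult: "lift (a * b) = lift a * lift b"
proof (induction a rule: poly_mapping_single_induct)
  case (single w c)
  show ?case
    by (induction b rule: poly_mapping_single_induct)
      (simp_all add: mult_single const_hom distrib_left lift_add)
qed (simp add: distrib_right lift_add)

lemma lift_eq_0_iff [simp]: "lift a = 0 \<longleftrightarrow> a = 0"
  by (metis const_simps(3) lookup_lift lookup_zero poly_mapping_eqI)

lemma lift_below_iff: "lift a \<in> below d \<longleftrightarrow> a \<in> below d"
  by (simp add: below_def)

definition shifted :: "('n, 'k::field) free_algebra \<Rightarrow> ('n, 'k ratfun) free_algebra" where
  "shifted f = lift f - scalar ratvar"

text \<open>The indeterminate is not a constant. This makes division modulo \<open>shifted f\<close>
  available for every \<open>f\<close>.\<close>

lemma lookup_shifted_0: "lookup (shifted f) 0 \<noteq> 0"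
  using ratvar_neq_const[of "lookup f 0"] by (auto simp: shifted_def lookup_minus)

lemma rq_shifted: "rq j (shifted f) = lift (rq j f)"
  by (simp add: shifted_def rq_diff rq_lift)

lemma to_fract_pCons: "to_fract (pCons c \<phi>) = const c + ratvar * to_fract \<phi>"
  by (simp add: const_def ratvar_def flip: to_fract_add to_fract_mult)

text \<open>The indeterminate is central and congruent to \<open>f\<close> modulo
  \<open>shifted f\<close>, so Horner's rule replaces it by \<open>f\<close> throughout.\<close>

lemma scalar_to_fract: "\<exists>h. scalar (to_fract \<phi>) = lift (peval \<phi> f) + shifted f * h"
proof (induction \<phi>)
  case 0
  have "scalar (to_fract 0) = lift (peval 0 f) + shifted f * 0" by simp
  then show ?case by blast
next
  case (pCons c \<phi>)
  then obtain h where h: "scalar (to_fract \<phi>) = lift (peval \<phi> f) + shifted f * h" by blast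
  have "scalar (to_fract (pCons c \<phi>)) = scalar (const c) + scalar ratvar * lift (peval \<phi> f) + shifted f * (scalar ratvar * h)"
    by (simp add: to_fract_pCons scalar_add scalar_mult h distrib_left scalar_left_commute add.assoc)
  also have "scalar ratvar = lift f - shifted f" by (simp add: shifted_def)
  finally have "scalar (to_fract (pCons c \<phi>)) =
      lift (peval (pCons c \<phi>) f) + shifted f * ((lift f - shifted f) * h - lift (peval \<phi> f))"
    by (simp add: lift_add lift_mult lift_scalar left_diff_distrib right_diff_distrib)
  then show ?case by blast
qed

lemma ratfun_cases:
  obtains \<phi> \<psi> where "x = to_fract \<phi> / to_fract \<psi>" "\<psi> \<noteq> 0"
proof (cases x)
  case (Fract a b)
  then show thesis using that[of a b] by (simp add: to_fract_def)
qed

text \<open>Up to a nonzero scalar, each class modulo \<open>shifted f\<close> is represented over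
  the base field: clear denominators and replace the indeterminate by \<open>f\<close>.\<close>

lemma substitute:
  fixes f :: "('n::finite, 'k::field) free_algebra"
  shows "\<exists>\<phi> r h. \<phi> \<noteq> 0 \<and> scalar (to_fract \<phi>) * a = lift r + shifted f * h"
proof (induction a rule: poly_mapping_single_induct)
  case (single w x)
  obtain \<phi> \<psi> where x: "x = to_fract \<phi> / to_fract \<psi>" "\<psi> \<noteq> 0" by (rule ratfun_cases)
  obtain h where h: "scalar (to_fract \<phi>) = lift (peval \<phi> f) + shifted f * h" using scalar_to_fract by blast
  have "scalar (to_fract \<psi>) * single w x = scalar (to_fract \<phi>) * single w 1"
    using x by (simp add: scalar_mult_single)
  also have "\<dots> = lift (peval \<phi> f * single w 1) + shifted f * (h * single w 1)"
    by (simp add: h distrib_right lift_mult mult.assoc)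
  finally show ?case using x(2) by blast
next
  case (add a b)
  then obtain \<phi> r h \<psi> s l where a: "\<phi> \<noteq> 0" "scalar (to_fract \<phi>) * a = lift r + shifted f * h"
    and b: "\<psi> \<noteq> 0" "scalar (to_fract \<psi>) * b = lift s + shifted f * l" by blast
  obtain h' l' where h': "scalar (to_fract \<psi>) = lift (peval \<psi> f) + shifted f * h'"
    and l': "scalar (to_fract \<phi>) = lift (peval \<phi> f) + shifted f * l'" using scalar_to_fract by blast
  \<comment> \<open>A further denominator becomes left multiplication of the representative by its
    value at \<open>f\<close>.\<close>
  have *: "scalar (to_fract \<theta>) * (lift r + shifted f * h) =
      lift (peval \<theta> f * r) + shifted f * (k * lift r + scalar (to_fract \<theta>) * h)"
    if "scalar (to_fract \<theta>) = lift (peval \<theta> f) + shifted f * k" for \<theta> r h k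
  proof -
    have "scalar (to_fract \<theta>) * lift r = lift (peval \<theta> f * r) + shifted f * (k * lift r)"
      by (simp add: that distrib_right lift_mult mult.assoc)
    then show ?thesis
      by (simp add: distrib_left scalar_left_commute[of "shifted f"])
  qed
  have "scalar (to_fract (\<phi> * \<psi>)) * (a + b) =
      scalar (to_fract \<psi>) * (scalar (to_fract \<phi>) * a) + scalar (to_fract \<phi>) * (scalar (to_fract \<psi>) * b)"
    unfolding mult.assoc[symmetric] scalar_mult[symmetric]
    by (simp add: distrib_left to_fract_mult mult.commute)
  also have "\<dots> = lift (peval \<psi> f * r + peval \<phi> f * s) +
      shifted f * ((h' * lift r + scalar (to_fract \<psi>) * h) + (l' * lift s + scalar (to_fract \<phi>) * l))"
    unfolding a(2) b(2) *[OF h'] *[OF l'] by (simp add: lift_add distrib_left add_ac)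
  finally show ?case using a(1) b(1) by (metis mult_eq_0_iff)
qed

text \<open>The polynomials \<open>n\<close> with \<open>lift n\<close> absorbed form a right ideal that is stable under left
  multiplication by \<open>f\<close>. It is generated by an element \<open>m\<close> of minimal degree, and since the
  eigenring of \<open>m\<close> is algebraic, it contains a nonzero polynomial in \<open>f\<close>; modulo \<open>shifted f\<close>,
  this is a unit of the field of rational functions.\<close>

lemma one_absorbed:
  fixes f :: "('n::finite, 'k::field) free_algebra"
  assumes U: "dq_stable (shifted f) U" and s: "s \<noteq> 0" "lift s \<in> absorbed (shifted f) U"
  shows "1 \<in> absorbed (shifted f) U"
proof -
  let ?p = "shifted f"
  define N where "N = {n. lift n \<in> absorbed ?p U}"
  note absorbed = absorbed_add[OF lookup_shifted_0 U] absorbed_diff[OF lookup_shifted_0 U]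
    absorbed_scale[OF lookup_shifted_0 U] absorbed_mult_left[OF lookup_shifted_0 U]
    absorbed_mult[OF lookup_shifted_0 U]
  have N_mult: "n * r \<in> N" if "n \<in> N" for n r
    using that by (simp add: N_def lift_mult absorbed)
  have N_diff: "n - n' \<in> N" if "n \<in> N" "n' \<in> N" for n n'
    using that by (simp add: N_def lift_diff absorbed)
  have N_f: "f * n \<in> N" if "n \<in> N" for n
  proof -
    have "lift (f * n) = ?p * lift n + scalar ratvar * lift n"
      by (simp add: lift_mult shifted_def left_diff_distrib)
    then show ?thesis using that by (simp add: N_def absorbed)
  qed
  have N_rq: "rq j n \<in> N" if "n \<in> N" "lookup n 0 = 0" for n j
  proof -
    have "dq ?p j (lift n) = lift (rq j n)" using that(2) by (simp add: dq_def rq_lift)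
    then show ?thesis using absorbed_dq[OF lookup_shifted_0 U, of "lift n" j] that(1) by (simp add: N_def)
  qed
  have "\<exists>m. m \<in> N \<and> m \<noteq> 0 \<and> (\<forall>n. n \<in> N \<and> n \<noteq> 0 \<longrightarrow> ht m \<le> ht n)"
    using ex_has_least_nat[of "\<lambda>n. n \<in> N \<and> n \<noteq> 0" s ht] s by (auto simp: N_def)
  then obtain m where m: "m \<in> N" "m \<noteq> 0" and min: "\<And>n. n \<in> N \<Longrightarrow> n \<noteq> 0 \<Longrightarrow> ht m \<le> ht n"
    by blast
  have rq_less: "ht (rq j n) < d" if "ht n \<le> d" "d > 0" for n :: "('n, 'k) free_algebra" and j d
  proof -
    have "n \<in> below (Suc (d - 1))" using that by (simp add: below_iff_ht)
    then have "rq j n \<in> below (d - 1)" by (simp only: below_Suc_iff)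
    then have "ht (rq j n) \<le> d - 1" by (simp only: below_iff_ht)
    then show ?thesis using that by linarith
  qed
  \<comment> \<open>Without a constant term, the right quotients of \<open>m\<close> would lie in
    \<open>N\<close> and have smaller degree, hence vanish.\<close>
  have m0: "lookup m 0 \<noteq> 0"
  proof
    assume m0: "lookup m 0 = 0"
    have "rq j m = 0" for j
    proof (rule ccontr)
      assume "rq j m \<noteq> 0"
      then have "ht m \<le> ht (rq j m)" using min N_rq m(1) m0 by blast
      then show False using rq_less[of m "ht m" j] m(2) by (metis ht_eq_0_iff not_gr0 not_less order_refl)
    qed
    then have "m = 0" using rq_expansion[of m] m0 by simp
    with m(2) show False ..
  qed
  have principal: "\<exists>r. n = m * r" if "n \<in> N" for n
    using that
  proof (induction "ht n" arbitrary: n rule: less_induct)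
    case less
    show ?case
    proof (cases "n = 0")
      case True
      then have "n = m * 0" by simp
      then show ?thesis by blast
    next
      case False
      define e :: "('n, 'k) free_algebra" where "e = scalar (lookup n 0 / lookup m 0)"
      define n' where "n' = n - m * e"
      have n'N: "n' \<in> N" using less.prems m(1) by (simp add: n'_def N_diff N_mult)
      have n'0: "lookup n' 0 = 0" using m0 by (simp add: n'_def e_def lookup_minus)
      have "m * e \<in> below (ht n)" unfolding e_def scalar_commute
        using min[OF less.prems False] by (intro below_scalar_mult) (simp add: below_iff_ht)
      then have "n' \<in> below (ht n)"
        unfolding n'_def by (intro below_diff) (simp_all add: below_iff_ht)
      moreover have "ht n > 0" using False ht_eq_0_iff[of n] by linarith
      ultimately have "ht (rq j n') < ht n" for j
        using rq_less by (simp add: below_iff_ht)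
      then have "\<forall>j. \<exists>r. rq j n' = m * r" using less.hyps N_rq[OF n'N n'0] by blast
      from choice[OF this] obtain r where r: "\<And>j. rq j n' = m * r j" by blast
      have "n' = (\<Sum>j\<in>UNIV. rq j n' * Var j)" using rq_expansion[of n'] n'0 by simp
      also have "\<dots> = m * (\<Sum>j\<in>UNIV. r j * Var j)" by (simp add: r sum_distrib_left mult.assoc)
      finally have "n = m * ((\<Sum>j\<in>UNIV. r j * Var j) + e)"
        by (simp add: n'_def distrib_left algebra_simps)
      then show ?thesis by blast
    qed
  qed
  obtain g where "f * m = m * g" using principal[OF N_f[OF m(1)]] by blast
  then obtain \<phi> h where \<phi>: "\<phi> \<noteq> 0" "peval \<phi> f = m * h"
    using eigenring_algebraic m(2) by blast
  have "peval \<phi> f \<in> N" using m(1) by (simp add: \<phi>(2) N_mult)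
  moreover obtain l where "scalar (to_fract \<phi>) = lift (peval \<phi> f) + ?p * l" using scalar_to_fract by blast
  ultimately have "scalar (to_fract \<phi>) \<in> absorbed ?p U" by (simp add: N_def absorbed)
  then have "scalar (inverse (to_fract \<phi>)) * scalar (to_fract \<phi>) \<in> absorbed ?p U" by (rule absorbed)
  then show ?thesis using \<phi>(1) by (simp add: scalar_mult[symmetric])
qed

lemma shifted_ht:
  assumes "f \<notin> below (Suc 0)"
  shows "ht (shifted f) = ht f"
proof -
  have "ht f \<noteq> 0" using assms unfolding below_iff_ht by linarith
  have *: "shifted f \<in> below d \<longleftrightarrow> f \<in> below d" if "d \<noteq> 0" for d
  proof -
    from that obtain e where d: "d = Suc e" by (cases d) auto
    show ?thesis unfolding d below_Suc_iff rq_shifted lift_below_iff ..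
  qed
  have "shifted f \<notin> below (Suc 0)" using *[of "Suc 0"] assms by simp
  then have "ht (shifted f) \<noteq> 0" unfolding below_iff_ht by linarith
  show ?thesis
    using *[OF \<open>ht f \<noteq> 0\<close>] *[OF \<open>ht (shifted f) \<noteq> 0\<close>] by (simp add: below_iff_ht)
qed

lemma multiple_below_imp_0:
  fixes p :: "('n, 'k::field) free_algebra"
  assumes "p * h \<in> below d" "d < ht p"
  shows "p * h = 0"
proof (rule ccontr)
  assume "p * h \<noteq> 0"
  then have "p \<noteq> 0" "h \<noteq> 0" by auto
  then have "ht p + ht h \<le> Suc d" using ht_mult[of p h] assms(1) by (simp add: below_iff_ht)
  moreover have "ht h \<noteq> 0" using \<open>h \<noteq> 0\<close> ht_eq_0_iff[of h] by blast
  ultimately show False using assms(2) by linarith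
qed

text \<open>By its degree \<open>u\<close> is not a multiple of \<open>shifted f\<close>, so its
  representative \<open>r\<close> over the base field is nonzero, and \<open>r\<close> is absorbed
  together with \<open>u\<close>.\<close>

lemma one_absorbed_of_nonzero:
  fixes f :: "('n::finite, 'k::field) free_algebra"
  assumes f: "ht f = Suc d" "d > 0" and U: "dq_stable (shifted f) U" "U \<subseteq> below d" "u \<in> U" "u \<noteq> 0"
  shows "1 \<in> absorbed (shifted f) U"
proof -
  obtain \<phi> r h where \<phi>: "\<phi> \<noteq> 0" "scalar (to_fract \<phi>) * u = lift r + shifted f * h"
    using substitute[of u f] by blast
  have "f \<notin> below (Suc 0)" using f by (simp add: below_iff_ht)
  then have ht: "ht (shifted f) = Suc d" using shifted_ht f by metis
  have "r \<noteq> 0"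
  proof
    assume "r = 0"
    then have e: "scalar (to_fract \<phi>) * u = shifted f * h" using \<phi>(2) by simp
    have "shifted f * h \<in> below d" unfolding e[symmetric] using U by (intro below_scalar_mult) blast
    then have "shifted f * h = 0" by (rule multiple_below_imp_0) (simp add: ht)
    then have "scalar (to_fract \<phi>) * u = 0" using e by (simp only:)
    then show False using \<phi>(1) U(4) by simp
  qed
  moreover have "lift r = scalar (to_fract \<phi>) * u - shifted f * h" using \<phi>(2) by simp
  then have "lift r \<in> absorbed (shifted f) U"
    using absorbed_diff[OF lookup_shifted_0 U(1)] absorbed_scale[OF lookup_shifted_0 U(1)]
      absorbed_base[OF lookup_shifted_0 U(1,3)]
      absorbed_mult_left[OF lookup_shifted_0 U(1)] by simp
  ultimately show ?thesis using one_absorbed[OF U(1)] by blast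
qed

text \<open>A nonzero \<open>s\<close> would put 1 into the right ideal of \<open>shifted f\<close>,
  by \<open>one_absorbed\<close> for the zero subspace. That is impossible for degree reasons when
  \<open>f\<close> is not constant.\<close>

lemma lift_multiple_imp_0:
  fixes f :: "('n::finite, 'k::field) free_algebra"
  assumes f: "f \<notin> below (Suc 0)" and s: "lift s = shifted f * h"
  shows "s = 0"
proof (rule ccontr)
  assume "s \<noteq> 0"
  moreover have "lift s \<in> absorbed (shifted f) {0}"
    unfolding s by (rule absorbed_mult_left[OF lookup_shifted_0 dq_stable_zero])
  ultimately have "1 \<in> absorbed (shifted f) {0}" using one_absorbed[OF dq_stable_zero] by blast
  then obtain l where l: "1 = shifted f * l" using absorbed_zero_imp_multiple[OF lookup_shifted_0] by blast
  have "(1 :: ('n, 'k ratfun) free_algebra) \<in> below (Suc 0)" using scalar_below[of 1 0] by simp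
  moreover have "Suc 0 < ht (shifted f)" using f shifted_ht[OF f] by (simp add: below_iff_ht)
  ultimately have "shifted f * l = 0" using multiple_below_imp_0[of "shifted f" l "Suc 0"] l by simp
  then show False using l by simp
qed

text \<open>Clear denominators in \<open>a\<close> and substitute \<open>f\<close> for the central variable.\<close>

lemma intertwined_of_ratfun:
  fixes f g :: "('n::finite, 'k::field) free_algebra"
  assumes f: "f \<notin> below (Suc 0)" and a: "a * shifted g = shifted f * b" "\<nexists>h. a = shifted f * h"
  shows "intertwined f g"
proof -
  let ?p = "shifted f"
  obtain \<phi> r h where \<phi>: "\<phi> \<noteq> 0" "scalar (to_fract \<phi>) * a = lift r + ?p * h"
    using substitute[of a f] by blast
  let ?c = "scalar (to_fract \<phi>)"
  have r: "lift r = ?c * a - ?p * h" using \<phi>(2) by simp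
  have "r \<noteq> 0"
  proof
    assume "r = 0"
    then have "?c * a = ?p * h" using \<phi>(2) by simp
    then have "scalar (inverse (to_fract \<phi>)) * (?c * a) = ?p * (scalar (inverse (to_fract \<phi>)) * h)"
      by (simp only: scalar_left_commute[of ?p])
    moreover have "scalar (inverse (to_fract \<phi>)) * (?c * a) = a"
      unfolding mult.assoc[symmetric] scalar_mult[symmetric] using \<phi>(1) by simp
    ultimately show False using a(2) by metis
  qed
  \<comment> \<open>The indeterminate cancels because it is central. What remains is a polynomial
    over the base field lying in the right ideal of \<open>shifted f\<close>, hence zero.\<close>
  have "lift (f * r - r * g) = (?p + scalar ratvar) * lift r - lift r * (shifted g + scalar ratvar)"
    by (simp add: lift_diff lift_mult shifted_def)
  also have "\<dots> = ?p * lift r - lift r * shifted g"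
    by (simp add: distrib_left distrib_right scalar_commute)
  also have "lift r * shifted g = ?c * (?p * b) - ?p * (h * shifted g)"
    unfolding r by (simp add: left_diff_distrib mult.assoc a(1))
  also have "?p * lift r - (?c * (?p * b) - ?p * (h * shifted g)) = ?p * (lift r - ?c * b + h * shifted g)"
    by (simp add: right_diff_distrib distrib_left scalar_left_commute[of ?p])
  finally have "f * r - r * g = 0" by (rule lift_multiple_imp_0[OF f])
  then show ?thesis unfolding intertwined_def using \<open>r \<noteq> 0\<close> by auto
qed

section \<open>Simple modules and homomorphisms\<close>

text \<open>The left module structure over the free algebra in which a letter divides by itself; its
  submodules are the stable subspaces.\<close>

definition act :: "('n, 'k::field) free_algebra \<Rightarrow> ('n, 'k) free_algebra \<Rightarrow> ('n, 'k) free_algebra \<Rightarrow> ('n, 'k) free_algebra"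
  where "act p \<eta> m = (\<Sum>w\<in>keys \<eta>. scalar (lookup \<eta> w) * dqs p (letters w) m)"

lemma act_superset:
  assumes "finite S" "keys \<eta> \<subseteq> S"
  shows "act p \<eta> m = (\<Sum>w\<in>S. scalar (lookup \<eta> w) * dqs p (letters w) m)"
  using assms by (auto simp: act_def in_keys_iff intro!: sum.mono_neutral_left)

lemma act_add_left: "act p (\<eta> + \<theta>) m = act p \<eta> m + act p \<theta> m"
proof -
  let ?S = "keys \<eta> \<union> keys \<theta>"
  have "keys (\<eta> + \<theta>) \<subseteq> ?S" by (rule keys_add)
  then show ?thesis
    by (simp add: act_superset[of ?S] lookup_add scalar_add distrib_right sum.distrib)
qed

lemma act_single: "act p (single w c) m = scalar c * dqs p (letters w) m"
  by (cases "c = 0") (simp_all add: act_def)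

lemma act_scalar_mult_left: "act p (scalar c * \<eta>) m = scalar c * act p \<eta> m"
proof -
  have "keys (scalar c * \<eta>) \<subseteq> keys \<eta>" by (auto simp: in_keys_iff)
  from act_superset[OF finite_keys this] show ?thesis
    unfolding act_def[of p \<eta>] sum_distrib_left by (simp only: lookup_scalar_mult scalar_mult mult.assoc)
qed

lemma act_0_left [simp]: "act p 0 m = 0"
  by (simp add: act_def)

lemma act_0_right [simp]: "act p \<eta> 0 = 0"
  by (simp add: act_def)

lemma act_add: "act p \<eta> (m + n) = act p \<eta> m + act p \<eta> n"
  by (simp add: act_def dqs_add distrib_left sum.distrib)

lemma act_scalar_mult: "act p \<eta> (scalar c * m) = scalar c * act p \<eta> m"
  unfolding act_def dqs_scalar_mult sum_distrib_left by (intro sum.cong refl scalar_left_commute)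

lemma act_Var_mult: "act p (Var j * \<eta>) m = dq p j (act p \<eta> m)"
proof (induction \<eta> rule: poly_mapping_single_induct)
  case (single w c)
  then show ?case by (simp add: mult_single act_single dq_scalar_mult)
qed (simp add: distrib_left act_add_left dq_add)

lemma act_in_stable:
  assumes "dq_stable p U" "m \<in> U"
  shows "act p \<eta> m \<in> U"
proof -
  have "fa.subspace U" using assms(1) by (simp add: dq_stable_def)
  then show ?thesis unfolding act_def
    using dq_stable_dqs[OF assms] by (intro fa.subspace_sum fa.subspace_scale) auto
qed

text \<open>The bound \<open>d\<close>, in use the degree of \<open>p\<close>, makes
  \<open>U\<close> finite-dimensional and lets it meet p R only in 0, so that \<open>U\<close>
  embeds into the quotient module.\<close>

definition simple_submodule :: "('n, 'k::field) free_algebra \<Rightarrow> nat \<Rightarrow> ('n, 'k) free_algebra set \<Rightarrow> bool" where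
  "simple_submodule p d U \<longleftrightarrow> dq_stable p U \<and> U \<subseteq> below d \<and> U \<noteq> {0} \<and>
     (\<forall>U'. dq_stable p U' \<and> U' \<subseteq> U \<and> U' \<noteq> {0} \<longrightarrow> U' = U)"

lemma simple_submoduleD:
  assumes "simple_submodule p d U"
  shows "dq_stable p U" "U \<subseteq> below d" "U \<noteq> {0}"
    "\<And>U'. dq_stable p U' \<Longrightarrow> U' \<subseteq> U \<Longrightarrow> U' \<noteq> {0} \<Longrightarrow> U' = U"
  using assms by (auto simp: simple_submodule_def)

lemma subspace_below_eqI:
  fixes U U' :: "('n::finite, 'k::field) free_algebra set"
  assumes U: "fa.subspace U" "U \<subseteq> below d" and U': "fa.subspace U'" "U' \<subseteq> U"
    and dim: "fa.dim U \<le> fa.dim U'"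
  shows "U' = U"
proof (rule ccontr)
  assume "U' \<noteq> U"
  then obtain x where x: "x \<in> U" "x \<notin> U'" using U'(2) by blast
  have fin: "finite B \<and> card B \<le> card (short_monomials d :: ('n, 'k) free_algebra set)"
    if "fa.independent B" "B \<subseteq> U" for B
  proof -
    have "B \<subseteq> below d" using that(2) U(2) by blast
    then have "B \<subseteq> fa.span (short_monomials d)"
      by (rule subset_trans[OF _ below_subset_span])
    then show ?thesis
      by (rule fa.independent_span_bound[OF finite_short_monomials that(1)])
  qed
  obtain B' where B': "B' \<subseteq> U'" "fa.independent B'" "U' \<subseteq> fa.span B'" "card B' = fa.dim U'"
    using fa.basis_exists by blast
  have "x \<notin> fa.span B'" using x(2) fa.span_minimal[OF B'(1) U'(1)] by blast
  then have ind: "fa.independent (insert x B')" using B'(2) by (rule fa.independent_insertI)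
  have "insert x B' \<subseteq> U" using x B'(1) U'(2) by blast
  from fa.maximal_independent_subset_extend[OF this ind]
  obtain B where B: "insert x B' \<subseteq> B" "B \<subseteq> U" "fa.independent B" "U \<subseteq> fa.span B" .
  have "card B = fa.dim U" by (rule fa.basis_card_eq_dim[OF B(2,4,3)])
  moreover have "finite B" using fin[OF B(3,2)] by blast
  then have "card (insert x B') \<le> card B" by (rule card_mono[OF _ B(1)])
  moreover have "x \<notin> B'" using x(2) B'(1) by blast
  moreover have "finite B'" using finite_subset[OF B(1) \<open>finite B\<close>] by simp
  ultimately show False using dim B'(4) by simp
qed

text \<open>Division modulo \<open>p\<close> preserves the polynomials of degree less than
  \<open>d\<close>; a nonzero stable subspace of least dimension among them is simple.\<close>

lemma simple_submodule_exists:
  fixes p :: "('n::finite, 'k::field) free_algebra"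
  assumes "p \<in> below (Suc d)" "d > 0"
  obtains U where "simple_submodule p d U"
proof -
  let ?P = "\<lambda>U. dq_stable p U \<and> U \<subseteq> below d \<and> U \<noteq> {0}"
  have "(1 :: ('n, 'k) free_algebra) \<in> below d"
    using assms(2) scalar_below[of 1 "d - 1"] by simp
  then have "?P (below d)"
    using assms dq_below[of p d] by (auto simp: dq_stable_def fa_subspace_below)
  from ex_has_least_nat[of ?P, OF this, of fa.dim]
  obtain U where U: "?P U" and min: "\<And>U'. ?P U' \<Longrightarrow> fa.dim U \<le> fa.dim U'" by blast
  have "U' = U" if "dq_stable p U'" "U' \<subseteq> U" "U' \<noteq> {0}" for U'
    using subspace_below_eqI[of U d U'] min[of U'] U that by (auto simp: dq_stable_def)
  then have "simple_submodule p d U" using U by (simp add: simple_submodule_def)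
  then show thesis by (rule that)
qed

text \<open>If the annihilator of the finite set \<open>B\<close> kills \<open>v\<close>, remove elements of \<open>B\<close> one by one until
  this fails.\<close>

lemma annihilator_dichotomy:
  fixes p q v :: "('n, 'k::field) free_algebra"
  assumes "finite B"
    and "\<exists>\<eta>. lookup \<eta> 0 = 0 \<and> act p \<eta> v \<noteq> 0"
    and "\<And>\<eta>. lookup \<eta> 0 = 0 \<Longrightarrow> (\<And>b. b \<in> B \<Longrightarrow> act q \<eta> b = 0) \<Longrightarrow> act p \<eta> v = 0"
  shows "\<exists>b\<in>B. \<exists>L. fa.subspace L \<and> (\<forall>\<eta>\<in>L. \<forall>j. Var j * \<eta> \<in> L) \<and>
    (\<exists>\<eta>\<in>L. act p \<eta> v \<noteq> 0) \<and> (\<forall>\<eta>\<in>L. act q \<eta> b = 0 \<longrightarrow> act p \<eta> v = 0)"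
  using assms(1,3)
proof (induction B rule: finite_induct)
  case empty
  then show ?case using assms(2) by auto
next
  case (insert b B)
  define L where "L = {\<eta>. lookup \<eta> 0 = 0 \<and> (\<forall>b\<in>B. act q \<eta> b = 0)}"
  show ?case
  proof (cases "\<forall>\<eta>\<in>L. act p \<eta> v = 0")
    case True
    then have "\<exists>b\<in>B. \<exists>L. fa.subspace L \<and> (\<forall>\<eta>\<in>L. \<forall>j. Var j * \<eta> \<in> L) \<and>
      (\<exists>\<eta>\<in>L. act p \<eta> v \<noteq> 0) \<and> (\<forall>\<eta>\<in>L. act q \<eta> b = 0 \<longrightarrow> act p \<eta> v = 0)"
      by (intro insert.IH) (auto simp: L_def)
    then show ?thesis by blast
  next
    \<comment> \<open>An element of \<open>L\<close> that kills \<open>b\<close> kills all of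
      \<open>insert b B\<close>, hence \<open>v\<close>. So \<open>\<eta> b\<close> determines
      \<open>\<eta> v\<close> for \<eta> in \<open>L\<close>, and not all these values
      vanish.\<close>
    case False
    have "fa.subspace L"
      by (auto simp: fa.subspace_def L_def lookup_add act_add_left act_scalar_mult_left)
    moreover have "\<forall>\<eta>\<in>L. \<forall>j. Var j * \<eta> \<in> L"
      by (auto simp: L_def act_Var_mult lookup_mult_0)
    moreover have "\<forall>\<eta>\<in>L. act q \<eta> b = 0 \<longrightarrow> act p \<eta> v = 0"
      using insert.prems by (auto simp: L_def)
    ultimately show ?thesis using False by blast
  qed
qed

text \<open>Simplicity gives L b = W, and sending \<open>\<eta> b\<close> to \<open>\<eta> v\<close>
  is a nonzero homomorphism \<theta> from \<open>W\<close> to \<open>V\<close>. Since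
  \<open>W\<close> and \<open>q\<close> generate the unit right ideal, \<theta> extends to a map of
  right modules from R / q R to R / p R. The image \<open>a\<close> of 1 satisfies a q = 0 modulo p
  R because \<open>q\<close> is zero in the source.\<close>

lemma homomorphism_extends:
  fixes p q v b :: "('n::finite, 'k::field) free_algebra"
  assumes p0: "lookup p 0 \<noteq> 0" and q0: "lookup q 0 \<noteq> 0"
    and V: "dq_stable p V" "v \<in> V" "\<And>h. p * h \<in> V \<Longrightarrow> p * h = 0"
    and W: "dq_stable q W" "b \<in> W" "1 \<in> absorbed q W"
      "\<And>U'. dq_stable q U' \<Longrightarrow> U' \<subseteq> W \<Longrightarrow> U' \<noteq> {0} \<Longrightarrow> U' = W"
    and L: "fa.subspace L" "\<And>\<eta> j. \<eta> \<in> L \<Longrightarrow> Var j * \<eta> \<in> L"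
      "\<eta>0 \<in> L" "act p \<eta>0 v \<noteq> 0" "\<And>\<eta>. \<eta> \<in> L \<Longrightarrow> act q \<eta> b = 0 \<Longrightarrow> act p \<eta> v = 0"
  shows "\<exists>a h. a * q = p * h \<and> (\<nexists>h. a = p * h)"
proof -
  let ?Lb = "(\<lambda>\<eta>. act q \<eta> b) ` L"
  have "dq_stable q ?Lb"
    unfolding dq_stable_def
  proof (intro conjI ballI allI)
    show "fa.subspace ?Lb"
      unfolding fa.subspace_def
    proof (intro conjI ballI allI)
      show "0 \<in> ?Lb" using fa.subspace_0[OF L(1)] by (intro image_eqI[of _ _ 0]) simp_all
      fix x y assume "x \<in> ?Lb" "y \<in> ?Lb"
      then obtain \<eta> \<theta> where "x = act q \<eta> b" "y = act q \<theta> b" "\<eta> \<in> L" "\<theta> \<in> L" by blast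
      then show "x + y \<in> ?Lb"
        using fa.subspace_add[OF L(1)] by (intro image_eqI[of _ _ "\<eta> + \<theta>"]) (simp_all add: act_add_left)
    next
      fix c x assume "x \<in> ?Lb"
      then obtain \<eta> where "x = act q \<eta> b" "\<eta> \<in> L" by blast
      then show "scalar c * x \<in> ?Lb"
        using fa.subspace_scale[OF L(1)]
        by (intro image_eqI[of _ _ "scalar c * \<eta>"]) (simp_all add: act_scalar_mult_left)
    qed
    fix m j assume "m \<in> ?Lb"
    then obtain \<eta> where "m = act q \<eta> b" "\<eta> \<in> L" by blast
    then show "dq q j m \<in> ?Lb"
      using L(2) by (intro image_eqI[of _ _ "Var j * \<eta>"]) (simp_all add: act_Var_mult)
  qed
  moreover have "?Lb \<subseteq> W" using act_in_stable[OF W(1,2)] by blast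
  moreover have "act q \<eta>0 b \<noteq> 0" using L(3,4,5) by blast
  then have "?Lb \<noteq> {0}" using L(3) by blast
  ultimately have LbW: "?Lb = W" by (rule W(4))
  define \<theta> where "\<theta> m = act p (SOME \<eta>. \<eta> \<in> L \<and> act q \<eta> b = m) v" for m
  have \<theta>: "\<theta> (act q \<eta> b) = act p \<eta> v" if "\<eta> \<in> L" for \<eta>
  proof -
    define \<eta>' where "\<eta>' = (SOME \<eta>'. \<eta>' \<in> L \<and> act q \<eta>' b = act q \<eta> b)"
    have \<eta>': "\<eta>' \<in> L" "act q \<eta>' b = act q \<eta> b"
      using someI[of "\<lambda>\<eta>'. \<eta>' \<in> L \<and> act q \<eta>' b = act q \<eta> b" \<eta>] that by (simp_all add: \<eta>'_def)
    have *: "act r (\<eta>' + scalar (- 1) * \<eta>) m = act r \<eta>' m - act r \<eta> m" for r m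
      unfolding act_add_left act_scalar_mult_left by (simp add: scalar_uminus)
    have "\<eta>' + scalar (- 1) * \<eta> \<in> L"
      by (intro fa.subspace_add[OF L(1)] fa.subspace_scale[OF L(1)] \<eta>'(1) that)
    then have "act p \<eta>' v - act p \<eta> v = 0"
      using L(5)[of "\<eta>' + scalar (- 1) * \<eta>"] \<eta>'(2) unfolding * by simp
    then show ?thesis by (simp add: \<theta>_def \<eta>'_def[symmetric])
  qed
  have WL: "\<exists>\<eta>\<in>L. m = act q \<eta> b" if "m \<in> W" for m using that LbW by blast
  have \<theta>_V: "\<theta> m \<in> V" if "m \<in> W" for m
    using WL[OF that] \<theta> act_in_stable[OF V(1,2)] by auto
  have \<theta>_add: "\<theta> (m + n) = \<theta> m + \<theta> n" if mn: "m \<in> W" "n \<in> W" for m n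
  proof -
    obtain \<eta> \<eta>' where *: "\<eta> \<in> L" "m = act q \<eta> b" "\<eta>' \<in> L" "n = act q \<eta>' b" using WL mn by metis
    show ?thesis
      using \<theta>[OF fa.subspace_add[OF L(1) *(1,3)]] \<theta>[OF *(1)] \<theta>[OF *(3)] by (simp add: * act_add_left)
  qed
  have \<theta>_scale: "\<theta> (scalar c * m) = scalar c * \<theta> m" if m: "m \<in> W" for c m
  proof -
    obtain \<eta> where *: "\<eta> \<in> L" "m = act q \<eta> b" using WL m by metis
    show ?thesis
      using \<theta>[OF fa.subspace_scale[OF L(1) *(1), of c]] \<theta>[OF *(1)] by (simp add: * act_scalar_mult_left)
  qed
  have \<theta>_dq: "\<theta> (dq q j m) = dq p j (\<theta> m)" if m: "m \<in> W" for j m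
  proof -
    obtain \<eta> where *: "\<eta> \<in> L" "m = act q \<eta> b" using WL m by metis
    show ?thesis using \<theta>[OF L(2)[OF *(1), of j]] \<theta>[OF *(1)] by (simp add: * act_Var_mult)
  qed
  have W0: "0 \<in> W" using W(1) fa.subspace_0 by (auto simp: dq_stable_def)
  have \<theta>_0: "\<theta> 0 = 0" using \<theta>_scale[OF W0, of 0] by simp
  have fin: "finite {w :: 'n list. length w = N}" for N
    using finite_lists_length_eq[of "UNIV :: 'n set" N] by simp
  \<comment> \<open>Apply \<theta> termwise to the expansion of \<open>m\<close> by words of length
    \<open>N\<close>, as soon as all quotients lie in \<open>W\<close>. The result depends on
    \<open>N\<close>, but only modulo p R, so the extended map is encoded as the relation
    \<open>R\<close> below.\<close>
  define S where "S N m = (\<Sum>w | length w = N. \<theta> (dqs q w m) * single (Word w) 1)" for N m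
  define dom where "dom N m \<longleftrightarrow> (\<forall>w. N \<le> length w \<longrightarrow> dqs q w m \<in> W)" for N m
  define R where "R m a \<longleftrightarrow> (\<exists>N. dom N m \<and> (\<exists>h. a = S N m + p * h))" for m a
  have S_Suc: "\<exists>h. S N m = S (Suc N) m + p * h" if dom: "dom N m" for N m
  proof -
    define c :: "'n list \<Rightarrow> ('n, 'k) free_algebra"
      where "c w = scalar (lookup (\<theta> (dqs q w m)) 0 / lookup p 0)" for w
    have "S N m = (\<Sum>w | length w = N. (\<Sum>j\<in>UNIV. \<theta> (dqs q (j # w) m) * single (Word (j # w)) 1) +
        p * (c w * single (Word w) 1))"
      unfolding S_def
    proof (intro sum.cong refl)
      fix w :: "'n list" assume "w \<in> {w. length w = N}"
      then have mW: "dqs q w m \<in> W" using dom by (simp add: dom_def)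
      have "\<theta> (dqs q w m) * single (Word w) 1 =
          ((\<Sum>j\<in>UNIV. dq p j (\<theta> (dqs q w m)) * Var j) + p * c w) * single (Word w) 1"
        using dq_expansion[OF p0, of "\<theta> (dqs q w m)"] by (simp add: c_def)
      then show "\<theta> (dqs q w m) * single (Word w) 1 =
          (\<Sum>j\<in>UNIV. \<theta> (dqs q (j # w) m) * single (Word (j # w)) 1) + p * (c w * single (Word w) 1)"
        unfolding monomial_conv_Cons[of _ w] by (simp add: distrib_right sum_distrib_right mult.assoc \<theta>_dq[OF mW])
    qed
    also have "\<dots> = (\<Sum>w | length w = N. \<Sum>j\<in>UNIV. \<theta> (dqs q (j # w) m) * single (Word (j # w)) 1) +
        p * (\<Sum>w | length w = N. c w * single (Word w) 1)"
      by (simp add: sum.distrib sum_distrib_left)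
    also have "(\<Sum>w | length w = N. \<Sum>j\<in>UNIV. \<theta> (dqs q (j # w) m) * single (Word (j # w)) 1) =
        (\<Sum>(w, j) \<in> {w. length w = N} \<times> UNIV. \<theta> (dqs q (j # w) m) * single (Word (j # w)) 1)"
      using fin by (simp add: sum.cartesian_product)
    also have "\<dots> = S (Suc N) m"
      unfolding S_def
      by (rule sum.reindex_bij_witness[of _ "\<lambda>w. (tl w, hd w)" "\<lambda>(w, j). j # w"])
        (auto simp: length_Suc_conv)
    finally show ?thesis by blast
  qed
  have dom_mono: "dom N' m" if "dom N m" "N \<le> N'" for N N' m
    using that by (auto simp: dom_def)
  have S_mono: "\<exists>h. S N m = S N' m + p * h" if dom: "dom N m" "N \<le> N'" for N N' m
    using dom(2)
  proof (induction N' rule: dec_induct)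
    case base
    have "S N m = S N m + p * 0" by simp
    then show ?case by blast
  next
    case (step n)
    then obtain h where "S N m = S n m + p * h" by blast
    moreover obtain h' where "S n m = S (Suc n) m + p * h'" using S_Suc dom_mono[OF dom(1)] step by blast
    ultimately have "S N m = S (Suc n) m + p * (h' + h)" by (simp add: distrib_left add.assoc)
    then show ?case by blast
  qed
  have R_at: "\<exists>N. dom N m \<and> (\<forall>N'\<ge>N. \<exists>h. a = S N' m + p * h)" if "R m a" for m a
  proof -
    from that obtain N h where N: "dom N m" "a = S N m + p * h" by (auto simp: R_def)
    have "\<exists>h. a = S N' m + p * h" if N': "N \<le> N'" for N'
    proof -
      obtain h' where "S N m = S N' m + p * h'" using S_mono[OF N(1) N'] by blast
      then have "a = S N' m + p * (h' + h)" using N(2) by (simp add: distrib_left add.assoc)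
      then show ?thesis by blast
    qed
    then show ?thesis using N(1) by blast
  qed
  have subW: "fa.subspace W" using W(1) by (simp add: dq_stable_def)
  have R_add: "R (m + n) (a + c)" if R: "R m a" "R n c" for m n a c
  proof -
    obtain N N' where N: "dom N m" "\<And>M. M \<ge> N \<Longrightarrow> \<exists>h. a = S M m + p * h"
      and N': "dom N' n" "\<And>M. M \<ge> N' \<Longrightarrow> \<exists>h. c = S M n + p * h" using R_at R by metis
    define M where "M = max N N'"
    obtain h h' where h: "a = S M m + p * h" "c = S M n + p * h'"
      using N(2)[of M] N'(2)[of M] by (auto simp: M_def)
    have d: "dom M m" "dom M n" using dom_mono N(1) N'(1) by (auto simp: M_def)
    then have "dom M (m + n)" using fa.subspace_add[OF subW] by (simp add: dom_def dqs_add)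
    moreover have "S M (m + n) = S M m + S M n"
      unfolding S_def sum.distrib[symmetric]
      by (intro sum.cong refl) (use d in \<open>simp add: dqs_add \<theta>_add dom_def distrib_right\<close>)
    then have "a + c = S M (m + n) + p * (h + h')" by (simp add: h distrib_left add_ac)
    ultimately show ?thesis unfolding R_def by blast
  qed
  have R_scale: "R (scalar e * m) (scalar e * a)" if R: "R m a" for e m a
  proof -
    obtain N h where N: "dom N m" "a = S N m + p * h" using R by (auto simp: R_def)
    have "dom N (scalar e * m)" using N(1) fa.subspace_scale[OF subW] by (simp add: dom_def dqs_scalar_mult)
    moreover have "S N (scalar e * m) = scalar e * S N m"
      unfolding S_def sum_distrib_left
      by (intro sum.cong refl) (use N(1) in \<open>simp add: dqs_scalar_mult \<theta>_scale dom_def mult.assoc\<close>)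
    then have "scalar e * a = S N (scalar e * m) + p * (scalar e * h)"
      by (simp add: N(2) distrib_left scalar_left_commute[of p])
    ultimately show ?thesis unfolding R_def by blast
  qed
  have R_Var: "R (m * Var i) (a * Var i)" if R: "R m a" for m a i
  proof -
    obtain N h where N: "dom N m" "a = S N m + p * h" using R by (auto simp: R_def)
    have dqs_snoc: "dqs q (w @ [j]) (m * Var i) = (if i = j then dqs q w m else 0)" for w j
      by (simp add: dqs_append)
    have "dqs q w (m * Var i) \<in> W" if len: "Suc N \<le> length w" for w
    proof -
      obtain w' j where w': "w = w' @ [j]" using len by (cases w rule: rev_cases) auto
      then show ?thesis using N(1) len W0 by (simp add: dqs_snoc dom_def)
    qed
    then have "dom (Suc N) (m * Var i)" by (simp add: dom_def)
    moreover have "S (Suc N) (m * Var i) = S N m * Var i"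
    proof -
      have bl: "butlast w @ [last w] = w" if "length w = Suc N" for w :: "'n list"
        using that by (intro append_butlast_last_id) auto
      have "S (Suc N) (m * Var i) = (\<Sum>(w, j) \<in> {w. length w = N} \<times> UNIV.
          \<theta> (dqs q (w @ [j]) (m * Var i)) * single (Word (w @ [j])) 1)"
        unfolding S_def
        by (rule sum.reindex_bij_witness[of _ "\<lambda>(w, j). w @ [j]" "\<lambda>w. (butlast w, last w)"])
          (auto simp: bl)
      also have "\<dots> = (\<Sum>w | length w = N. \<Sum>j\<in>UNIV.
          \<theta> (dqs q (w @ [j]) (m * Var i)) * single (Word (w @ [j])) 1)"
        using fin by (simp add: sum.cartesian_product)
      also have "\<dots> = (\<Sum>w | length w = N. \<theta> (dqs q w m) * single (Word w) 1 * Var i)"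
      proof (intro sum.cong refl)
        fix w
        have "(\<Sum>j\<in>UNIV. \<theta> (dqs q (w @ [j]) (m * Var i)) * single (Word (w @ [j])) 1) =
            (\<Sum>j\<in>UNIV. if i = j then \<theta> (dqs q w m) * single (Word (w @ [i])) 1 else 0)"
          by (intro sum.cong refl) (simp add: dqs_snoc \<theta>_0)
        then show "(\<Sum>j\<in>UNIV. \<theta> (dqs q (w @ [j]) (m * Var i)) * single (Word (w @ [j])) 1) =
            \<theta> (dqs q w m) * single (Word w) 1 * Var i"
          by (simp add: mult.assoc mult_single)
      qed
      also have "\<dots> = S N m * Var i" by (simp add: S_def sum_distrib_right)
      finally show ?thesis .
    qed
    then have "a * Var i = S (Suc N) (m * Var i) + p * (h * Var i)"
      by (simp add: N(2) distrib_right mult.assoc)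
    ultimately show ?thesis unfolding R_def by blast
  qed
  have R_mult: "R (m * r) (a * r)" if "R m a" for m a r
  proof (induction r rule: free_algebra_induct)
    case (scalar c)
    then show ?case using R_scale[OF that, of c] unfolding scalar_commute[of m] scalar_commute[of a] .
  next
    case (add r s)
    then show ?case using R_add by (simp add: distrib_left)
  next
    case (Var r j)
    then show ?case using R_Var by (simp add: mult.assoc[symmetric])
  qed
  \<comment> \<open>All terms of the expansion by nonempty words are zero. For \<open>m = q\<close>
    this gives the intertwining equation, for \<open>m = 0\<close> the uniqueness of images modulo p
    R.\<close>
  have R_vanish: "\<exists>h. a = p * h" if R: "R m a" and zero: "\<And>w. w \<noteq> [] \<Longrightarrow> dqs q w m = 0" for m a
  proof -
    obtain N where N: "\<And>N'. N' \<ge> N \<Longrightarrow> \<exists>h. a = S N' m + p * h" using R_at[OF R] by blast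
    obtain h where h: "a = S (Suc N) m + p * h" using N[of "Suc N"] by auto
    have "S (Suc N) m = 0" unfolding S_def
    proof (rule sum.neutral, rule ballI)
      fix w :: "'n list" assume "w \<in> {w. length w = Suc N}"
      then have "dqs q w m = 0" by (intro zero) auto
      then show "\<theta> (dqs q w m) * single (Word w) 1 = 0" by (simp add: \<theta>_0)
    qed
    then show ?thesis using h by auto
  qed
  obtain N where N: "dom N 1" using W(3) by (auto simp: absorbed_def dom_def)
  define a where "a = S N 1"
  have "R 1 a" unfolding R_def using N by (intro exI[of _ N] conjI exI[of _ 0]) (simp_all add: a_def)
  have "R q (a * q)" using R_mult[OF \<open>R 1 a\<close>, of q] by simp
  moreover have "dqs q w q = 0" if "w \<noteq> []" for w
  proof -
    have "rqs w (1 :: ('n, 'k) free_algebra) = 0" using that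
      by (induction w) (auto, metis rq_0 rq_1 rqs_simps(1))
    then show ?thesis using dqs_mult[OF q0, of w 1] by simp
  qed
  ultimately obtain h where h: "a * q = p * h" using R_vanish by blast
  \<comment> \<open>If \<open>a\<close> were in p R, then each \<open>\<theta> m\<close>, congruent
    to \<open>a * m\<close>, would lie in p R and in \<open>V\<close>, which meet only in 0; but
    \<theta> is not zero.\<close>
  moreover have "\<nexists>h. a = p * h"
  proof
    assume "\<exists>h. a = p * h"
    then obtain h where h: "a = p * h" by blast
    have "\<theta> m = 0" if m: "m \<in> W" for m
    proof -
      have "R m (a * m)" using R_mult[OF \<open>R 1 a\<close>, of m] by simp
      moreover have "R m (\<theta> m)"
        unfolding R_def
      proof (intro exI conjI)
        show "dom 0 m" using dq_stable_dqs[OF W(1) m] by (simp add: dom_def)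
        show "\<theta> m = S 0 m + p * 0" by (simp add: S_def zero_free_monoid_def[symmetric])
      qed
      from R_scale[OF this, of "- 1"] have "R (- m) (- \<theta> m)" by (simp add: scalar_uminus)
      ultimately have "R (m + - m) (a * m + - \<theta> m)" by (rule R_add)
      then have "R 0 (a * m - \<theta> m)" by simp
      from R_vanish[OF this] obtain l where "a * m - \<theta> m = p * l" by auto
      then have "\<theta> m = p * (h * m - l)" by (simp add: h right_diff_distrib mult.assoc algebra_simps)
      then show ?thesis using V(3)[of "h * m - l"] \<theta>_V[OF m] by simp
    qed
    moreover have "act q \<eta>0 b \<in> W" "\<theta> (act q \<eta>0 b) \<noteq> 0"
      using act_in_stable[OF W(1,2)] \<theta>[OF L(3)] L(4) by simp_all
    ultimately show False by blast
  qed
  ultimately show ?thesis by blast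
qed

section \<open>Matrices with prescribed eigenvalues\<close>

text \<open>A weighted automaton for the polynomial with the coefficients \<open>c\<close>: the states are words, encoded
  by \<open>d\<close> as indices below \<open>n\<close>, and reading a letter either extends the state or returns to the
  empty word with the weight of the word read. The indices from \<open>n\<close> to \<open>N\<close> are padding.\<close>

definition automaton :: "nat \<Rightarrow> nat \<Rightarrow> (nat \<Rightarrow> 'n list) \<Rightarrow> ('n list \<Rightarrow> 'k::field) \<Rightarrow> 'n \<Rightarrow> 'k mat" where
  "automaton N n d c j = mat N N (\<lambda>(r, s). if r < n \<and> s < n then
     (if d s = [] then c (d r @ [j]) else if d s = d r @ [j] then 1 else 0) else 0)"

lemma automaton_matrix_tuples: "automaton N n d c \<in> matrix_tuples N"
  by (simp add: matrix_tuples_def automaton_def)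

lemma eval_entry_add:
  assumes "X \<in> matrix_tuples N" "i < N" "s < N"
  shows "eval_at N (a + b) X $$ (i, s) = eval_at N a X $$ (i, s) + eval_at N b X $$ (i, s)"
  using assms carrier_matD[OF eval_at_carrier[of N a X]] carrier_matD[OF eval_at_carrier[of N b X]]
  by (simp add: eval_at_add)

lemma eval_entry_mult:
  assumes "X \<in> matrix_tuples N" "i < N" "s < N"
  shows "eval_at N (a * b) X $$ (i, s) = (\<Sum>r<N. eval_at N a X $$ (i, r) * eval_at N b X $$ (r, s))"
  using assms carrier_matD[OF eval_at_carrier[of N a X]] carrier_matD[OF eval_at_carrier[of N b X]]
  by (simp add: eval_at_mult scalar_prod_def atLeast0LessThan)

lemma eval_entry_mult_Var:
  assumes "X \<in> matrix_tuples N" "i < N" "s < N"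
  shows "eval_at N (a * Var j) X $$ (i, s) = (\<Sum>r<N. eval_at N a X $$ (i, r) * X j $$ (r, s))"
  using assms carrier_matD[OF eval_at_carrier[of N a X]] carrier_matD[OF matrix_tuplesD[OF assms(1), of j]]
  by (simp add: eval_at_mult_Var scalar_prod_def atLeast0LessThan)

lemma eval_entry_scalar:
  assumes "X \<in> matrix_tuples N" "i < N" "s < N"
  shows "eval_at N (scalar c) X $$ (i, s) = (if i = s then c else 0)"
  using assms by (simp add: eval_at_scalar)

lemma eval_entry_mult_scalar:
  assumes "X \<in> matrix_tuples N" "i < N" "s < N"
  shows "eval_at N (a * scalar c) X $$ (i, s) = eval_at N a X $$ (i, s) * c"
  using assms by (simp add: eval_entry_mult eval_entry_scalar if_distrib[of "(*) _"] cong: if_cong)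

lemma eval_entry_scalar_mult:
  assumes "X \<in> matrix_tuples N" "i < N" "s < N"
  shows "eval_at N (scalar c * a) X $$ (i, s) = c * eval_at N a X $$ (i, s)"
  using eval_entry_mult_scalar[OF assms, of a c] by (simp add: scalar_commute mult.commute)

lemma eval_entry_0:
  assumes "i < N" "s < N"
  shows "eval_at N 0 X $$ (i, s) = 0"
  using assms by (simp add: eval_at_def)

lemma eval_entry_sum:
  assumes "X \<in> matrix_tuples N" "i < N" "s < N"
  shows "eval_at N (sum f A) X $$ (i, s) = (\<Sum>x\<in>A. eval_at N (f x) X $$ (i, s))"
  using assms by (induction A rule: infinite_finite_induct) (simp_all add: eval_entry_0 eval_entry_add)

lemma sum_less_extend:
  fixes f :: "nat \<Rightarrow> 'b::comm_monoid_add"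
  assumes "n \<le> N" "\<And>s. n \<le> s \<Longrightarrow> s < N \<Longrightarrow> f s = 0"
  shows "(\<Sum>s<N. f s) = (\<Sum>s<n. f s)"
  using assms by (intro sum.mono_neutral_right) auto

context
  fixes l n N :: nat and d :: "nat \<Rightarrow> 'n::finite list" and c :: "'n list \<Rightarrow> 'k::field"
  assumes l: "l > 0" and nN: "n \<le> N" and d: "bij_betw d {..<n} {w. length w < l}"
begin

lemma finite_states: "finite {w :: 'n list. length w < l}"
  using bij_betw_finite[OF d] by simp

lemma automaton_row_sum:
  fixes y :: "'n list \<Rightarrow> ('m, 'k) free_algebra"
  assumes r: "r < n" and y: "\<And>u. length u \<ge> l \<Longrightarrow> y u = 0"
  shows "(\<Sum>s<n. scalar (automaton N n d c j $$ (r, s)) * y (d s)) = scalar (c (d r @ [j])) * y [] + y (d r @ [j])"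
proof -
  let ?e = "\<lambda>u. if u = [] then c (d r @ [j]) else if u = d r @ [j] then 1 else 0"
  have "(\<Sum>s<n. scalar (automaton N n d c j $$ (r, s)) * y (d s)) = (\<Sum>s<n. scalar (?e (d s)) * y (d s))"
    using r nN by (intro sum.cong) (auto simp: automaton_def)
  also have "\<dots> = (\<Sum>u | length u < l. scalar (?e u) * y u)"
    by (rule sum.reindex_bij_betw[OF d])
  also have "\<dots> = (\<Sum>u\<in>{[], d r @ [j]}. scalar (?e u) * y u)"
    by (rule sum.mono_neutral_cong) (use finite_states l y in \<open>auto simp: not_less\<close>)
  also have "\<dots> = scalar (c (d r @ [j])) * y [] + y (d r @ [j])" by simp
  finally show ?thesis .
qed

lemma automaton_col_sum:
  fixes y :: "'n list \<Rightarrow> 'k"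
  assumes s: "s < n"
  shows "(\<Sum>r<n. y (d r) * automaton N n d c j $$ (r, s)) =
    (if d s = [] then \<Sum>u | length u < l. y u * c (u @ [j])
     else if last (d s) = j then y (butlast (d s)) else 0)"
proof -
  let ?e = "\<lambda>u. if d s = [] then c (u @ [j]) else if d s = u @ [j] then 1 else 0"
  have "(\<Sum>r<n. y (d r) * automaton N n d c j $$ (r, s)) = (\<Sum>r<n. y (d r) * ?e (d r))"
    using s nN by (intro sum.cong) (auto simp: automaton_def)
  also have "\<dots> = (\<Sum>u | length u < l. y u * ?e u)"
    by (rule sum.reindex_bij_betw[OF d])
  also have "\<dots> = (if d s = [] then \<Sum>u | length u < l. y u * c (u @ [j])
     else if last (d s) = j then y (butlast (d s)) else 0)"
  proof (cases "d s = []")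
    case False
    then obtain u j' where u: "d s = u @ [j']" by (cases "d s" rule: rev_cases) auto
    have "length (d s) < l" using bij_betwE[OF d] s by auto
    then have "(\<Sum>v | length v < l. y v * ?e v) = (\<Sum>v\<in>{u}. y v * ?e v)"
      using finite_states by (intro sum.mono_neutral_right) (auto simp: u)
    then show ?thesis by (simp add: u)
  qed simp
  finally show ?thesis .
qed

lemma finite_nonempty_lists: "finite {w :: 'n list. w \<noteq> [] \<and> length w \<le> l}"
  by (rule finite_subset[OF _ finite_lists_length_le[of UNIV l]]) auto

lemma act_conv_lists:
  fixes p \<eta> :: "('n, 'k) free_algebra"
  assumes \<eta>0: "lookup \<eta> 0 = 0" and \<eta>: "\<eta> \<in> below (Suc l)"
  shows "act p \<eta> m = (\<Sum>w | w \<noteq> [] \<and> length w \<le> l. scalar (lookup \<eta> (Word w)) * dqs p w m)"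
proof -
  have "act p \<eta> m = (\<Sum>w\<in>Word ` {w. w \<noteq> [] \<and> length w \<le> l}. scalar (lookup \<eta> w) * dqs p (letters w) m)"
  proof (rule act_superset)
    show "keys \<eta> \<subseteq> Word ` {w. w \<noteq> [] \<and> length w \<le> l}"
    proof
      fix w assume w: "w \<in> keys \<eta>"
      then have "length (letters w) \<le> l" using \<eta> by (auto simp: below_def in_keys_iff)
      moreover have "letters w \<noteq> []" using w \<eta>0 by (metis Word_letters in_keys_iff zero_free_monoid_def)
      ultimately show "w \<in> Word ` {w. w \<noteq> [] \<and> length w \<le> l}"
        by (intro image_eqI[of _ _ "letters w"]) simp_all
    qed
  qed (rule finite_imageI[OF finite_nonempty_lists])
  also have "\<dots> = (\<Sum>w | w \<noteq> [] \<and> length w \<le> l. scalar (lookup \<eta> (Word w)) * dqs p w m)"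
    by (subst sum.reindex) (auto simp: inj_on_def)
  finally show ?thesis .
qed

lemma automaton_outside: "r < N \<Longrightarrow> s < N \<Longrightarrow> n \<le> r \<or> n \<le> s \<Longrightarrow> automaton N n d c j $$ (r, s) = 0"
  by (auto simp: automaton_def)

text \<open>The kernel vector consists of the constant terms of polynomials \<open>m u\<close> attached to the states:
  on evaluating their expansions modulo \<open>p\<close> at the automaton and adding them up, everything but the
  term with \<open>p\<close> cancels.\<close>

lemma automaton_singular:
  assumes p0: "lookup p 0 \<noteq> 0" and v: "v \<noteq> 0" and fixed: "act p \<eta> v = v"
    and \<eta>0: "lookup \<eta> 0 = 0" and \<eta>: "\<eta> \<in> below (Suc l)" and c: "\<And>w. c w = lookup \<eta> (Word w)"
  shows "det (eval_at N p (automaton N n d c)) = 0"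
proof -
  let ?X = "automaton N n d c"
  note X = automaton_matrix_tuples[of N n d c]
  \<comment> \<open>The state \<open>u\<close> means that \<eta> has been read up to the prefix
    \<open>u\<close>; \<open>m u\<close> applies the nonempty continuations to \<open>v\<close>. The
    initial value \<open>m []\<close> is \<open>v\<close> because \<eta> fixes
    \<open>v\<close>.\<close>
  define m where "m u = (\<Sum>w | w \<noteq> [] \<and> length w \<le> l. scalar (c (u @ w)) * dqs p w v)" for u
  have c_long: "c w = 0" if "length w > l" for w
    using \<eta> that by (auto simp: below_def c)
  note fin = finite_nonempty_lists
  have m_long: "m u = 0" if "length u \<ge> l" for u
    unfolding m_def
  proof (intro sum.neutral ballI)
    fix w :: "'n list" assume "w \<in> {w. w \<noteq> [] \<and> length w \<le> l}"
    then have "length (u @ w) > l" using that by (cases w) auto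
    then show "scalar (c (u @ w)) * dqs p w v = 0" by (simp add: c_long)
  qed
  have m_Nil: "m [] = v"
    using act_conv_lists[OF \<eta>0 \<eta>, of p v] fixed by (simp add: m_def c)
  have m_rec: "m u = (\<Sum>j\<in>UNIV. dq p j (scalar (c (u @ [j])) * v + m (u @ [j])))" for u
  proof -
    have inner: "(\<Sum>w | length w < l. scalar (c ((u @ [j]) @ w)) * dqs p w v) = scalar (c (u @ [j])) * v + m (u @ [j])" for j
    proof -
      have "{w :: 'n list. length w < l} = insert [] {w. w \<noteq> [] \<and> length w < l}" using l by auto
      moreover have "finite {w :: 'n list. w \<noteq> [] \<and> length w < l}"
        by (rule finite_subset[OF _ finite_states]) auto
      ultimately have "(\<Sum>w | length w < l. scalar (c ((u @ [j]) @ w)) * dqs p w v) =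
          scalar (c (u @ [j])) * v + (\<Sum>w | w \<noteq> [] \<and> length w < l. scalar (c ((u @ [j]) @ w)) * dqs p w v)"
        by simp
      also have "(\<Sum>w | w \<noteq> [] \<and> length w < l. scalar (c ((u @ [j]) @ w)) * dqs p w v) = m (u @ [j])"
      proof -
        have "c ((u @ [j]) @ w) = 0" if "\<not> length w < l" for w
          using that by (intro c_long) simp
        then show ?thesis
          unfolding m_def using fin by (intro sum.mono_neutral_left) auto
      qed
      finally show ?thesis .
    qed
    have "m u = (\<Sum>(j, w)\<in>UNIV \<times> {w. length w < l}. scalar (c (u @ j # w)) * dqs p (j # w) v)"
      unfolding m_def
      by (rule sum.reindex_bij_witness[of _ "\<lambda>(j, w). j # w" "\<lambda>w. (hd w, tl w)"])
        (auto simp: neq_Nil_conv)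
    also have "\<dots> = (\<Sum>j\<in>UNIV. \<Sum>w | length w < l. scalar (c (u @ j # w)) * dqs p (j # w) v)"
      using finite_states by (simp add: sum.cartesian_product)
    also have "\<dots> = (\<Sum>j\<in>UNIV. dq p j (\<Sum>w | length w < l. scalar (c ((u @ [j]) @ w)) * dqs p w v))"
    proof (intro sum.cong refl)
      fix j
      have dq_sum: "dq p j (sum f A) = (\<Sum>w\<in>A. dq p j (f w))" for f and A :: "'n list set"
        using dqs_sum[of p "[j]" f A] by simp
      show "(\<Sum>w | length w < l. scalar (c (u @ j # w)) * dqs p (j # w) v) =
          dq p j (\<Sum>w | length w < l. scalar (c ((u @ [j]) @ w)) * dqs p w v)"
        by (simp add: dq_sum dq_scalar_mult)
    qed
    also have "\<dots> = (\<Sum>j\<in>UNIV. dq p j (scalar (c (u @ [j])) * v + m (u @ [j])))"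
      by (simp only: inner)
    finally show ?thesis .
  qed
  have rec: "m (d r) = (\<Sum>j\<in>UNIV. \<Sum>s<n. scalar (?X j $$ (r, s)) * dq p j (m (d s)))" if r: "r < n" for r
  proof -
    have "(\<Sum>s<n. scalar (?X j $$ (r, s)) * dq p j (m (d s))) = dq p j (scalar (c (d r @ [j])) * v + m (d r @ [j]))" for j
      using automaton_row_sum[OF r, of "\<lambda>u. dq p j (m u)"] m_long
      by (simp add: m_Nil dq_add dq_scalar_mult)
    then show ?thesis using m_rec[of "d r"] by simp
  qed
  define z where "z = vec N (\<lambda>r. if r < n then lookup (m (d r)) 0 / lookup p 0 else 0)"
  have z: "z \<in> carrier_vec N" by (simp add: z_def)
  have "eval_at N p ?X *\<^sub>v z = 0\<^sub>v N"
  proof (rule eq_vecI)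
    fix i assume "i < dim_vec (0\<^sub>v N)"
    then have i: "i < N" by simp
    let ?E = "\<lambda>a s. eval_at N a ?X $$ (i, s)"
    note ent = eval_entry_add[OF X i] eval_entry_sum[OF X i] eval_entry_scalar_mult[OF X i]
      eval_entry_mult_Var[OF X i] eval_entry_mult_scalar[OF X i]
    have e1: "(\<Sum>r<n. ?E (m (d r)) r) =
        (\<Sum>r<n. (\<Sum>j\<in>UNIV. \<Sum>s<n. ?E (dq p j (m (d r))) s * ?X j $$ (s, r)) + ?E p r * z $ r)"
    proof (intro sum.cong refl)
      fix r assume "r \<in> {..<n}"
      then have r: "r < n" "r < N" using nN by auto
      let ?m = "m (d r)"
      have "?E ?m r = ?E ((\<Sum>j\<in>UNIV. dq p j ?m * Var j) + p * scalar (lookup ?m 0 / lookup p 0)) r"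
        using dq_expansion[OF p0, of ?m] by simp
      also have "\<dots> = (\<Sum>j\<in>UNIV. \<Sum>s<N. ?E (dq p j ?m) s * ?X j $$ (s, r)) + ?E p r * z $ r"
        using r by (simp add: ent z_def)
      also have "\<dots> = (\<Sum>j\<in>UNIV. \<Sum>s<n. ?E (dq p j ?m) s * ?X j $$ (s, r)) + ?E p r * z $ r"
        using r by (intro arg_cong2[of _ _ _ _ "(+)"] sum.cong refl sum_less_extend nN) (simp add: automaton_outside)
      finally show "?E ?m r = (\<Sum>j\<in>UNIV. \<Sum>s<n. ?E (dq p j ?m) s * ?X j $$ (s, r)) + ?E p r * z $ r" .
    qed
    have e2: "(\<Sum>r<n. (\<Sum>j\<in>UNIV. \<Sum>s<n. ?E (dq p j (m (d r))) s * ?X j $$ (s, r)) + ?E p r * z $ r) =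
        (\<Sum>s<n. \<Sum>j\<in>UNIV. \<Sum>r<n. ?E (dq p j (m (d r))) s * ?X j $$ (s, r)) + (\<Sum>r<n. ?E p r * z $ r)"
    proof -
      have "(\<Sum>r<n. \<Sum>j\<in>UNIV. \<Sum>s<n. ?E (dq p j (m (d r))) s * ?X j $$ (s, r)) =
          (\<Sum>r<n. \<Sum>s<n. \<Sum>j\<in>UNIV. ?E (dq p j (m (d r))) s * ?X j $$ (s, r))"
        by (intro sum.cong refl sum.swap)
      also have "\<dots> = (\<Sum>s<n. \<Sum>r<n. \<Sum>j\<in>UNIV. ?E (dq p j (m (d r))) s * ?X j $$ (s, r))"
        by (rule sum.swap)
      also have "\<dots> = (\<Sum>s<n. \<Sum>j\<in>UNIV. \<Sum>r<n. ?E (dq p j (m (d r))) s * ?X j $$ (s, r))"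
        by (intro sum.cong refl sum.swap)
      finally show ?thesis by (simp add: sum.distrib)
    qed
    have e3: "(\<Sum>s<n. \<Sum>j\<in>UNIV. \<Sum>r<n. ?E (dq p j (m (d r))) s * ?X j $$ (s, r)) = (\<Sum>s<n. ?E (m (d s)) s)"
    proof (intro sum.cong refl)
      fix s assume "s \<in> {..<n}"
      then have s: "s < n" "s < N" using nN by auto
      have "?E (m (d s)) s = ?E (\<Sum>j\<in>UNIV. \<Sum>r<n. scalar (?X j $$ (s, r)) * dq p j (m (d r))) s"
        using rec[OF s(1)] by simp
      then show "(\<Sum>j\<in>UNIV. \<Sum>r<n. ?E (dq p j (m (d r))) s * ?X j $$ (s, r)) = ?E (m (d s)) s"
        using s by (simp add: ent mult.commute)
    qed
    from trans[OF e1 e2] have "(\<Sum>r<n. ?E p r * z $ r) = 0"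
      unfolding e3 add_cancel_right_right .
    moreover have "(\<Sum>r<N. ?E p r * z $ r) = (\<Sum>r<n. ?E p r * z $ r)"
      by (rule sum_less_extend[OF nN]) (simp add: z_def)
    ultimately show "(eval_at N p ?X *\<^sub>v z) $ i = 0\<^sub>v N $ i"
      using i z carrier_matD[OF eval_at_carrier[of N p ?X]] by (simp add: scalar_prod_def atLeast0LessThan)
  qed (use carrier_matD[OF eval_at_carrier[of N p ?X]] in simp)
  moreover have "z \<noteq> 0\<^sub>v N"
  proof
    assume z0: "z = 0\<^sub>v N"
    have const0: "lookup (m (d r)) 0 = 0" if "r < n" for r
      using arg_cong[OF z0, of "\<lambda>z. z $ r"] that nN p0 by (simp add: z_def)
    then have rec': "m (d r) = (\<Sum>j\<in>UNIV. \<Sum>s<n. scalar (?X j $$ (r, s)) * rq j (m (d s)))" if "r < n" for r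
      using rec[OF that] by (simp add: dq_def)
    \<comment> \<open>Once the constant terms vanish, the recursion expresses each
      \<open>m (d r)\<close> by right quotients of the others. A common degree bound therefore drops
      with every round, until even \<open>m [] = v\<close> vanishes.\<close>
    have descent: "\<forall>r<n. m (d r) \<in> below e \<Longrightarrow> \<forall>r<n. m (d r) = 0" for e
    proof (induction e)
      case (Suc e)
      have "m (d r) \<in> below e" if r: "r < n" for r
        unfolding rec'[OF r]
        by (intro below_sum below_scalar_mult) (use Suc.prems in \<open>auto simp: below_Suc_iff\<close>)
      then show ?case using Suc.IH by blast
    qed simp
    have "\<forall>r. \<exists>e. m (d r) \<in> below e" using finite_below_exists by blast
    from choice[OF this] obtain e where e: "\<And>r. m (d r) \<in> below (e r)" by blast
    have "m (d r) \<in> below (\<Sum>s<n. e s)" if "r < n" for r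
      using e[of r] that by (intro below_mono[OF _ e[of r]] member_le_sum) auto
    then have "\<forall>r<n. m (d r) = 0" using descent by blast
    moreover have "[] \<in> d ` {..<n}" using d l by (simp add: bij_betw_def)
    then obtain r where "r < n" "d r = []" by auto
    ultimately show False using m_Nil v by metis
  qed
  ultimately show ?thesis using det_0_iff_vec_prod_zero[OF eval_at_carrier] z by blast
qed

text \<open>A row vector \<open>y\<close> in the left kernel gives row vectors
  \<open>\<psi> m\<close>, namely \<open>y\<close> times the value of \<open>m\<close>. They vanish
  on scalar multiples of \<open>q\<close> and so are determined by the quotients of
  \<open>m\<close>. The shape of the automaton makes the component at a state \<open>u\<close> that
  of \<open>dqs q u m\<close> at the empty word, where \<open>m\<close> can be replaced by
  \<open>act q \<eta> m\<close>. As \<eta> kills \<open>W\<close>, so does \<psi>; then \<psi>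
  vanishes on everything absorbed, in particular at 1, where its value is \<open>y\<close>.\<close>

lemma automaton_nonsingular:
  assumes q0: "lookup q 0 \<noteq> 0" and W: "dq_stable q W" "1 \<in> absorbed q W"
    and kill: "\<And>m. m \<in> W \<Longrightarrow> act q \<eta> m = 0"
    and \<eta>0: "lookup \<eta> 0 = 0" and \<eta>: "\<eta> \<in> below (Suc l)" and c: "\<And>w. c w = lookup \<eta> (Word w)"
  shows "det (eval_at N q (automaton N n d c)) \<noteq> 0"
proof
  let ?X = "automaton N n d c"
  note X = automaton_matrix_tuples[of N n d c]
  let ?Q = "eval_at N q ?X"
  assume "det ?Q = 0"
  then have "det (transpose_mat ?Q) = 0" by (simp add: det_transpose[OF eval_at_carrier])
  then obtain y where y: "y \<in> carrier_vec N" "y \<noteq> 0\<^sub>v N" "transpose_mat ?Q *\<^sub>v y = 0\<^sub>v N"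
    using det_0_iff_vec_prod_zero[of "transpose_mat ?Q" N] by auto
  have yQ: "(\<Sum>i<N. y $ i * ?Q $$ (i, s)) = 0" if s: "s < N" for s
  proof -
    have "(transpose_mat ?Q *\<^sub>v y) $ s = 0" using y(3) s by simp
    then show ?thesis
      using s y(1) carrier_matD[OF eval_at_carrier[of N q ?X]]
      by (simp add: scalar_prod_def atLeast0LessThan mult.commute)
  qed
  define \<psi> where "\<psi> m s = (\<Sum>i<N. y $ i * eval_at N m ?X $$ (i, s))" for m s
  have \<psi>_add: "\<psi> (a + b) s = \<psi> a s + \<psi> b s" if "s < N" for a b s
    using that by (simp add: \<psi>_def eval_entry_add[OF X] distrib_left sum.distrib)
  have \<psi>_0: "\<psi> 0 s = 0" if "s < N" for s
    using that by (simp add: \<psi>_def eval_entry_0)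
  have \<psi>_sum: "\<psi> (sum f A) s = (\<Sum>x\<in>A. \<psi> (f x) s)" if "s < N" for f s and A :: "'x set"
    using that by (induction A rule: infinite_finite_induct) (simp_all add: \<psi>_0 \<psi>_add)
  have \<psi>_scale: "\<psi> (scalar e * a) s = e * \<psi> a s" if "s < N" for e a s
    using that by (simp add: \<psi>_def eval_entry_scalar_mult[OF X] sum_distrib_left mult_ac)
  have \<psi>_Var: "\<psi> (a * Var j) s = (\<Sum>r<N. \<psi> a r * ?X j $$ (r, s))" if "s < N" for a j s
  proof -
    have "\<psi> (a * Var j) s = (\<Sum>i<N. \<Sum>r<N. y $ i * eval_at N a ?X $$ (i, r) * ?X j $$ (r, s))"
      using that by (simp add: \<psi>_def eval_entry_mult_Var[OF X] sum_distrib_left mult.assoc)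
    also have "\<dots> = (\<Sum>r<N. \<psi> a r * ?X j $$ (r, s))"
      unfolding \<psi>_def sum_distrib_right by (rule sum.swap)
    finally show ?thesis .
  qed
  have \<psi>_q: "\<psi> (q * scalar e) s = 0" if "s < N" for e s
  proof -
    have "\<psi> (q * scalar e) s = e * \<psi> q s" using \<psi>_scale[OF that, of e q] by (simp add: scalar_commute)
    then show ?thesis using yQ[OF that] by (simp add: \<psi>_def)
  qed
  have \<psi>_rec: "\<psi> m s = (\<Sum>j\<in>UNIV. \<Sum>r<N. \<psi> (dq q j m) r * ?X j $$ (r, s))" if "s < N" for m s
  proof -
    have "\<psi> m s = \<psi> ((\<Sum>j\<in>UNIV. dq q j m * Var j) + q * scalar (lookup m 0 / lookup q 0)) s"
      using dq_expansion[OF q0, of m] by simp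
    then show ?thesis using that by (simp add: \<psi>_add \<psi>_sum \<psi>_Var \<psi>_q)
  qed
  have \<psi>_dummy: "\<psi> m s = 0" if "n \<le> s" "s < N" for m s
    unfolding \<psi>_rec[OF that(2), of m] by (intro sum.neutral ballI) (simp add: that automaton_outside)
  obtain e where e: "\<And>u. length u < l \<Longrightarrow> e u < n \<and> d (e u) = u" "\<And>r. r < n \<Longrightarrow> e (d r) = r"
  proof -
    define e where "e = the_inv_into {..<n} d"
    have inj: "inj_on d {..<n}" and im: "d ` {..<n} = {w. length w < l}" using d by (simp_all add: bij_betw_def)
    have "e u < n \<and> d (e u) = u" if "length u < l" for u
      using the_inv_into_into[OF inj, of u "{..<n}"] f_the_inv_into_f[OF inj, of u] im that by (auto simp: e_def)
    moreover have "e (d r) = r" if "r < n" for r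
      using the_inv_into_f_f[OF inj, of r] that by (simp add: e_def)
    ultimately show thesis by (rule that)
  qed
  define \<Psi> where "\<Psi> m u = \<psi> m (e u)" for m u
  have \<Psi>_d: "\<psi> m r = \<Psi> m (d r)" if "r < n" for m r using e(2)[OF that] by (simp add: \<Psi>_def)
  have \<psi>_rec': "\<psi> m s = (\<Sum>j\<in>UNIV. \<Sum>r<n. \<Psi> (dq q j m) (d r) * ?X j $$ (r, s))" if s: "s < n" for m s
  proof -
    have "(\<Sum>r<N. \<psi> (dq q j m) r * ?X j $$ (r, s)) = (\<Sum>r<n. \<Psi> (dq q j m) (d r) * ?X j $$ (r, s))" for j
      by (subst sum_less_extend[OF nN]) (auto simp: \<psi>_dummy \<Psi>_d)
    then show ?thesis using \<psi>_rec[of s m] s nN by simp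
  qed
  have \<Psi>_snoc: "\<Psi> m (u @ [j]) = \<Psi> (dq q j m) u" if "length u + 1 < l" for m u j
  proof -
    have s: "e (u @ [j]) < n" "d (e (u @ [j])) = u @ [j]" using e(1)[of "u @ [j]"] that by auto
    have "\<Psi> m (u @ [j]) = (\<Sum>i\<in>UNIV. if j = i then \<Psi> (dq q i m) u else 0)"
      unfolding \<Psi>_def[of m] \<psi>_rec'[OF s(1)] automaton_col_sum[OF s(1)] s(2) by (simp cong: if_cong)
    then show ?thesis by simp
  qed
  have \<Psi>_dqs: "length u < l \<Longrightarrow> \<Psi> m u = \<Psi> (dqs q u m) []" for u m
  proof (induction u arbitrary: m rule: rev_induct)
    case (snoc j u)
    then show ?case by (simp add: \<Psi>_snoc dqs_append)
  qed simp
  have e0: "e [] < n" "d (e []) = []" using e(1)[of "[]"] l by auto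
  have \<Psi>_Nil: "\<Psi> m [] = \<Psi> (act q \<eta> m) []" for m
  proof -
    have "\<Psi> m [] = (\<Sum>j\<in>UNIV. \<Sum>u | length u < l. \<Psi> (dq q j m) u * c (u @ [j]))"
      unfolding \<Psi>_def[of m] \<psi>_rec'[OF e0(1)] automaton_col_sum[OF e0(1)] e0(2) by simp
    also have "\<dots> = (\<Sum>j\<in>UNIV. \<Sum>u | length u < l. c (u @ [j]) * \<Psi> (dqs q (u @ [j]) m) [])"
    proof (intro sum.cong refl)
      fix j :: 'n and u :: "'n list" assume "u \<in> {u. length u < l}"
      then have "\<Psi> (dq q j m) u = \<Psi> (dqs q (u @ [j]) m) []"
        using \<Psi>_dqs[of u "dq q j m"] by (simp add: dqs_append)
      then show "\<Psi> (dq q j m) u * c (u @ [j]) = c (u @ [j]) * \<Psi> (dqs q (u @ [j]) m) []"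
        by simp
    qed
    also have "\<dots> = (\<Sum>(j, u)\<in>UNIV \<times> {u. length u < l}. c (u @ [j]) * \<Psi> (dqs q (u @ [j]) m) [])"
      using finite_states by (simp add: sum.cartesian_product)
    also have "\<dots> = (\<Sum>w | w \<noteq> [] \<and> length w \<le> l. c w * \<Psi> (dqs q w m) [])"
      by (rule sum.reindex_bij_witness[of _ "\<lambda>w. (last w, butlast w)" "\<lambda>(j, u). u @ [j]"])
        (use l in auto)
    also have "\<dots> = \<Psi> (act q \<eta> m) []"
    proof -
      have "e [] < N" using e0 nN by simp
      then show ?thesis
        unfolding act_conv_lists[OF \<eta>0 \<eta>] \<Psi>_def by (simp add: \<psi>_sum \<psi>_scale c)
    qed
    finally show ?thesis .
  qed
  have \<psi>_W: "\<psi> m s = 0" if m: "m \<in> W" and s: "s < N" for m s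
  proof (cases "s < n")
    case True
    have "length (d s) < l" using bij_betwE[OF d] True by auto
    then have "\<psi> m s = \<Psi> (dqs q (d s) m) []"
      unfolding \<Psi>_d[OF True] by (rule \<Psi>_dqs)
    also have "\<dots> = \<Psi> (act q \<eta> (dqs q (d s) m)) []"
      by (rule \<Psi>_Nil)
    also have "act q \<eta> (dqs q (d s) m) = 0" using kill dq_stable_dqs[OF W(1) m] by blast
    finally show ?thesis using \<psi>_0[of "e []"] e0 nN by (simp add: \<Psi>_def)
  qed (use \<psi>_dummy s in simp)
  \<comment> \<open>Induction on the length after which all quotients are in \<open>W\<close>: each
    component of \<open>\<psi> m\<close> is a combination of components of the
    \<open>\<psi> (dq q j m)\<close>.\<close>
  have \<psi>_absorbed: "\<psi> m s = 0" if "\<forall>w. M \<le> length w \<longrightarrow> dqs q w m \<in> W" "s < N" for M m s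
    using that
  proof (induction M arbitrary: m s)
    case 0
    have "dqs q [] m \<in> W" using 0(1) by blast
    then show ?case using \<psi>_W 0(2) by simp
  next
    case (Suc M)
    have "\<forall>w. M \<le> length w \<longrightarrow> dqs q w (dq q j m) \<in> W" for j
    proof (intro allI impI)
      fix w :: "'n list" assume "M \<le> length w"
      then have "dqs q (w @ [j]) m \<in> W" using Suc.prems(1) by simp
      then show "dqs q w (dq q j m) \<in> W" by (simp add: dqs_append)
    qed
    then have "\<psi> (dq q j m) r = 0" if "r < N" for j r using Suc.IH that by blast
    then show ?case using \<psi>_rec[OF Suc.prems(2), of m] by simp
  qed
  have "y $ s = 0" if s: "s < N" for s
  proof -
    have "\<psi> 1 s = 0" using W(2) \<psi>_absorbed s unfolding absorbed_def by blast
    moreover have "\<psi> 1 s = (\<Sum>i<N. y $ i * (if i = s then 1 else 0))"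
      unfolding \<psi>_def using s eval_entry_scalar[OF X _ s, of _ 1] by (intro sum.cong) simp_all
    ultimately show ?thesis using s by (simp add: if_distrib[of "(*) _"] cong: if_cong)
  qed
  then have "y = 0\<^sub>v N" using y(1) by auto
  with y(2) show False ..
qed

end

section \<open>Specialization of rational functions at all but finitely many points\<close>

definition specializes :: "'k::field ratfun \<Rightarrow> ('k \<Rightarrow> 'k) \<Rightarrow> bool" where
  "specializes x F \<longleftrightarrow> (\<exists>\<phi> \<psi>. \<psi> \<noteq> 0 \<and> x = to_fract \<phi> / to_fract \<psi> \<and>
     (\<forall>\<^sub>F e in cofinite. F e = poly \<phi> e / poly \<psi> e))"

lemma eventually_poly_nonzero: "\<psi> \<noteq> 0 \<Longrightarrow> \<forall>\<^sub>F e in cofinite. poly \<psi> e \<noteq> (0 :: 'k::field)"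
  using poly_roots_finite[of \<psi>] by (simp add: eventually_cofinite)

lemma specializes_exists: "\<exists>F. specializes x F"
proof -
  obtain \<phi> \<psi> where "x = to_fract \<phi> / to_fract \<psi>" "\<psi> \<noteq> 0" by (rule ratfun_cases)
  then have "specializes x (\<lambda>e. poly \<phi> e / poly \<psi> e)"
    unfolding specializes_def by (intro exI[of _ \<phi>] exI[of _ \<psi>]) simp
  then show ?thesis by blast
qed

lemma specializes_const: "specializes (const c) (\<lambda>e. c)"
  unfolding specializes_def by (intro exI[of _ "[:c:]"] exI[of _ 1]) (simp add: const_def)

lemma specializes_ratvar: "specializes ratvar (\<lambda>e. e)"
  unfolding specializes_def by (intro exI[of _ "[:0, 1:]"] exI[of _ 1]) (simp add: ratvar_def)

lemma specializes_add:
  assumes "specializes x F" "specializes y G"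
  shows "specializes (x + y) (\<lambda>e. F e + G e)"
proof -
  obtain \<phi> \<psi> \<phi>' \<psi>' where *: "\<psi> \<noteq> 0" "x = to_fract \<phi> / to_fract \<psi>" "\<forall>\<^sub>F e in cofinite. F e = poly \<phi> e / poly \<psi> e"
    "\<psi>' \<noteq> 0" "y = to_fract \<phi>' / to_fract \<psi>'" "\<forall>\<^sub>F e in cofinite. G e = poly \<phi>' e / poly \<psi>' e"
    using assms by (auto simp: specializes_def)
  have "\<forall>\<^sub>F e in cofinite. F e + G e = poly (\<phi> * \<psi>' + \<phi>' * \<psi>) e / poly (\<psi> * \<psi>') e"
    using *(3,6) eventually_poly_nonzero[OF *(1)] eventually_poly_nonzero[OF *(4)]
    by eventually_elim (simp add: add_frac_eq)
  moreover have "x + y = to_fract (\<phi> * \<psi>' + \<phi>' * \<psi>) / to_fract (\<psi> * \<psi>')"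
    using *(1,2,4,5) by (simp add: add_frac_eq to_fract_mult to_fract_add)
  moreover have "\<psi> * \<psi>' \<noteq> 0" using *(1,4) by simp
  ultimately show ?thesis unfolding specializes_def by blast
qed

lemma specializes_mult:
  assumes "specializes x F" "specializes y G"
  shows "specializes (x * y) (\<lambda>e. F e * G e)"
proof -
  obtain \<phi> \<psi> \<phi>' \<psi>' where *: "\<psi> \<noteq> 0" "x = to_fract \<phi> / to_fract \<psi>" "\<forall>\<^sub>F e in cofinite. F e = poly \<phi> e / poly \<psi> e"
    "\<psi>' \<noteq> 0" "y = to_fract \<phi>' / to_fract \<psi>'" "\<forall>\<^sub>F e in cofinite. G e = poly \<phi>' e / poly \<psi>' e"
    using assms by (auto simp: specializes_def)
  have "\<forall>\<^sub>F e in cofinite. F e * G e = poly (\<phi> * \<phi>') e / poly (\<psi> * \<psi>') e"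
    using *(3,6) by eventually_elim simp
  moreover have "x * y = to_fract (\<phi> * \<phi>') / to_fract (\<psi> * \<psi>')"
    using *(2,5) by (simp add: to_fract_mult)
  moreover have "\<psi> * \<psi>' \<noteq> 0" using *(1,4) by simp
  ultimately show ?thesis unfolding specializes_def by blast
qed

lemma specializes_sum:
  "(\<And>i. i \<in> A \<Longrightarrow> specializes (x i) (F i)) \<Longrightarrow> specializes (\<Sum>i\<in>A. x i) (\<lambda>e. \<Sum>i\<in>A. F i e)"
  using specializes_const[of 0]
  by (induction A rule: infinite_finite_induct) (auto intro: specializes_add)

lemma specializes_prod:
  "(\<And>i. i \<in> A \<Longrightarrow> specializes (x i) (F i)) \<Longrightarrow> specializes (\<Prod>i\<in>A. x i) (\<lambda>e. \<Prod>i\<in>A. F i e)"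
  using specializes_const[of 1]
  by (induction A rule: infinite_finite_induct) (auto intro: specializes_mult)

text \<open>A numerator with cofinitely many zeros is the zero polynomial, since a field of
  characteristic 0 is infinite.\<close>

lemma specializes_zero_iff:
  fixes F :: "'k::field_char_0 \<Rightarrow> 'k"
  assumes "specializes x F"
  shows "x = 0 \<longleftrightarrow> (\<forall>\<^sub>F e in cofinite. F e = 0)"
proof -
  obtain \<phi> \<psi> where *: "\<psi> \<noteq> 0" "x = to_fract \<phi> / to_fract \<psi>" "\<forall>\<^sub>F e in cofinite. F e = poly \<phi> e / poly \<psi> e"
    using assms by (auto simp: specializes_def)
  have "x = 0 \<longleftrightarrow> \<phi> = 0" using *(1,2) by simp
  also have "\<dots> \<longleftrightarrow> (\<forall>\<^sub>F e in cofinite. F e = 0)"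
  proof
    assume "\<phi> = 0"
    with *(3) show "\<forall>\<^sub>F e in cofinite. F e = 0" by simp
  next
    assume "\<forall>\<^sub>F e in cofinite. F e = 0"
    with *(3) eventually_poly_nonzero[OF *(1)] have "\<forall>\<^sub>F e in cofinite. poly \<phi> e = 0"
      by eventually_elim simp
    then have "finite {e. poly \<phi> e \<noteq> 0}" by (simp add: eventually_cofinite)
    moreover have "UNIV = {e. poly \<phi> e \<noteq> 0} \<union> {e. poly \<phi> e = 0}" by auto
    ultimately have "infinite {e. poly \<phi> e = 0}"
      using infinite_UNIV_char_0[where ?'a = 'k] finite_UnI by fastforce
    then show "\<phi> = 0" using poly_roots_finite by blast
  qed
  finally show ?thesis .
qed

lemma specializes_det:
  fixes M :: "'k::field ratfun mat"
  assumes M: "M \<in> carrier_mat N N" "\<And>e. M' e \<in> carrier_mat N N"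
    and entry: "\<And>a b. a < N \<Longrightarrow> b < N \<Longrightarrow> specializes (M $$ (a, b)) (\<lambda>e. M' e $$ (a, b))"
  shows "specializes (det M) (\<lambda>e. det (M' e))"
proof -
  have sign: "specializes (signof p :: 'k ratfun) (\<lambda>e. signof p)" for p :: "nat \<Rightarrow> nat"
  proof -
    have "signof p = (const (signof p) :: 'k ratfun)" by (simp add: sign_def const_hom)
    then show ?thesis using specializes_const[of "signof p :: 'k"] by simp
  qed
  have perm: "p i < N" if "p permutes {0..<N}" "i < N" for p i
    using permutes_in_image[OF that(1), of i] that(2) by simp
  show ?thesis
    unfolding det_def'[OF M(1)] det_def'[OF M(2)]
    by (intro specializes_sum specializes_mult specializes_prod sign entry) (auto simp: perm)
qed

lemma specialize_matrix_tuple: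
  fixes X :: "'n \<Rightarrow> 'k::field ratfun mat"
  assumes X: "X \<in> matrix_tuples N"
  obtains Y where "\<And>e. Y e \<in> matrix_tuples N"
    "\<And>h a b. a < N \<Longrightarrow> b < N \<Longrightarrow> specializes (eval_at N (lift h) X $$ (a, b)) (\<lambda>e. eval_at N h (Y e) $$ (a, b))"
proof -
  have "\<forall>z. \<exists>F. specializes (X (fst z) $$ snd z) F" using specializes_exists by blast
  from choice[OF this] obtain F where F: "\<And>z. specializes (X (fst z) $$ snd z) (F z)" by blast
  define Y where "Y e j = mat N N (\<lambda>(a, b). F (j, (a, b)) e)" for e j
  have Y: "Y e \<in> matrix_tuples N" for e by (simp add: matrix_tuples_def Y_def)
  have XY: "specializes (X j $$ (a, b)) (\<lambda>e. Y e j $$ (a, b))" if "a < N" "b < N" for j a b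
    using F[of "(j, (a, b))"] that by (simp add: Y_def)
  have evw: "specializes (evw N w X $$ (a, b)) (\<lambda>e. evw N w (Y e) $$ (a, b))" if "a < N" "b < N" for w a b
    using that
  proof (induction w arbitrary: a)
    case Nil
    then show ?case using specializes_const[of "0 :: 'k"] specializes_const[of "1 :: 'k"] by simp
  next
    case (Cons j w)
    have "evw N (j # w) Z $$ (a, b) = (\<Sum>c<N. Z j $$ (a, c) * evw N w Z $$ (c, b))"
      if Z: "Z \<in> matrix_tuples N" for Z :: "'n \<Rightarrow> 'l::field mat"
    proof -
      have "evw N (j # w) Z $$ (a, b) = (Z j * evw N w Z) $$ (a, b)" by (simp add: evw_def)
      then show ?thesis
        using Cons.prems carrier_matD[OF evw_carrier[OF Z, of w]] carrier_matD[OF matrix_tuplesD[OF Z, of j]]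
        by (simp add: scalar_prod_def atLeast0LessThan)
    qed
    note evw_Cons = this
    show ?case unfolding evw_Cons[OF X] evw_Cons[OF Y]
      using Cons by (intro specializes_sum specializes_mult XY) auto
  qed
  have "specializes (eval_at N (lift h) X $$ (a, b)) (\<lambda>e. eval_at N h (Y e) $$ (a, b))"
    if ab: "a < N" "b < N" for h :: "('n, 'k) free_algebra" and a b
  proof -
    have keys: "keys (lift h) = keys h" by (auto simp: in_keys_iff)
    have "eval_at N (lift h) X $$ (a, b) =
        (\<Sum>w\<in>keys h. const (lookup h w) * evw N (letters w) X $$ (a, b))"
      using ab by (simp add: eval_at_eq_evm evm_def keys)
    moreover have "eval_at N h (Y e) $$ (a, b) =
        (\<Sum>w\<in>keys h. lookup h w * evw N (letters w) (Y e) $$ (a, b))" for e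
      using ab by (simp add: eval_at_eq_evm evm_def)
    ultimately show ?thesis
      using ab by (simp only:) (intro specializes_sum specializes_mult specializes_const evw)
  qed
  with Y show thesis by (rule that)
qed

text \<open>Setting the indeterminate to \<open>e\<close> in \<open>X\<close> gives tuples
  \<open>Y e\<close> over the base field. The determinant for \<open>shifted f\<close> vanishes
  exactly if \<open>e\<close> is an eigenvalue of \<open>f\<close> at \<open>Y e\<close> for almost
  all \<open>e\<close>; the tuple and the eigenvalue vary together.\<close>

lemma spectra_transfer:
  fixes f g :: "('n, 'k::field_char_0) free_algebra"
  assumes spec: "\<And>Y. Y \<in> matrix_tuples N \<Longrightarrow> spectrum (eval_at N f Y) = spectrum (eval_at N g Y)"
    and X: "X \<in> matrix_tuples N" and det: "det (eval_at N (shifted f) X) = 0"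
  shows "det (eval_at N (shifted g) X) = 0"
proof -
  obtain Y where Y: "\<And>e. Y e \<in> matrix_tuples N"
    and sp: "\<And>h a b. a < N \<Longrightarrow> b < N \<Longrightarrow> specializes (eval_at N (lift h) X $$ (a, b)) (\<lambda>e. eval_at N h (Y e) $$ (a, b))"
    using specialize_matrix_tuple[OF X] by blast
  have *: "det (eval_at N (shifted h) X) = 0 \<longleftrightarrow> (\<forall>\<^sub>F e in cofinite. e \<in> spectrum (eval_at N h (Y e)))"
    for h :: "('n, 'k) free_algebra"
  proof -
    have "specializes (det (eval_at N (shifted h) X)) (\<lambda>e. det (char_matrix (eval_at N h (Y e)) e))"
    proof (rule specializes_det[of _ N])
      fix a b assume ab: "a < N" "b < N"
      have "shifted h = lift h + scalar (- ratvar)" by (simp add: shifted_def scalar_uminus)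
      then have e1: "eval_at N (shifted h) X $$ (a, b) =
          eval_at N (lift h) X $$ (a, b) + (if a = b then const (- 1) * ratvar else const 0)"
        using ab by (simp add: eval_entry_add[OF X] eval_entry_scalar[OF X] const_hom)
      have e2: "char_matrix (eval_at N h (Y e)) e $$ (a, b) =
          eval_at N h (Y e) $$ (a, b) + (if a = b then (- 1) * e else 0)" for e
        using ab carrier_matD[OF eval_at_carrier[of N h "Y e"]] by (simp add: char_matrix_def)
      have e3: "specializes (if a = b then const (- 1) * ratvar else const 0) (\<lambda>e :: 'k. if a = b then (- 1) * e else 0)"
        using specializes_mult[OF specializes_const[of "- 1 :: 'k"] specializes_ratvar] specializes_const[of "0 :: 'k"]
        by (cases "a = b") simp_all
      show "specializes (eval_at N (shifted h) X $$ (a, b)) (\<lambda>e. char_matrix (eval_at N h (Y e)) e $$ (a, b))"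
        unfolding e1 e2 by (rule specializes_add[OF sp[OF ab] e3])
    qed simp_all
    from specializes_zero_iff[OF this] show ?thesis
      by (simp add: spectrum_def eigenvalue_det[OF eval_at_carrier])
  qed
  show ?thesis using det unfolding * by (simp add: spec[OF Y])
qed

section \<open>The theorem\<close>

lemma intertwined_of_equal_spectra:
  fixes f g :: "('n::finite, 'k::field_char_0) free_algebra"
  assumes f: "f \<notin> below (Suc 0)"
    and inf: "infinite {N. \<forall>Y :: 'n \<Rightarrow> 'k mat. Y \<in> matrix_tuples N \<longrightarrow>
      spectrum (eval_at N f Y) = spectrum (eval_at N g Y)}"
  shows "intertwined f g"
proof -
  let ?p = "shifted f" and ?q = "shifted g"
  note p0 = lookup_shifted_0[of f] and q0 = lookup_shifted_0[of g]
  obtain d where d: "ht f = Suc d" "d > 0"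
    using f unfolding below_iff_ht by (cases "ht f") auto
  have htp: "ht ?p = Suc d" using shifted_ht[OF f] d by simp
  then have "?p \<in> below (Suc d)" by (simp add: below_iff_ht)
  then obtain V where V: "simple_submodule ?p d V" using simple_submodule_exists d(2) by blast
  note V = simple_submoduleD[OF V]
  have Vp: "?p * h = 0" if "?p * h \<in> V" for h
  proof (rule multiple_below_imp_0)
    show "?p * h \<in> below d" using V(2) that by (rule subsetD)
  qed (simp add: htp)
  have subV: "fa.subspace V" using V(1) by (simp add: dq_stable_def)
  obtain W B where W: "dq_stable ?q W" "1 \<in> absorbed ?q W"
      "\<And>U'. dq_stable ?q U' \<Longrightarrow> U' \<subseteq> W \<Longrightarrow> U' \<noteq> {0} \<Longrightarrow> U' = W"
    and B: "finite B" "B \<subseteq> W" "W \<subseteq> fa.span B"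
  proof (cases "g \<in> below (Suc 0)")
    \<comment> \<open>For constant \<open>g\<close> the polynomial \<open>shifted g\<close> is a
      unit and its quotient module is zero, so \<open>W\<close> is the zero space with an empty
      spanning set.\<close>
    case True
    then obtain c where "g = scalar c" using below_1 by blast
    then have q: "?q = scalar (const c - ratvar)" by (simp add: shifted_def lift_scalar scalar_diff)
    moreover have "const c - ratvar \<noteq> 0" using ratvar_neq_const[of c] by auto
    ultimately have "?q * scalar (inverse (const c - ratvar)) = 1"
      by (simp add: scalar_mult[symmetric])
    then have "1 \<in> absorbed ?q {0}"
      using absorbed_mult_left[OF q0 dq_stable_zero, of "scalar (inverse (const c - ratvar))"] by simp
    moreover have "U' = {0}" if "dq_stable ?q U'" "U' \<subseteq> {0}" "U' \<noteq> {0}" for U'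
      using that fa.subspace_0 by (auto simp: dq_stable_def)
    ultimately show thesis by (intro that[of "{0}" "{}"] dq_stable_zero) auto
  next
    case False
    then obtain e where e: "ht g = Suc e" "e > 0"
      unfolding below_iff_ht by (cases "ht g") auto
    then have "?q \<in> below (Suc e)" using shifted_ht[OF False] by (simp add: below_iff_ht)
    then obtain W where "simple_submodule ?q e W" using simple_submodule_exists e(2) by blast
    note W = simple_submoduleD[OF this]
    have "0 \<in> W" using W(1) fa.subspace_0 by (auto simp: dq_stable_def)
    then obtain u where "u \<in> W" "u \<noteq> 0" using W(3) by blast
    then have one: "1 \<in> absorbed ?q W" by (rule one_absorbed_of_nonzero[OF e W(1,2)])
    obtain B where B: "B \<subseteq> W" "fa.independent B" "W \<subseteq> fa.span B" "card B = fa.dim W"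
      by (rule fa.basis_exists)
    have "B \<subseteq> below e" using B(1) W(2) by (rule subset_trans)
    then have "B \<subseteq> fa.span (short_monomials e)" by (rule subset_trans[OF _ below_subset_span])
    from fa.independent_span_bound[OF finite_short_monomials B(2) this] have "finite B"
      by (rule conjunct1)
    then show thesis by (intro that[of W B] W(1,4) one B(1,3))
  qed
  have span_kill: "act ?q \<eta> m = 0" if "m \<in> W" "\<And>b. b \<in> B \<Longrightarrow> act ?q \<eta> b = 0" for \<eta> m
  proof -
    have "fa.subspace {m. act ?q \<eta> m = 0}"
      by (auto simp: fa.subspace_def act_add act_scalar_mult)
    then have "fa.span B \<subseteq> {m. act ?q \<eta> m = 0}"
      using that(2) by (intro fa.span_minimal) auto
    then show ?thesis using that(1) B(3) by blast
  qed
  show ?thesis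
  proof (cases "\<exists>v\<in>V. \<exists>\<eta>. lookup \<eta> 0 = 0 \<and> (\<forall>m\<in>W. act ?q \<eta> m = 0) \<and> act ?p \<eta> v \<noteq> 0")
    case True
    then obtain v \<eta>0 where v: "v \<in> V" "lookup \<eta>0 0 = 0" "\<forall>m\<in>W. act ?q \<eta>0 m = 0" "act ?p \<eta>0 v \<noteq> 0"
      by blast
    define I where "I = {\<eta>. lookup \<eta> 0 = 0 \<and> (\<forall>m\<in>W. act ?q \<eta> m = 0)}"
    have "dq_stable ?p ((\<lambda>\<eta>. act ?p \<eta> v) ` I)"
      unfolding dq_stable_def fa.subspace_def
    proof (intro conjI ballI allI)
      show "0 \<in> (\<lambda>\<eta>. act ?p \<eta> v) ` I" by (rule image_eqI[of _ _ 0]) (simp_all add: I_def)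
      fix x y assume "x \<in> (\<lambda>\<eta>. act ?p \<eta> v) ` I" "y \<in> (\<lambda>\<eta>. act ?p \<eta> v) ` I"
      then obtain \<eta> \<theta> where "x = act ?p \<eta> v" "y = act ?p \<theta> v" "\<eta> \<in> I" "\<theta> \<in> I" by blast
      then show "x + y \<in> (\<lambda>\<eta>. act ?p \<eta> v) ` I"
        by (intro image_eqI[of _ _ "\<eta> + \<theta>"]) (auto simp: act_add_left I_def lookup_add)
    next
      fix c x assume "x \<in> (\<lambda>\<eta>. act ?p \<eta> v) ` I"
      then obtain \<eta> where "x = act ?p \<eta> v" "\<eta> \<in> I" by blast
      then show "scalar c * x \<in> (\<lambda>\<eta>. act ?p \<eta> v) ` I"
        by (intro image_eqI[of _ _ "scalar c * \<eta>"]) (auto simp: act_scalar_mult_left I_def)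
    next
      fix x j assume "x \<in> (\<lambda>\<eta>. act ?p \<eta> v) ` I"
      then obtain \<eta> where "x = act ?p \<eta> v" "\<eta> \<in> I" by blast
      then show "dq ?p j x \<in> (\<lambda>\<eta>. act ?p \<eta> v) ` I"
        by (intro image_eqI[of _ _ "Var j * \<eta>"]) (auto simp: act_Var_mult lookup_mult_0 I_def)
    qed
    moreover have "(\<lambda>\<eta>. act ?p \<eta> v) ` I \<subseteq> V" using act_in_stable[OF V(1) v(1)] by blast
    moreover have "(\<lambda>\<eta>. act ?p \<eta> v) ` I \<noteq> {0}" using v(2,3,4) by (auto simp: I_def)
    \<comment> \<open>The orbit of \<open>v\<close> under the annihilator of \<open>W\<close> is a
      nonzero submodule of the simple \<open>V\<close>, so it contains \<open>v\<close>
      itself.\<close>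
    ultimately have "(\<lambda>\<eta>. act ?p \<eta> v) ` I = V" by (rule V(4))
    then obtain \<eta> where \<eta>: "act ?p \<eta> v = v" "lookup \<eta> 0 = 0" "\<And>m. m \<in> W \<Longrightarrow> act ?q \<eta> m = 0"
      using v(1) by (auto simp: I_def image_iff set_eq_iff) metis
    have "v \<noteq> 0" using v(4) by auto
    obtain e where "\<eta> \<in> below e" using finite_below_exists by blast
    define l where "l = Suc e"
    have l: "l > 0" "\<eta> \<in> below (Suc l)" using below_mono[OF _ \<open>\<eta> \<in> below e\<close>] by (simp_all add: l_def)
    define n where "n = card {w :: 'n list. length w < l}"
    have "finite {w :: 'n list. length w < l}"
      by (rule finite_subset[OF _ finite_lists_length_le[of UNIV l]]) auto
    from ex_bij_betw_nat_finite[OF this] obtain dec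
      where dec: "bij_betw dec {..<n} {w :: 'n list. length w < l}"
      by (auto simp: n_def atLeast0LessThan)
    \<comment> \<open>The number \<open>n\<close> of states need not be a size at which the spectra
      agree; the padding bridges the gap.\<close>
    obtain N where N: "n \<le> N" and spec: "\<And>Y :: 'n \<Rightarrow> 'k mat. Y \<in> matrix_tuples N \<Longrightarrow>
        spectrum (eval_at N f Y) = spectrum (eval_at N g Y)"
      using inf unfolding infinite_nat_iff_unbounded_le by blast
    define X where "X = automaton N n dec (\<lambda>w. lookup \<eta> (Word w))"
    have "det (eval_at N ?p X) = 0"
      unfolding X_def by (rule automaton_singular[OF l(1) N dec p0 \<open>v \<noteq> 0\<close> \<eta>(1,2) l(2)]) simp
    then have "det (eval_at N ?q X) = 0"
      using spectra_transfer[of N f g, OF spec] by (simp add: X_def automaton_matrix_tuples)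
    moreover have "det (eval_at N ?q X) \<noteq> 0"
      unfolding X_def by (rule automaton_nonsingular[OF l(1) N dec q0 W(1,2) \<eta>(3,2) l(2)]) simp_all
    ultimately show ?thesis by contradiction
  next
    case False
    then have kill: "act ?p \<eta> v = 0"
      if "v \<in> V" "lookup \<eta> 0 = 0" "\<And>m. m \<in> W \<Longrightarrow> act ?q \<eta> m = 0" for v \<eta>
      using that by blast
    obtain v where v: "v \<in> V" "v \<noteq> 0" using V(3) fa.subspace_0[OF subV] by blast
    \<comment> \<open>This provides an element without constant term that moves \<open>v\<close> to
      something nonzero, namely a variable: if every quotient of \<open>v\<close> vanished,
      \<open>v\<close> would be a multiple of \<open>shifted f\<close>.\<close>
    have "\<exists>j. dq ?p j v \<noteq> 0"
    proof (rule ccontr)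
      assume "\<not> ?thesis"
      then have "v = ?p * scalar (lookup v 0 / lookup ?p 0)"
        using dq_expansion[OF p0, of v] by simp
      then show False using Vp v by metis
    qed
    then obtain j where "dq ?p j v \<noteq> 0" ..
    then have "act ?p (Var j) v \<noteq> 0" by (simp add: act_single)
    then have ex: "\<exists>\<eta>. lookup \<eta> 0 = 0 \<and> act ?p \<eta> v \<noteq> 0"
      using lookup_mult_Var_0[of 1 j] by auto
    have "act ?p \<eta> v = 0" if "lookup \<eta> 0 = 0" "\<And>b. b \<in> B \<Longrightarrow> act ?q \<eta> b = 0" for \<eta>
      using kill[OF v(1) that(1)] span_kill that(2) by blast
    then obtain b L \<eta>0 where L: "b \<in> B" "fa.subspace L"
      "\<And>\<eta> j. \<eta> \<in> L \<Longrightarrow> Var j * \<eta> \<in> L" "\<eta>0 \<in> L" "act ?p \<eta>0 v \<noteq> 0"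
      "\<And>\<eta>. \<eta> \<in> L \<Longrightarrow> act ?q \<eta> b = 0 \<Longrightarrow> act ?p \<eta> v = 0"
      using annihilator_dichotomy[OF B(1) ex] by (metis (no_types, lifting))
    have "b \<in> W" using L(1) B(2) by blast
    from homomorphism_extends[OF p0 q0 V(1) v(1) Vp W(1) this W(2,3) L(2-6)]
    obtain a h where "a * ?q = ?p * h" "\<nexists>h. a = ?p * h" by blast
    then show ?thesis by (rule intertwined_of_ratfun[OF f])
  qed
qed

lemma shared_eigenvalues_imp_intertwined:
  fixes f g :: "('n::finite, 'k::{alg_closed_field, field_char_0}) free_algebra"
  assumes inf: "infinite {k. \<exists>D :: ('n \<Rightarrow> 'k mat) set. zariski_dense k D \<and>
    (\<forall>X\<in>D. \<exists>c. eigenvalue (eval_at k f X) c \<and> eigenvalue (eval_at k g X) c)}"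
  shows "intertwined f g"
proof -
  let ?S = "{N. \<forall>Y :: 'n \<Rightarrow> 'k mat. Y \<in> matrix_tuples N \<longrightarrow> spectrum (eval_at N f Y) = spectrum (eval_at N g Y)}"
  have "infinite ?S"
  proof
    assume "finite ?S"
    \<comment> \<open>Size 0 is set aside, since the comparison of characteristic polynomials
      assumes a positive size.\<close>
    moreover have "{k. \<exists>D :: ('n \<Rightarrow> 'k mat) set. zariski_dense k D \<and>
      (\<forall>X\<in>D. \<exists>c. eigenvalue (eval_at k f X) c \<and> eigenvalue (eval_at k g X) c)} \<subseteq> insert 0 ?S" (is "?ratvar \<subseteq> _")
    proof
      fix k assume "k \<in> ?ratvar"
      then obtain D :: "('n \<Rightarrow> 'k mat) set" where D: "zariski_dense k D"
        "\<And>X. X \<in> D \<Longrightarrow> \<exists>c. eigenvalue (eval_at k f X) c \<and> eigenvalue (eval_at k g X) c" by blast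
      have "spectrum (eval_at k f Y) = spectrum (eval_at k g Y)" if "k > 0" "Y \<in> matrix_tuples k" for Y
        unfolding spectrum_root_char_poly[OF eval_at_carrier]
        using shared_eigenvalues_imp_char_poly_eq[OF D that] by simp
      then show "k \<in> insert 0 ?S" by blast
    qed
    ultimately show False using inf finite_subset by blast
  qed
  show ?thesis
  proof (cases "f \<in> below (Suc 0)")
    case False
    then show ?thesis using intertwined_of_equal_spectra \<open>infinite ?S\<close> by blast
  next
    \<comment> \<open>A constant \<open>f\<close> is central. If \<open>g\<close> is not constant,
      the previous lemma applies with the roles exchanged and cancellation gives g = f; two
      constants are compared at the zero matrices of a positive size.\<close>
    case True
    then obtain c where c: "f = scalar c" using below_1 by blast
    have "g = f"
    proof (cases "g \<in> below (Suc 0)")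
      case False
      have "infinite {N. \<forall>Y :: 'n \<Rightarrow> 'k mat. Y \<in> matrix_tuples N \<longrightarrow> spectrum (eval_at N g Y) = spectrum (eval_at N f Y)}"
        using \<open>infinite ?S\<close> by (simp add: eq_commute)
      then have "intertwined g f" using intertwined_of_equal_spectra[OF False] by blast
      then obtain a where a: "a \<noteq> 0" "g * a = a * f" by (auto simp: intertwined_def)
      then have "g * a = f * a" by (simp add: c scalar_commute)
      then show ?thesis using a(1) by (rule free_algebra_mult_right_cancel)
    next
      case True
      then obtain e where e: "g = scalar e" using below_1 by blast
      obtain N where N: "N \<ge> 1" "N \<in> ?S"
        using \<open>infinite ?S\<close> unfolding infinite_nat_iff_unbounded_le by blast
      define Y :: "'n \<Rightarrow> 'k mat" where "Y j = 0\<^sub>m N N" for j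
      have Y: "Y \<in> matrix_tuples N" by (simp add: matrix_tuples_def Y_def)
      have "spectrum (b \<cdot>\<^sub>m 1\<^sub>m N) = {b}" for b :: 'k
      proof -
        have "eigenvalue (b \<cdot>\<^sub>m 1\<^sub>m N) x \<longleftrightarrow> x = b" for x
        proof -
          have "char_matrix (b \<cdot>\<^sub>m 1\<^sub>m N) x = (b - x) \<cdot>\<^sub>m 1\<^sub>m N"
            by (rule eq_matI) (auto simp: char_matrix_def)
          then show ?thesis using N(1) by (auto simp: eigenvalue_det[of _ N])
        qed
        then show ?thesis by (simp add: spectrum_def set_eq_iff)
      qed
      then have "{c} = {e}"
        using N(2) Y by (simp add: c e eval_at_scalar[OF Y]) (metis eval_at_scalar singleton_inject)
      then show ?thesis by (simp add: c e)
    qed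
    then show ?thesis unfolding intertwined_def by (intro exI[of _ 1]) simp
  qed
qed

theorem theorem4p1:
  fixes f g :: "('n::finite, 'k::{alg_closed_field, field_char_0}) free_algebra"
  shows
    "(infinite {k::nat. \<exists>D :: ('n \<Rightarrow> 'k mat) set. zariski_dense k D \<and>
        (\<forall>X\<in>D. \<exists>c. eigenvalue (eval_at k f X) c \<and> eigenvalue (eval_at k g X) c)}
      \<longleftrightarrow> isospectral f g) \<and>
     (isospectral f g \<longleftrightarrow> intertwined f g) \<and>
     (intertwined f g \<longleftrightarrow>
       (\<exists>(l::nat) F. 1 \<le> l \<and> F 1 = f \<and> F l = g \<and>
         (\<forall>i. 1 \<le> i \<and> i \<le> l - 1 \<longrightarrow> elementary_intertwined (F i) (F (i + 1)))))"
proof -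
  let ?i = "infinite {k::nat. \<exists>D :: ('n \<Rightarrow> 'k mat) set. zariski_dense k D \<and>
        (\<forall>X\<in>D. \<exists>c. eigenvalue (eval_at k f X) c \<and> eigenvalue (eval_at k g X) c)}"
  let ?iv = "elementary_intertwined\<^sup>*\<^sup>* f g"
  \<comment> \<open>The cycle of implications is (i), (iii), (iv), (ii), (i).\<close>
  have "intertwined f g" if ?i
    using that by (rule shared_eigenvalues_imp_intertwined)
  moreover have ?iv if "intertwined f g"
    using that intertwined_imp_chain by (auto simp: intertwined_def)
  moreover have "isospectral f g" if ?iv
    using that by (rule chain_imp_isospectral)
  moreover have ?i if iso: "isospectral f g"
  proof -
    \<comment> \<open>All tuples serve as the dense set; size 0 is excluded because an empty matrix
      has no eigenvalue.\<close>
    have "{0<..} \<subseteq> {k::nat. \<exists>D :: ('n \<Rightarrow> 'k mat) set. zariski_dense k D \<and>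
        (\<forall>X\<in>D. \<exists>c. eigenvalue (eval_at k f X) c \<and> eigenvalue (eval_at k g X) c)}"
    proof
      fix k :: nat assume k: "k \<in> {0<..}"
      have "\<exists>c. eigenvalue (eval_at k f X) c \<and> eigenvalue (eval_at k g X) c"
        if X: "X \<in> matrix_tuples k" for X :: "'n \<Rightarrow> 'k mat"
      proof -
        obtain c where "eigenvalue (eval_at k f X) c"
          by (rule eigenvalue_exists[OF eval_at_carrier[of k f X]]) (use k in simp_all)
        moreover have "spectrum (eval_at k f X) = spectrum (eval_at k g X)"
          using iso X by (simp add: isospectral_def)
        ultimately show ?thesis by (auto simp: spectrum_def)
      qed
      then show "k \<in> {k::nat. \<exists>D :: ('n \<Rightarrow> 'k mat) set. zariski_dense k D \<and>
          (\<forall>X\<in>D. \<exists>c. eigenvalue (eval_at k f X) c \<and> eigenvalue (eval_at k g X) c)}"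
        using zariski_dense_matrix_tuples by blast
    qed
    then show ?thesis using infinite_Ioi finite_subset by blast
  qed
  ultimately show ?thesis unfolding rtranclp_iff_chain[symmetric] by blast
qed

end
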